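(* Let $n\ge 2$, let $\mathfrak{q}=\mathfrak{q}(n)$ be the queer Lie superalgebra, let $A$ be a commutative associative unital $\mathbb{C}$-algebra, and let $\psi\in\mathcal{L}(\mathfrak{h}\otimes A)$. The following conditions are equivalent: (1) The module $V(\psi)$ is quasifinite. (2) There exists a finite-codimensional ideal $I$ of $A$ such that $(\mathfrak{q}\otimes I)V(\psi)=0$. (3) There exists a finite-codimensional ideal $I$ of $A$ such that $\psi(\mathfrak{h}_{\bar 0}\otimes I)=0$. If $A$ is finitely generated, then conditions (1), (2) and (3) are also equivalent to: (4) The module $V(\psi)$ has finite support.
   Context: Everything is over $\mathbb{C}$. Modules over a Lie superalgebra are $\mathbb{Z}_2$-graded, submodules are graded, and irreducible means nonzero with no proper nonzero graded submodule. A homomorphism of modules is a linear map $f$ with $f(xm)=xf(m)$ for all $x,m$, not required to be homogeneous. Queer Lie superalgebra: let $\hat{\mathfrak{q}}(n)$ be the Lie superalgebra of block matrices $\begin{pmatrix}a&b\\ b&a\end{pmatrix}$ with $a,b$ complex $(n+1)\times(n+1)$ matrices; the even part is given by $b=0$, the odd part by $a=0$, and the bracket on homogeneous elements is $[x,y]=xy-(-1)^{|x||y|}yx$. Its derived subalgebra $\tilde{\mathfrak{q}}(n)$ consists of those matrices with $\operatorname{tr} b=0$, and $\mathfrak{q}(n)=\tilde{\mathfrak{q}}(n)/\mathbb{C}I_{2n+2}$. Let $\mathfrak{h}=\mathfrak{h}_{\bar 0}\oplus\mathfrak{h}_{\bar 1}$, where $\mathfrak{h}_{\bar 0}$ is the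 image of the matrices with $a$ diagonal traceless, $b=0$, and $\mathfrak{h}_{\bar 1}$ the image of those with $a=0$, $b$ diagonal traceless. Let $\mathfrak{n}^+$ be the image of the matrices with $a,b$ both strictly upper triangular, and $\mathfrak{b}=\mathfrak{h}\oplus\mathfrak{n}^+$. For a subalgebra $\mathfrak{s}\subseteq\mathfrak{q}$, $\mathfrak{s}\otimes A$ has grading $(\mathfrak{s}\otimes A)_j=\mathfrak{s}_j\otimes A$ and bracket $[x_1\otimes f_1,x_2\otimes f_2]=[x_1,x_2]\otimes f_1f_2$; $\mathfrak{q}$ is viewed in $\mathfrak{q}\otimes A$ as $\mathfrak{q}\otimes\mathbb{C}$. $\mathcal{L}(\mathfrak{h}\otimes A)$ is the set of $\psi\in(\mathfrak{h}_{\bar 0}\otimes A)^*$ such that $\psi(\mathfrak{h}_{\bar 0}\otimes I)=0$ for some finite-codimensional ideal $I\subseteq A$. For such $\psi$, $H(\psi)$ denotes the unique (up to isomorphism) irreducible finite-dimensional $\mathfrak{h}\otimes A$-module on which each $x\in\mathfrak{h}_{\bar 0}\otimes A$ acts as the scalar $\psi(x)$. Extend $H(\psi)$ to a $\mathfrak{b}\otimes A$-module by letting $\mathfrak{n}^+\otimes A$ act by zero, let $\bar V(\psi)=U(\mathfrak{q}\otimes A)\otimes_{U(\mathfrak{b}\otimes A)}H(\psi)$, let $N(\psi)$ be the unique maximal proper submodule of $\bar V(\psi)$, and set $V(\psi)=\bar V(\psi)/N(\psi)$. For a $\mathfrak{q}\otimes A$-module $V$ and $\mu\in\mathfrak{h}_{\bar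 0}^*$ put $V_\mu=\{v\in V: hv=\mu(h)v\ \forall h\in\mathfrak{h}_{\bar 0}\}$. $V$ is a weight module if $V=\bigoplus_{\mu\in\mathfrak{h}_{\bar 0}^*}V_\mu$; a weight module is quasifinite if all its weight spaces $V_\mu$ are finite-dimensional. $\operatorname{Ann}_A(V)$ is the sum of all ideals $I\subseteq A$ with $(\mathfrak{q}\otimes I)V=0$. The support of an ideal $I\subseteq A$ is the set of maximal ideals of $A$ containing $I$, and the support of $V$ is the support of $\operatorname{Ann}_A(V)$. *)

theory Defs
  imports "HOL-Analysis.Analysis" "HOL-Library.Z2" "HOL-Library.Poly_Mapping"
begin

section \<open>Complex vector spaces and algebras\<close>

class scaleC =
  fixes scaleC :: "complex \<Rightarrow> 'a \<Rightarrow> 'a"  (infixr \<open>*\<^sub>C\<close> 75)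

class complex_vector = scaleC + ab_group_add +
  assumes scaleC_add_right: "a *\<^sub>C (x + y) = a *\<^sub>C x + a *\<^sub>C y"
    and scaleC_add_left: "(a + b) *\<^sub>C x = a *\<^sub>C x + b *\<^sub>C x"
    and scaleC_scaleC: "a *\<^sub>C b *\<^sub>C x = (a * b) *\<^sub>C x"
    and scaleC_one: "1 *\<^sub>C x = x"

global_interpretation complex_vector: vector_space "scaleC :: complex \<Rightarrow> 'a \<Rightarrow> 'a::complex_vector"
  defines csubspace = complex_vector.subspace and cspan = complex_vector.span
  by unfold_locales
    (simp_all add: scaleC_add_right scaleC_add_left scaleC_scaleC scaleC_one)

abbreviation clinear :: "('a::complex_vector \<Rightarrow> 'b::complex_vector) \<Rightarrow> bool"
  where "clinear \<equiv> Vector_Spaces.linear scaleC scaleC"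

definition finite_dimensional :: "'a::complex_vector set \<Rightarrow> bool"
  where "finite_dimensional S \<longleftrightarrow> (\<exists>B. finite B \<and> S \<subseteq> cspan B)"

definition internal_direct_sum :: "'i set \<Rightarrow> ('i \<Rightarrow> 'a::complex_vector set) \<Rightarrow> bool"
  where "internal_direct_sum J F \<longleftrightarrow>
    (\<forall>i\<in>J. csubspace (F i)) \<and>
    cspan (\<Union>i\<in>J. F i) = UNIV \<and>
    (\<forall>i\<in>J. F i \<inter> cspan (\<Union>j\<in>J - {i}. F j) = {0})"

text \<open>The dual space of a subspace \<open>S\<close>. As functions are total, a functional on \<open>S\<close> is encoded by
  its extension by zero outside \<open>S\<close>, so that each functional has exactly one representative.\<close>

definition dual_space :: "'a::complex_vector set \<Rightarrow> ('a \<Rightarrow> complex) set"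
  where "dual_space S = {f.
    (\<forall>x\<in>S. \<forall>y\<in>S. f (x + y) = f x + f y) \<and> (\<forall>c. \<forall>x\<in>S. f (c *\<^sub>C x) = c * f x) \<and>
    (\<forall>x. x \<notin> S \<longrightarrow> f x = 0)}"

text \<open>Commutative associative unital algebras. The class \<open>comm_ring_1\<close> is avoided because it
  excludes the zero algebra.\<close>

class comm_complex_algebra_1 = complex_vector + comm_ring + comm_monoid_mult +
  assumes scaleC_mult_left: "(c *\<^sub>C x) * y = c *\<^sub>C (x * y)"

definition alg_ideal :: "'a::comm_complex_algebra_1 set \<Rightarrow> bool"
  where "alg_ideal I \<longleftrightarrow> 0 \<in> I \<and> (\<forall>x\<in>I. \<forall>y\<in>I. x + y \<in> I) \<and> (\<forall>a. \<forall>x\<in>I. a * x \<in> I)"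

lemma alg_ideal_csubspace:
  assumes "alg_ideal I" shows "csubspace I"
proof (rule complex_vector.subspaceI)
  fix c x assume x: "x \<in> I"
  have "c *\<^sub>C x = (c *\<^sub>C 1) * x" by (simp add: scaleC_mult_left)
  then show "c *\<^sub>C x \<in> I" using assms x unfolding alg_ideal_def by metis
qed (use assms in \<open>auto simp: alg_ideal_def\<close>)

definition finite_codimensional :: "'a::complex_vector set \<Rightarrow> bool"
  where "finite_codimensional W \<longleftrightarrow> (\<exists>B. finite B \<and> cspan (B \<union> W) = UNIV)"

definition maximal_ideal :: "'a::comm_complex_algebra_1 set \<Rightarrow> bool"
  where "maximal_ideal M \<longleftrightarrow> alg_ideal M \<and> M \<noteq> UNIV \<and>
    (\<forall>I. alg_ideal I \<and> M \<subseteq> I \<longrightarrow> I = M \<or> I = UNIV)"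

definition ideal_support :: "'a::comm_complex_algebra_1 set \<Rightarrow> 'a set set"
  where "ideal_support I = {M. maximal_ideal M \<and> I \<subseteq> M}"

definition subalgebra_1 :: "'a::comm_complex_algebra_1 set \<Rightarrow> bool"
  where "subalgebra_1 B \<longleftrightarrow> csubspace B \<and> 1 \<in> B \<and> (\<forall>x\<in>B. \<forall>y\<in>B. x * y \<in> B)"

definition finitely_generated_algebra :: "'a::comm_complex_algebra_1 itself \<Rightarrow> bool"
  where "finitely_generated_algebra _ \<longleftrightarrow> (\<exists>S::'a set. finite S \<and> subalgebra_1 hull S = UNIV)"


section \<open>Lie superalgebras\<close>

definition koszul_sign :: "bit \<Rightarrow> bit \<Rightarrow> complex"
  where "koszul_sign i j = (if i = 1 \<and> j = 1 then - 1 else 1)"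

text \<open>\<open>gr i\<close> is the homogeneous part of parity \<open>i\<close>; the type \<open>bit\<close> is the field with two elements.\<close>

class lie_superalgebra = complex_vector +
  fixes gr :: "bit \<Rightarrow> 'a set"
    and br :: "'a \<Rightarrow> 'a \<Rightarrow> 'a"
  assumes gr_zero: "0 \<in> gr i"
    and gr_add: "x \<in> gr i \<Longrightarrow> y \<in> gr i \<Longrightarrow> x + y \<in> gr i"
    and gr_scale: "x \<in> gr i \<Longrightarrow> c *\<^sub>C x \<in> gr i"
    and gr_decomp: "\<exists>y\<in>gr 0. \<exists>z\<in>gr 1. x = y + z"
    and gr_disjoint: "x \<in> gr 0 \<Longrightarrow> x \<in> gr 1 \<Longrightarrow> x = 0"
    and br_add_left: "br (x + y) z = br x z + br y z"
    and br_add_right: "br x (y + z) = br x y + br x z"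
    and br_scale_left: "br (c *\<^sub>C x) y = c *\<^sub>C br x y"
    and br_scale_right: "br x (c *\<^sub>C y) = c *\<^sub>C br x y"
    and br_gr: "x \<in> gr i \<Longrightarrow> y \<in> gr j \<Longrightarrow> br x y \<in> gr (i + j)"
    and br_skew: "x \<in> gr i \<Longrightarrow> y \<in> gr j \<Longrightarrow> br x y = - (koszul_sign i j *\<^sub>C br y x)"
    and br_jacobi: "x \<in> gr i \<Longrightarrow> y \<in> gr j \<Longrightarrow>
      br x (br y z) = br (br x y) z + koszul_sign i j *\<^sub>C br y (br x z)"

section \<open>Free vector spaces and tensor products\<close>

instantiation complex :: complex_vector
begin
definition scaleC_complex :: "complex \<Rightarrow> complex \<Rightarrow> complex" where "scaleC_complex = (*)"
instance by standard (auto simp: scaleC_complex_def algebra_simps)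
end

instantiation poly_mapping :: (type, complex_vector) complex_vector
begin
lift_definition scaleC_poly_mapping :: "complex \<Rightarrow> ('a \<Rightarrow>\<^sub>0 'b) \<Rightarrow> 'a \<Rightarrow>\<^sub>0 'b"
  is "\<lambda>c f k. c *\<^sub>C f k"
  by (rule finite_subset[rotated]) (auto intro: complex_vector.scale_zero_right)
instance
  by standard (transfer; simp add: fun_eq_iff scaleC_add_right scaleC_add_left scaleC_scaleC scaleC_one)+
end

abbreviation basis_elt :: "'k \<Rightarrow> 'k \<Rightarrow>\<^sub>0 complex"
  where "basis_elt k \<equiv> Poly_Mapping.single k 1"

definition tensor_relations :: "('x::complex_vector \<times> 'y::complex_vector \<Rightarrow>\<^sub>0 complex) set"
  where "tensor_relations = cspan (
    {basis_elt (x + x', y) - basis_elt (x, y) - basis_elt (x', y) | x x' y. True} \<union>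
    {basis_elt (x, y + y') - basis_elt (x, y) - basis_elt (x, y') | x y y'. True} \<union>
    {basis_elt (c *\<^sub>C x, y) - c *\<^sub>C basis_elt (x, y) | c x y. True} \<union>
    {basis_elt (x, c *\<^sub>C y) - c *\<^sub>C basis_elt (x, y) | c x y. True})"

lemma equivp_mod_subspace: "csubspace W \<Longrightarrow> equivp (\<lambda>p q. p - q \<in> W)"
proof (rule equivpI)
  assume W: "csubspace W"
  show "reflp (\<lambda>p q. p - q \<in> W)"
    using W by (auto intro!: reflpI simp: complex_vector.subspace_0)
  show "symp (\<lambda>p q. p - q \<in> W)"
    by (rule sympI) (metis W complex_vector.subspace_neg minus_diff_eq)
  show "transp (\<lambda>p q. p - q \<in> W)"
    by (rule transpI) (metis W complex_vector.subspace_add diff_add_cancel add_diff_eq)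
qed

lemma mod_subspace_add: "csubspace W \<Longrightarrow> p - q \<in> W \<Longrightarrow> p' - q' \<in> W \<Longrightarrow> (p + p') - (q + q') \<in> W"
  using complex_vector.subspace_add[of W "p - q" "p' - q'"] by (simp add: algebra_simps)

lemma mod_subspace_diff: "csubspace W \<Longrightarrow> p - q \<in> W \<Longrightarrow> p' - q' \<in> W \<Longrightarrow> (p - p') - (q - q') \<in> W"
  using complex_vector.subspace_diff[of W "p - q" "p' - q'"] by (simp add: algebra_simps)

lemma mod_subspace_uminus: "csubspace W \<Longrightarrow> p - q \<in> W \<Longrightarrow> - p - - q \<in> W"
  using complex_vector.subspace_neg[of W "p - q"] by (simp add: algebra_simps)

lemma mod_subspace_scale: "csubspace W \<Longrightarrow> p - q \<in> W \<Longrightarrow> c *\<^sub>C p - c *\<^sub>C q \<in> W"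
  using complex_vector.subspace_scale[of W "p - q" c]
  by (simp add: complex_vector.scale_right_diff_distrib)

lemma csubspace_tensor_relations: "csubspace tensor_relations"
  unfolding tensor_relations_def by (rule complex_vector.subspace_span)

quotient_type (overloaded) ('x, 'y) tensor =
  "'x::complex_vector \<times> 'y::complex_vector \<Rightarrow>\<^sub>0 complex" / "\<lambda>p q. p - q \<in> tensor_relations"
  by (rule equivp_mod_subspace[OF csubspace_tensor_relations])

instantiation tensor :: (complex_vector, complex_vector) complex_vector
begin
lift_definition zero_tensor :: "('a, 'b) tensor" is 0 .
lift_definition plus_tensor :: "('a, 'b) tensor \<Rightarrow> ('a, 'b) tensor \<Rightarrow> ('a, 'b) tensor" is "(+)"
  by (rule mod_subspace_add[OF csubspace_tensor_relations])
lift_definition minus_tensor :: "('a, 'b) tensor \<Rightarrow> ('a, 'b) tensor \<Rightarrow> ('a, 'b) tensor" is "(-)"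
  by (rule mod_subspace_diff[OF csubspace_tensor_relations])
lift_definition uminus_tensor :: "('a, 'b) tensor \<Rightarrow> ('a, 'b) tensor" is uminus
  by (rule mod_subspace_uminus[OF csubspace_tensor_relations])
lift_definition scaleC_tensor :: "complex \<Rightarrow> ('a, 'b) tensor \<Rightarrow> ('a, 'b) tensor" is scaleC
  by (rule mod_subspace_scale[OF csubspace_tensor_relations])
instance
  by standard
    (transfer; simp add: complex_vector.subspace_0[OF csubspace_tensor_relations] algebra_simps
      scaleC_add_right scaleC_add_left scaleC_scaleC scaleC_one)+
end

lift_definition tens :: "'x::complex_vector \<Rightarrow> 'y::complex_vector \<Rightarrow> ('x, 'y) tensor"  (infixl \<open>\<otimes>\<^sub>t\<close> 70)
  is "\<lambda>x y. basis_elt (x, y)" .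


definition tensor_span :: "'x::complex_vector set \<Rightarrow> 'y::complex_vector set \<Rightarrow> ('x, 'y) tensor set"
  where "tensor_span S T = cspan {x \<otimes>\<^sub>t y | x y. x \<in> S \<and> y \<in> T}"

definition cbilinear ::
  "('x::complex_vector \<Rightarrow> 'y::complex_vector \<Rightarrow> 'z::complex_vector) \<Rightarrow> bool"
  where "cbilinear B \<longleftrightarrow> (\<forall>x. clinear (B x)) \<and> (\<forall>y. clinear (\<lambda>x. B x y))"

definition free_lift :: "('k \<Rightarrow> 'z::complex_vector) \<Rightarrow> ('k \<Rightarrow>\<^sub>0 complex) \<Rightarrow> 'z"
  where "free_lift b p = (\<Sum>k\<in>Poly_Mapping.keys p. Poly_Mapping.lookup p k *\<^sub>C b k)"

text \<open>The linear map induced by a bilinear map \<open>B\<close>. The choice of representative is immaterial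
  precisely because \<open>B\<close> is bilinear.\<close>

definition tensor_lift ::
  "('x::complex_vector \<Rightarrow> 'y::complex_vector \<Rightarrow> 'z::complex_vector) \<Rightarrow> ('x, 'y) tensor \<Rightarrow> 'z"
  where "tensor_lift B t = free_lift (\<lambda>(x, y). B x y) (rep_tensor t)"

lemma clinearI:
  "(\<And>x y. f (x + y) = f x + f y) \<Longrightarrow> (\<And>c x. f (c *\<^sub>C x) = c *\<^sub>C f x) \<Longrightarrow> clinear f"
  by unfold_locales auto

lemma clinear_add: "clinear f \<Longrightarrow> f (x + y) = f x + f y"
  by (rule Vector_Spaces.linear.axioms(3)[THEN module_hom.add]) 

lemma clinear_scale: "clinear f \<Longrightarrow> f (c *\<^sub>C x) = c *\<^sub>C f x"
  by (rule Vector_Spaces.linear.axioms(3)[THEN module_hom.scale])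

lemma clinear_diff: "clinear f \<Longrightarrow> f (x - y) = f x - f y"
  by (rule Vector_Spaces.linear.axioms(3)[THEN module_hom.diff])

lemma csubspace_kernel: "clinear f \<Longrightarrow> csubspace {x. f x = 0}"
  by (rule complex_vector.subspaceI)
    (auto simp: clinear_add clinear_scale clinear_scale[of f 0 0, simplified])

lemma free_lift_superset:
  assumes "finite K" "Poly_Mapping.keys p \<subseteq> K"
  shows "free_lift b p = (\<Sum>k\<in>K. Poly_Mapping.lookup p k *\<^sub>C b k)"
  unfolding free_lift_def using assms
  by (intro sum.mono_neutral_left) (auto simp: in_keys_iff)

lemma lookup_scaleC: "Poly_Mapping.lookup (c *\<^sub>C p) k = c *\<^sub>C Poly_Mapping.lookup p k"
  by transfer simp

lemma clinear_free_lift: "clinear (free_lift b)"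
proof (rule clinearI)
  fix p q :: "'a \<Rightarrow>\<^sub>0 complex" and c
  let ?K = "Poly_Mapping.keys p \<union> Poly_Mapping.keys q"
  have "free_lift b (p + q) = (\<Sum>k\<in>?K. Poly_Mapping.lookup (p + q) k *\<^sub>C b k)"
    by (rule free_lift_superset) (auto simp: Poly_Mapping.keys_add)
  also have "\<dots> = (\<Sum>k\<in>?K. Poly_Mapping.lookup p k *\<^sub>C b k) + (\<Sum>k\<in>?K. Poly_Mapping.lookup q k *\<^sub>C b k)"
    by (simp add: lookup_add scaleC_add_left sum.distrib)
  also have "\<dots> = free_lift b p + free_lift b q"
    by (subst (1 2) free_lift_superset[of ?K]) auto
  finally show "free_lift b (p + q) = free_lift b p + free_lift b q" .
  have "free_lift b (c *\<^sub>C p) = (\<Sum>k\<in>Poly_Mapping.keys p. Poly_Mapping.lookup (c *\<^sub>C p) k *\<^sub>C b k)"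
    by (rule free_lift_superset) (auto simp: in_keys_iff lookup_scaleC scaleC_complex_def)
  then show "free_lift b (c *\<^sub>C p) = c *\<^sub>C free_lift b p"
    by (simp add: free_lift_def lookup_scaleC scaleC_complex_def
        complex_vector.scale_sum_right)
qed

lemma free_lift_basis: "free_lift b (basis_elt k) = b k"
  by (simp add: free_lift_def scaleC_one)

lemma free_lift_tensor_relations:
  assumes "cbilinear B" "p \<in> tensor_relations"
  shows "free_lift (\<lambda>(x, y). B x y) p = 0"
proof -
  let ?f = "free_lift (\<lambda>(x, y). B x y)"
  have l: "clinear ?f" by (rule clinear_free_lift)
  have r: "clinear (B x)" "clinear (\<lambda>x. B x y)" for x y
    using assms(1) by (auto simp: cbilinear_def)
  have "tensor_relations \<subseteq> {p. ?f p = 0}"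
    unfolding tensor_relations_def
    by (rule complex_vector.span_minimal[OF _ csubspace_kernel[OF l]])
      (auto simp: clinear_diff[OF l] clinear_scale[OF l] free_lift_basis r clinear_add[OF r(1)]
        clinear_add[OF r(2)] clinear_scale[OF r(1)] clinear_scale[OF r(2)])
  then show ?thesis using assms(2) by auto
qed

lemma abs_rep_tensor: "abs_tensor (rep_tensor t) = t"
  by (rule Quotient3_abs_rep[OF Quotient3_tensor])

lemma tensor_lift_abs:
  assumes "cbilinear B"
  shows "tensor_lift B (abs_tensor p) = free_lift (\<lambda>(x, y). B x y) p"
proof -
  have "rep_tensor (abs_tensor p) - p \<in> tensor_relations"
    using abs_rep_tensor[of "abs_tensor p"] by (simp add: tensor.abs_eq_iff)
  from free_lift_tensor_relations[OF assms this] show ?thesis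
    unfolding tensor_lift_def clinear_diff[OF clinear_free_lift] by (rule eq_iff_diff_eq_0[THEN iffD2])
qed

lemma clinear_tensor_lift:
  assumes "cbilinear B" shows "clinear (tensor_lift B)"
proof (rule clinearI)
  fix s t :: "('a, 'b) tensor" and c
  show "tensor_lift B (s + t) = tensor_lift B s + tensor_lift B t"
    by (induct s, induct t)
      (simp add: plus_tensor.abs_eq tensor_lift_abs[OF assms] clinear_add[OF clinear_free_lift])
  show "tensor_lift B (c *\<^sub>C t) = c *\<^sub>C tensor_lift B t"
    by (induct t)
      (simp add: scaleC_tensor.abs_eq tensor_lift_abs[OF assms] clinear_scale[OF clinear_free_lift])
qed

lemma tensor_lift_tens: "cbilinear B \<Longrightarrow> tensor_lift B (x \<otimes>\<^sub>t y) = B x y"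
  by (simp add: tens.abs_eq tensor_lift_abs free_lift_basis)

lemma tensor_lift_add_fun:
  "tensor_lift (\<lambda>x y. B x y + C x y) t = tensor_lift B t + tensor_lift C t"
  by (simp add: tensor_lift_def free_lift_def case_prod_beta scaleC_add_right sum.distrib)

lemma tensor_lift_scale_fun:
  "tensor_lift (\<lambda>x y. c *\<^sub>C B x y) t = c *\<^sub>C tensor_lift B t"
  by (simp add: tensor_lift_def free_lift_def case_prod_beta complex_vector.scale_sum_right
      mult.commute)

lemma tens_add_left: "(x + x') \<otimes>\<^sub>t y = x \<otimes>\<^sub>t y + x' \<otimes>\<^sub>t y"
  by (transfer, unfold tensor_relations_def, rule complex_vector.span_base)
    (force simp: diff_diff_eq)

lemma tens_add_right: "x \<otimes>\<^sub>t (y + y') = x \<otimes>\<^sub>t y + x \<otimes>\<^sub>t y'"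
  by (transfer, unfold tensor_relations_def, rule complex_vector.span_base)
    (force simp: diff_diff_eq)

lemma tens_scale_left: "(c *\<^sub>C x) \<otimes>\<^sub>t y = c *\<^sub>C (x \<otimes>\<^sub>t y)"
  by (transfer, unfold tensor_relations_def, rule complex_vector.span_base) blast

lemma tens_scale_right: "x \<otimes>\<^sub>t (c *\<^sub>C y) = c *\<^sub>C (x \<otimes>\<^sub>t y)"
  by (transfer, unfold tensor_relations_def, rule complex_vector.span_base) blast

lemma tensor_span_UNIV: "tensor_span UNIV UNIV = UNIV"
proof -
  have "abs_tensor p \<in> tensor_span UNIV UNIV" for p :: "'a \<times> 'b \<Rightarrow>\<^sub>0 complex"
  proof (induct p rule: update_induct)
    case const
    show ?case
      by (simp add: zero_tensor.abs_eq[symmetric] tensor_span_def complex_vector.span_zero)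
  next
    case (update p k v)
    have "Poly_Mapping.update k v p = p + v *\<^sub>C basis_elt k"
      using update(1)
      by (intro poly_mapping_eqI)
        (auto simp: lookup_update lookup_add lookup_scaleC lookup_single scaleC_complex_def
          when_def in_keys_iff)
    then have "abs_tensor (Poly_Mapping.update k v p) = abs_tensor p + v *\<^sub>C (fst k \<otimes>\<^sub>t snd k)"
      by (simp add: scaleC_tensor.abs_eq tens.abs_eq plus_tensor.abs_eq)
    moreover have "v *\<^sub>C (fst k \<otimes>\<^sub>t snd k) \<in> tensor_span UNIV UNIV"
      unfolding tensor_span_def
      by (intro complex_vector.span_scale complex_vector.span_base) auto
    ultimately show ?case
      using complex_vector.span_add update(3) unfolding tensor_span_def by simp
  qed
  then show ?thesis
    by (metis (no_types) UNIV_eq_I abs_rep_tensor)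
qed

lemma tensor_induct [case_names tens add]:
  assumes "\<And>x y. P (x \<otimes>\<^sub>t y)" "\<And>s t. P s \<Longrightarrow> P t \<Longrightarrow> P (s + t)"
  shows "P t"
proof -
  have "t \<in> tensor_span UNIV UNIV" by (simp add: tensor_span_UNIV)
  then show ?thesis unfolding tensor_span_def
  proof (induct rule: complex_vector.span_induct_alt)
    case base
    have "(0::('a, 'b) tensor) = (0 *\<^sub>C 0) \<otimes>\<^sub>t 0"
      by (subst tens_scale_left) simp
    then show ?case using assms(1) by metis
  next
    case (step c x y)
    then obtain a b where "x = a \<otimes>\<^sub>t b" by auto
    then have "P (c *\<^sub>C x)" using assms(1) by (simp add: tens_scale_left[symmetric])
    then show ?case using assms(2) step by simp
  qed
qed


section \<open>The Lie superalgebra \<open>\<gg> \<otimes> A\<close>\<close>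

lemma scaleC_mult_right: "x * (c *\<^sub>C y) = c *\<^sub>C (x * y)" for x :: "'a::comm_complex_algebra_1"
  by (metis mult.commute scaleC_mult_left)

definition even_part :: "'g::lie_superalgebra \<Rightarrow> 'g"
  where "even_part x = (THE y. y \<in> gr 0 \<and> x - y \<in> gr 1)"

lemma even_part_eq:
  assumes "y \<in> gr 0" "z \<in> gr 1" shows "even_part (y + z) = y"
  unfolding even_part_def
proof (rule the_equality)
  fix y' assume y': "y' \<in> gr 0 \<and> y + z - y' \<in> gr 1"
  have "y' + - 1 *\<^sub>C y \<in> gr 0" using y' assms gr_add gr_scale by blast
  moreover have "z + - 1 *\<^sub>C (y + z - y') \<in> gr 1" using y' assms gr_add gr_scale by blast
  moreover have "z + - 1 *\<^sub>C (y + z - y') = y' + - 1 *\<^sub>C y"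
    by (simp add: complex_vector.scale_minus_left)
  ultimately show "y' = y"
    using gr_disjoint[of "y' + - 1 *\<^sub>C y"] by (simp add: complex_vector.scale_minus_left)
qed (use assms in auto)

lemma clinear_even_part: "clinear even_part"
proof (rule clinearI)
  fix x x' :: 'a and c
  obtain y z where x: "x = y + z" "y \<in> gr 0" "z \<in> gr 1" using gr_decomp by blast
  obtain y' z' where x': "x' = y' + z'" "y' \<in> gr 0" "z' \<in> gr 1" using gr_decomp by blast
  have e: "x + x' = (y + y') + (z + z')" by (simp add: x x')
  show "even_part (x + x') = even_part x + even_part x'"
    unfolding e using x x' by (simp only: even_part_eq gr_add)
  have e: "c *\<^sub>C x = c *\<^sub>C y + c *\<^sub>C z" by (simp add: x scaleC_add_right)
  show "even_part (c *\<^sub>C x) = c *\<^sub>C even_part x"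
    unfolding e using x by (simp only: even_part_eq gr_scale)
qed

instantiation tensor :: (lie_superalgebra, comm_complex_algebra_1) lie_superalgebra
begin

definition gr_tensor :: "bit \<Rightarrow> ('a, 'b) tensor set"
  where "gr_tensor i = tensor_span (gr i) UNIV"

definition br_tensor :: "('a, 'b) tensor \<Rightarrow> ('a, 'b) tensor \<Rightarrow> ('a, 'b) tensor"
  where "br_tensor s t =
    tensor_lift (\<lambda>x f. tensor_lift (\<lambda>y g. br x y \<otimes>\<^sub>t (f * g)) t) s"

lemma cbilinear_br_inner: "cbilinear (\<lambda>y g. br x y \<otimes>\<^sub>t (f * g))"
  for x :: 'a and f :: 'b
  unfolding cbilinear_def
  by (intro conjI allI clinearI)
    (simp_all add: br_add_right br_scale_right distrib_left scaleC_mult_right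
      tens_add_left tens_add_right tens_scale_left tens_scale_right)

lemma cbilinear_br_outer: "cbilinear (\<lambda>x f. tensor_lift (\<lambda>y g. br x y \<otimes>\<^sub>t (f * g)) t)"
  for t :: "('a, 'b) tensor"
  unfolding cbilinear_def
  by (intro conjI allI clinearI)
    (simp_all add: br_add_left br_scale_left distrib_right scaleC_mult_left
      tens_add_left tens_add_right tens_scale_left tens_scale_right
      tensor_lift_add_fun tensor_lift_scale_fun)

lemma br_tens: "br (x \<otimes>\<^sub>t f) (y \<otimes>\<^sub>t g) = br x y \<otimes>\<^sub>t (f * g)"
  for x y :: 'a and f g :: 'b
  unfolding br_tensor_def tensor_lift_tens[OF cbilinear_br_outer]
  by (rule tensor_lift_tens[OF cbilinear_br_inner])

lemma br_tensor_add_left: "br (s + s') t = br s t + br s' t" for s t :: "('a, 'b) tensor"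
  by (simp add: br_tensor_def clinear_add[OF clinear_tensor_lift[OF cbilinear_br_outer]])

lemma br_tensor_scale_left: "br (c *\<^sub>C s) t = c *\<^sub>C br s t" for s t :: "('a, 'b) tensor"
  by (simp add: br_tensor_def clinear_scale[OF clinear_tensor_lift[OF cbilinear_br_outer]])

lemma br_tensor_add_right: "br s (t + t') = br s t + br s t'" for s t :: "('a, 'b) tensor"
  by (simp add: br_tensor_def clinear_add[OF clinear_tensor_lift[OF cbilinear_br_inner]]
      tensor_lift_add_fun)

lemma br_tensor_scale_right: "br s (c *\<^sub>C t) = c *\<^sub>C br s t" for s t :: "('a, 'b) tensor"
  by (simp add: br_tensor_def clinear_scale[OF clinear_tensor_lift[OF cbilinear_br_inner]]
      tensor_lift_scale_fun)

lemmas br_tensor_bilinear =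
  br_tensor_add_left br_tensor_scale_left br_tensor_add_right br_tensor_scale_right

lemma br_tensor_zero: "br 0 t = 0" "br t 0 = 0" for t :: "('a, 'b) tensor"
  using br_tensor_scale_left[of 0 0 t] br_tensor_scale_right[of t 0 0] by simp_all

lemma gr_tensor_induct [consumes 1, case_names zero tens add]:
  fixes t :: "('a, 'b) tensor"
  assumes "t \<in> gr i" "P 0" "\<And>x f. x \<in> gr i \<Longrightarrow> P (x \<otimes>\<^sub>t f)" "\<And>s t. P s \<Longrightarrow> P t \<Longrightarrow> P (s + t)"
  shows "P t"
  using assms(1) unfolding gr_tensor_def tensor_span_def
proof (induct rule: complex_vector.span_induct_alt)
  case (step c x y)
  then obtain a f where "x = a \<otimes>\<^sub>t f" "a \<in> gr i" by auto
  then have "P (c *\<^sub>C x)" using assms(3)[of "c *\<^sub>C a" f] by (simp add: tens_scale_left gr_scale)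
  then show ?case using assms(4) step by simp
qed (rule assms(2))

lemma tens_in_gr: "x \<in> gr i \<Longrightarrow> x \<otimes>\<^sub>t f \<in> gr i" for x :: 'a and f :: 'b
  unfolding gr_tensor_def tensor_span_def by (auto intro!: complex_vector.span_base)

lemma csubspace_gr_tensor: "csubspace (gr i :: ('a, 'b) tensor set)"
  unfolding gr_tensor_def tensor_span_def by (rule complex_vector.subspace_span)

instance
proof
  fix x y z :: "('a, 'b) tensor" and i j c
  show "0 \<in> (gr i :: ('a, 'b) tensor set)"
    by (rule complex_vector.subspace_0[OF csubspace_gr_tensor])
  show "x \<in> gr i \<Longrightarrow> y \<in> gr i \<Longrightarrow> x + y \<in> gr i"
    by (rule complex_vector.subspace_add[OF csubspace_gr_tensor])
  show "x \<in> gr i \<Longrightarrow> c *\<^sub>C x \<in> gr i"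
    by (rule complex_vector.subspace_scale[OF csubspace_gr_tensor])
  show "\<exists>y\<in>gr 0. \<exists>z\<in>gr 1. x = y + z"
  proof (induct x rule: tensor_induct)
    case (tens a f)
    obtain b c where "b \<in> gr 0" "c \<in> gr 1" "a = b + c" using gr_decomp by blast
    then show ?case
      by (intro bexI[of _ "b \<otimes>\<^sub>t f"] bexI[of _ "c \<otimes>\<^sub>t f"]) (simp_all add: tens_in_gr tens_add_left)
  next
    case (add s t)
    then obtain a b a' b' where "a \<in> gr 0" "b \<in> gr 1" "s = a + b" "a' \<in> gr 0" "b' \<in> gr 1" "t = a' + b'"
      by blast
    then have "a + a' \<in> gr 0" "b + b' \<in> gr 1" "s + t = (a + a') + (b + b')"
      using complex_vector.subspace_add[OF csubspace_gr_tensor] by auto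
    then show ?case by blast
  qed
  let ?E = "tensor_lift (\<lambda>x f. even_part x \<otimes>\<^sub>t f) :: ('a, 'b) tensor \<Rightarrow> ('a, 'b) tensor"
  have bil: "cbilinear (\<lambda>(x::'a) (f::'b). even_part x \<otimes>\<^sub>t f)"
    unfolding cbilinear_def
    by (intro conjI allI clinearI)
      (simp_all add: clinear_add[OF clinear_even_part] clinear_scale[OF clinear_even_part]
        tens_add_left tens_add_right tens_scale_left tens_scale_right)
  note lin = clinear_tensor_lift[OF bil]
  have lin0: "?E 0 = 0" using clinear_scale[OF lin, of 0 0] by simp
  show "x = 0" if "x \<in> gr 0" "x \<in> gr 1"
  proof -
    have "?E x = x" using that(1)
    proof (induct rule: gr_tensor_induct)
      case (tens a f)
      then show ?case using even_part_eq[OF tens gr_zero] by (simp add: tensor_lift_tens[OF bil])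
    qed (simp_all add: lin0 clinear_add[OF lin])
    moreover have "?E x = 0" using that(2)
    proof (induct rule: gr_tensor_induct)
      case (tens a f)
      have "(0::'a) \<otimes>\<^sub>t f = 0" using tens_scale_left[of 0 "0::'a" f] by simp
      then show ?case using even_part_eq[OF gr_zero tens] by (simp add: tensor_lift_tens[OF bil])
    qed (simp_all add: lin0 clinear_add[OF lin])
    ultimately show ?thesis by simp
  qed
  show "br x y \<in> gr (i + j)" if "x \<in> gr i" "y \<in> gr j"
    using that(1)
  proof (induct rule: gr_tensor_induct)
    case (tens a f)
    show ?case using that(2)
    proof (induct rule: gr_tensor_induct)
      case (tens b g)
      show ?case unfolding br_tens by (intro tens_in_gr br_gr \<open>a \<in> gr i\<close> tens)
    qed (simp_all only: br_tensor_zero br_tensor_bilinear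
        complex_vector.subspace_0[OF csubspace_gr_tensor]
        complex_vector.subspace_add[OF csubspace_gr_tensor])
  qed (simp_all only: br_tensor_zero br_tensor_bilinear
        complex_vector.subspace_0[OF csubspace_gr_tensor]
        complex_vector.subspace_add[OF csubspace_gr_tensor])
  show "br x y = - (koszul_sign i j *\<^sub>C br y x)" if "x \<in> gr i" "y \<in> gr j"
    using that(1)
  proof (induct rule: gr_tensor_induct)
    case (tens a f)
    show ?case using that(2)
    proof (induct rule: gr_tensor_induct)
      case (tens b g)
      have "br a b = (- koszul_sign i j) *\<^sub>C br b a"
        using br_skew[OF \<open>a \<in> gr i\<close> \<open>b \<in> gr j\<close>] by (simp add: complex_vector.scale_minus_left)
      then have "br a b \<otimes>\<^sub>t (f * g) = (- koszul_sign i j) *\<^sub>C (br b a \<otimes>\<^sub>t (f * g))"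
        by (simp only: tens_scale_left)
      then show ?case
        by (simp add: br_tens complex_vector.scale_minus_left mult.commute)
    qed (auto simp: br_tensor_zero br_tensor_bilinear scaleC_add_right)
  qed (auto simp: br_tensor_zero br_tensor_bilinear scaleC_add_right)
  show "br x (br y z) = br (br x y) z + koszul_sign i j *\<^sub>C br y (br x z)"
    if "x \<in> gr i" "y \<in> gr j"
    using that(1)
  proof (induct rule: gr_tensor_induct)
    case (tens a f)
    show ?case using that(2)
    proof (induct rule: gr_tensor_induct)
      case (tens b g)
      show ?case
      proof (induct z rule: tensor_induct)
        case (tens d h)
        show ?case
          by (simp add: br_tens br_jacobi[OF \<open>a \<in> gr i\<close> \<open>b \<in> gr j\<close>] tens_add_left tens_scale_left
              mult.assoc mult.left_commute)
      qed (auto simp: br_tensor_bilinear scaleC_add_right)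
    qed (auto simp: br_tensor_zero br_tensor_bilinear scaleC_add_right)
  qed (auto simp: br_tensor_zero br_tensor_bilinear scaleC_add_right)
qed (rule br_tensor_bilinear)+

end


section \<open>The queer Lie superalgebra\<close>

instantiation vec :: (complex_vector, finite) complex_vector
begin
definition scaleC_vec :: "complex \<Rightarrow> 'a ^ 'b \<Rightarrow> 'a ^ 'b" where "scaleC_vec c v = (\<chi> i. c *\<^sub>C (v $ i))"
instance
  by standard
    (simp_all add: scaleC_vec_def vec_eq_iff scaleC_add_right scaleC_add_left scaleC_scaleC scaleC_one)
end

instantiation prod :: (complex_vector, complex_vector) complex_vector
begin
definition scaleC_prod :: "complex \<Rightarrow> 'a \<times> 'b \<Rightarrow> 'a \<times> 'b"
  where "scaleC_prod c p = (c *\<^sub>C fst p, c *\<^sub>C snd p)"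
instance
  by standard
    (simp_all add: scaleC_prod_def prod_eq_iff scaleC_add_right scaleC_add_left scaleC_scaleC scaleC_one)
end

text \<open>The pair \<open>(a, b)\<close> stands for the block matrix with blocks \<open>a, b\<close> in the first and \<open>b, a\<close> in the
  second row. The index type has \<open>n + 1\<close> elements.\<close>

type_synonym 'n qpair = "(complex ^ 'n ^ 'n) \<times> (complex ^ 'n ^ 'n)"

definition block :: "'n::finite qpair \<Rightarrow> complex ^ ('n + 'n) ^ ('n + 'n)"
  where "block p = (\<chi> i j. case (i, j) of
      (Inl k, Inl l) \<Rightarrow> fst p $ k $ l | (Inl k, Inr l) \<Rightarrow> snd p $ k $ l
    | (Inr k, Inl l) \<Rightarrow> snd p $ k $ l | (Inr k, Inr l) \<Rightarrow> fst p $ k $ l)"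

text \<open>The bilinear extension of \<open>xy - (-1)^(|x||y|) yx\<close>; the sign is \<open>+\<close> only for the product of the
  two odd parts.\<close>

definition qbr :: "'n::finite qpair \<Rightarrow> 'n qpair \<Rightarrow> 'n qpair"
  where "qbr p q = (case (p, q) of ((a, b), (a', b')) \<Rightarrow>
    (a ** a' - a' ** a + (b ** b' + b' ** b), a ** b' - b' ** a + (b ** a' - a' ** b)))"

lemma block_mult: "block (a, b) ** block (a', b') = block (a ** a' + b ** b', a ** b' + b ** a')"
proof -
  have s: "(\<Sum>k\<in>UNIV. f k) = (\<Sum>k\<in>UNIV. f (Inl k)) + (\<Sum>k\<in>UNIV. f (Inr k))"
    for f :: "'a + 'a \<Rightarrow> complex"
    using sum.Plus[of "UNIV :: 'a set" "UNIV :: 'a set" f] by (simp only: UNIV_Plus_UNIV finite comp_def)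
  show ?thesis
  proof (simp only: vec_eq_iff, intro allI)
    fix i j :: "'a + 'a"
    show "(block (a, b) ** block (a', b')) $ i $ j
        = block (a ** a' + b ** b', a ** b' + b ** a') $ i $ j"
      by (cases i; cases j) (simp_all add: block_def matrix_matrix_mult_def s)
  qed
qed

lemma sum_all: "(\<forall>x. P x) \<longleftrightarrow> (\<forall>y. P (Inl y)) \<and> (\<forall>z. P (Inr z))"
  by (metis sum.exhaust)

lemma block_qbr:
  "block (qbr (a, 0) (a', 0)) = block (a, 0) ** block (a', 0) - block (a', 0) ** block (a, 0)"
  "block (qbr (a, 0) (0, b')) = block (a, 0) ** block (0, b') - block (0, b') ** block (a, 0)"
  "block (qbr (0, b) (a', 0)) = block (0, b) ** block (a', 0) - block (a', 0) ** block (0, b)"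
  "block (qbr (0, b) (0, b')) = block (0, b) ** block (0, b') + block (0, b') ** block (0, b)"
  unfolding block_mult
  by (auto simp: block_def qbr_def vec_eq_iff sum_all)

lemma matrix_diff_ldistrib: "A ** (B - C) = A ** B - A ** C" for A B C :: "complex ^ 'n ^ 'n"
  by (vector matrix_matrix_mult_def sum_subtractf[symmetric] field_simps)

lemma matrix_diff_rdistrib: "(B - C) ** A = B ** A - C ** A" for A B C :: "complex ^ 'n ^ 'n"
  by (vector matrix_matrix_mult_def sum_subtractf[symmetric] field_simps)

lemma matrix_scaleC_left: "(c *\<^sub>C A) ** B = c *\<^sub>C (A ** B)" for A B :: "complex ^ 'n ^ 'n"
  by (simp add: matrix_matrix_mult_def vec_eq_iff scaleC_vec_def scaleC_complex_def sum_distrib_left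
      mult.assoc)

lemma matrix_scaleC_right: "A ** (c *\<^sub>C B) = c *\<^sub>C (A ** B)" for A B :: "complex ^ 'n ^ 'n"
  by (simp add: matrix_matrix_mult_def vec_eq_iff scaleC_vec_def scaleC_complex_def sum_distrib_left
      mult.left_commute)

lemma matrix_add_rdistrib: "(B + C) ** A = B ** A + C ** A" for A B C :: "complex ^ 'n ^ 'n"
  by (vector matrix_matrix_mult_def sum.distrib[symmetric] field_simps)

lemma trace_scaleC: "trace (c *\<^sub>C A) = c * trace A" for A :: "complex ^ 'n ^ 'n"
  by (simp add: trace_def scaleC_vec_def scaleC_complex_def sum_distrib_left)

lemma trace_zero: "trace (0 :: complex ^ 'n ^ 'n) = 0"
  by (simp add: trace_def)

text \<open>Both pairs lie in the derived subalgebra (odd block traceless) and differ by a multiple of the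
  identity matrix.\<close>

definition queer_rel :: "'n::finite qpair \<Rightarrow> 'n qpair \<Rightarrow> bool"
  where "queer_rel p q \<longleftrightarrow> trace (snd p) = 0 \<and> trace (snd q) = 0 \<and>
    (\<exists>c. p - q = c *\<^sub>C (mat 1, 0))"

quotient_type 'n queer = "'n::finite qpair" / partial: queer_rel
proof (rule part_equivpI)
  show "\<exists>p::'n qpair. queer_rel p p"
    by (rule exI[of _ 0]) (auto simp: queer_rel_def trace_zero intro: exI[of _ 0])
  show "symp (queer_rel :: 'n qpair \<Rightarrow> _)"
  proof (rule sympI)
    fix p q :: "'n qpair" assume pq: "queer_rel p q"
    then obtain c where "p - q = c *\<^sub>C (mat 1, 0)" by (auto simp: queer_rel_def)
    then have "q - p = (- c) *\<^sub>C (mat 1, 0)" by (metis complex_vector.scale_minus_left minus_diff_eq)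
    then show "queer_rel q p" using pq unfolding queer_rel_def by blast
  qed
  show "transp (queer_rel :: 'n qpair \<Rightarrow> _)"
  proof (rule transpI)
    fix p q r :: "'n qpair" assume pq: "queer_rel p q" "queer_rel q r"
    then obtain c d where "p - q = c *\<^sub>C (mat 1, 0)" "q - r = d *\<^sub>C (mat 1, 0)"
      by (auto simp: queer_rel_def)
    moreover have "p - r = (p - q) + (q - r)" by simp
    ultimately have "p - r = (c + d) *\<^sub>C (mat 1, 0)" by (simp only: scaleC_add_left)
    then show "queer_rel p r" using pq unfolding queer_rel_def by blast
  qed
qed

lemma queer_relE:
  assumes "queer_rel p q"
  obtains c where "trace (snd p) = 0" "trace (snd q) = 0" "p = q + c *\<^sub>C (mat 1, 0)"
proof -
  obtain c where c: "p - q = c *\<^sub>C (mat 1, 0)" using assms unfolding queer_rel_def by blast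
  have "p = q + (p - q)" by simp
  with c have "p = q + c *\<^sub>C (mat 1, 0)" by (simp only:)
  with that assms show ?thesis unfolding queer_rel_def by blast
qed

lemma queer_relI: "trace (snd q) = 0 \<Longrightarrow> p = q + c *\<^sub>C (mat 1, 0) \<Longrightarrow> queer_rel p q"
  by (auto simp: queer_rel_def scaleC_prod_def)

lemma qbr_shift: "qbr (p + c *\<^sub>C (mat 1, 0)) (q + d *\<^sub>C (mat 1, 0)) = qbr p q"
  by (cases p, cases q)
    (simp add: qbr_def scaleC_prod_def matrix_add_ldistrib matrix_add_rdistrib
      matrix_scaleC_left matrix_scaleC_right)

lemma trace_qbr: "trace (snd (qbr p q)) = 0"
proof (cases p, cases q)
  fix a b a' b' assume "p = (a, b)" "q = (a', b')"
  then show ?thesis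
    using trace_mul_sym[of a b'] trace_mul_sym[of b a']
    by (simp add: qbr_def trace_add trace_sub)
qed

instantiation queer :: (finite) lie_superalgebra
begin

lift_definition zero_queer :: "'a queer" is 0
  by (rule queer_relI[of _ _ 0]) (simp_all add: trace_zero)

lift_definition plus_queer :: "'a queer \<Rightarrow> 'a queer \<Rightarrow> 'a queer" is "(+)"
proof -
  fix p p' q q' :: "'a qpair"
  assume "queer_rel p p'" "queer_rel q q'"
  then obtain c d where "trace (snd p') = 0" "trace (snd q') = 0"
    "p = p' + c *\<^sub>C (mat 1, 0)" "q = q' + d *\<^sub>C (mat 1, 0)"
    by (elim queer_relE)
  then show "queer_rel (p + q) (p' + q')"
    by (intro queer_relI[of _ _ "c + d"]) (simp_all add: trace_add scaleC_add_left)
qed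

lift_definition minus_queer :: "'a queer \<Rightarrow> 'a queer \<Rightarrow> 'a queer" is "(-)"
proof -
  fix p p' q q' :: "'a qpair"
  assume "queer_rel p p'" "queer_rel q q'"
  then obtain c d where "trace (snd p') = 0" "trace (snd q') = 0"
    "p = p' + c *\<^sub>C (mat 1, 0)" "q = q' + d *\<^sub>C (mat 1, 0)"
    by (elim queer_relE)
  then show "queer_rel (p - q) (p' - q')"
    by (intro queer_relI[of _ _ "c - d"])
      (simp_all add: trace_sub complex_vector.scale_left_diff_distrib)
qed

lift_definition uminus_queer :: "'a queer \<Rightarrow> 'a queer" is uminus
proof -
  fix p p' :: "'a qpair"
  assume "queer_rel p p'"
  then obtain c where "trace (snd p') = 0" "p = p' + c *\<^sub>C (mat 1, 0)"
    by (elim queer_relE)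
  then show "queer_rel (- p) (- p')"
    using trace_sub[of 0 "snd p'"]
    by (intro queer_relI[of _ _ "- c"]) (simp_all add: trace_zero complex_vector.scale_minus_left)
qed

lift_definition scaleC_queer :: "complex \<Rightarrow> 'a queer \<Rightarrow> 'a queer" is scaleC
proof -
  fix d and p p' :: "'a qpair"
  assume "queer_rel p p'"
  then obtain c where c: "trace (snd p') = 0" "p = p' + c *\<^sub>C (mat 1, 0)"
    by (elim queer_relE)
  show "queer_rel (d *\<^sub>C p) (d *\<^sub>C p')"
  proof (rule queer_relI)
    show "trace (snd (d *\<^sub>C p')) = 0" using c by (simp add: scaleC_prod_def trace_scaleC)
    show "d *\<^sub>C p = d *\<^sub>C p' + (d * c) *\<^sub>C (mat 1, 0)" by (simp add: c scaleC_add_right)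
  qed
qed

lift_definition br_queer :: "'a queer \<Rightarrow> 'a queer \<Rightarrow> 'a queer" is qbr
proof -
  fix p p' q q' :: "'a qpair"
  assume "queer_rel p p'" "queer_rel q q'"
  then obtain c d where "p = p' + c *\<^sub>C (mat 1, 0)" "q = q' + d *\<^sub>C (mat 1, 0)"
    by (elim queer_relE)
  then show "queer_rel (qbr p q) (qbr p' q')"
    by (intro queer_relI[of _ _ 0]) (simp_all add: qbr_shift trace_qbr)
qed

definition gr_queer :: "bit \<Rightarrow> 'a queer set"
  where "gr_queer i = (if i = 0 then {abs_queer (a, 0) | a. True}
    else {abs_queer (0, b) | b. trace b = 0})"

lemma queer_relI': "trace (snd p) = 0 \<Longrightarrow> p = q \<Longrightarrow> queer_rel p q"
  by (rule queer_relI[of _ _ 0]) simp_all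

lemma queer_cases:
  obtains a b where "x = abs_queer (a, b)" "trace b = 0"
proof -
  have "queer_rel (rep_queer x) (rep_queer x)" "abs_queer (rep_queer x) = x"
    using Quotient3_rep_reflp[OF Quotient3_queer] Quotient3_abs_rep[OF Quotient3_queer] by auto
  then show ?thesis using that[of "fst (rep_queer x)" "snd (rep_queer x)"]
    by (auto simp: queer_rel_def)
qed

lemma queer_abs_ops:
  "trace b = 0 \<Longrightarrow> trace b' = 0 \<Longrightarrow> abs_queer (a, b) + abs_queer (a', b') = abs_queer (a + a', b + b')"
  "trace b = 0 \<Longrightarrow> trace b' = 0 \<Longrightarrow> abs_queer (a, b) - abs_queer (a', b') = abs_queer (a - a', b - b')"
  "trace b = 0 \<Longrightarrow> - abs_queer (a, b) = abs_queer (- a, - b)"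
  "trace b = 0 \<Longrightarrow> c *\<^sub>C abs_queer (a, b) = abs_queer (c *\<^sub>C a, c *\<^sub>C b)"
  "trace b = 0 \<Longrightarrow> trace b' = 0 \<Longrightarrow>
    br (abs_queer (a, b)) (abs_queer (a', b')) = abs_queer (qbr (a, b) (a', b'))"
  by (simp_all add: plus_queer.abs_eq minus_queer.abs_eq uminus_queer.abs_eq scaleC_queer.abs_eq
      br_queer.abs_eq queer_relI' scaleC_prod_def)

lemma queer_abs_eq:
  "trace b = 0 \<Longrightarrow> trace b' = 0 \<Longrightarrow>
    abs_queer (a, b) = abs_queer (a', b') \<longleftrightarrow> (\<exists>c. a - a' = c *\<^sub>C mat 1) \<and> b = b'"
  using Quotient3_rel[OF Quotient3_queer, of "(a, b)" "(a', b')"]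
    queer_relI'[of "(a, b)" "(a, b)"] queer_relI'[of "(a', b')" "(a', b')"]
  by (simp add: queer_rel_def scaleC_prod_def)

lemma gr_queer_cases:
  assumes "x \<in> gr i"
  obtains a where "i = 0" "x = abs_queer (a, 0)" | b where "i = 1" "x = abs_queer (0, b)" "trace b = 0"
  using assms by (cases i) (auto simp: gr_queer_def)

lemma zero_queer_eq: "0 = abs_queer (0, 0)"
  by (simp add: zero_queer.abs_eq zero_prod_def)

lemma qbr_bilinear:
  "qbr (p + p') q = qbr p q + qbr p' q" "qbr q (p + p') = qbr q p + qbr q p'"
  "qbr (c *\<^sub>C p) q = c *\<^sub>C qbr p q" "qbr q (c *\<^sub>C p) = c *\<^sub>C qbr q p"
  by (cases p, cases p', cases q;
      simp add: qbr_def scaleC_prod_def matrix_add_ldistrib matrix_add_rdistrib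
        matrix_scaleC_left matrix_scaleC_right complex_vector.scale_right_diff_distrib
        scaleC_add_right)+

lemma qbr_jacobi:
  fixes a b c a' b' c' :: "complex ^ 'n ^ 'n"
  shows "qbr (a, 0) (qbr (b, 0) (c, c')) = qbr (qbr (a, 0) (b, 0)) (c, c') + qbr (b, 0) (qbr (a, 0) (c, c'))"
    and "qbr (a, 0) (qbr (0, b') (c, c')) = qbr (qbr (a, 0) (0, b')) (c, c') + qbr (0, b') (qbr (a, 0) (c, c'))"
    and "qbr (0, a') (qbr (b, 0) (c, c')) = qbr (qbr (0, a') (b, 0)) (c, c') + qbr (b, 0) (qbr (0, a') (c, c'))"
    and "qbr (0, a') (qbr (0, b') (c, c')) = qbr (qbr (0, a') (0, b')) (c, c') - qbr (0, b') (qbr (0, a') (c, c'))"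
  by (simp_all add: qbr_def matrix_add_ldistrib matrix_add_rdistrib matrix_diff_ldistrib
      matrix_diff_rdistrib matrix_mul_assoc)

lemma abs_queer_plus:
  "trace (snd p) = 0 \<Longrightarrow> trace (snd q) = 0 \<Longrightarrow> abs_queer (p + q) = abs_queer p + abs_queer q"
  by (simp add: plus_queer.abs_eq queer_relI')

lemma abs_queer_scale: "trace (snd p) = 0 \<Longrightarrow> abs_queer (c *\<^sub>C p) = c *\<^sub>C abs_queer p"
  by (simp add: scaleC_queer.abs_eq queer_relI')

lemma abs_queer_br:
  "trace (snd p) = 0 \<Longrightarrow> trace (snd q) = 0 \<Longrightarrow> abs_queer (qbr p q) = br (abs_queer p) (abs_queer q)"
  by (simp add: br_queer.abs_eq queer_relI')

lemma snd_scaleC_prod: "snd (c *\<^sub>C p) = c *\<^sub>C snd p"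
  by (simp add: scaleC_prod_def)

lemma trace_mul_diff: "trace (A ** B - B ** A) = 0" for A B :: "complex ^ 'n ^ 'n"
  using trace_mul_sym[of A B] by (simp add: trace_sub)

instance
proof
  fix x y z :: "'a queer" and c d and i j :: bit
  obtain a b where x: "x = abs_queer (a, b)" "trace b = 0" by (rule queer_cases)
  obtain a' b' where y: "y = abs_queer (a', b')" "trace b' = 0" by (rule queer_cases)
  obtain a'' b'' where z: "z = abs_queer (a'', b'')" "trace b'' = 0" by (rule queer_cases)
  note t = trace_add trace_sub trace_scaleC trace_zero
  note m = matrix_add_ldistrib matrix_add_rdistrib matrix_scaleC_left matrix_scaleC_right
  show "x + y + z = x + (y + z)" "x + y = y + x"
    by (simp_all add: x y z queer_abs_ops t ac_simps)
  show "0 + x = x" "- x + x = 0"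
    using trace_sub[of 0 b] by (simp_all add: x zero_queer_eq queer_abs_ops t)
  show "x - y = x + - y"
    using trace_sub[of 0 b'] by (simp add: x y queer_abs_ops t)
  show "c *\<^sub>C (x + y) = c *\<^sub>C x + c *\<^sub>C y" "(c + d) *\<^sub>C x = c *\<^sub>C x + d *\<^sub>C x"
    "c *\<^sub>C d *\<^sub>C x = (c * d) *\<^sub>C x" "1 *\<^sub>C x = x"
    by (simp_all add: x y queer_abs_ops t scaleC_add_left scaleC_add_right)
  show "br (x + y) z = br x z + br y z" "br z (x + y) = br z x + br z y"
    "br (c *\<^sub>C x) y = c *\<^sub>C br x y" "br x (c *\<^sub>C y) = c *\<^sub>C br x y"
    using x(2) y(2) z(2)
    by (simp_all add: x(1) y(1) z(1) abs_queer_br[symmetric] abs_queer_plus[symmetric]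
        abs_queer_scale[symmetric] trace_qbr qbr_bilinear t snd_scaleC_prod del: add_Pair)
  show "0 \<in> (gr i :: 'a queer set)" by (auto simp: gr_queer_def zero_queer_eq t)
  show "\<exists>y\<in>gr 0. \<exists>z\<in>gr 1. x = y + z"
    by (rule bexI[of _ "abs_queer (a, 0)"], rule bexI[of _ "abs_queer (0, b)"])
      (use x in \<open>auto simp: gr_queer_def queer_abs_ops t\<close>)
  show "x + y \<in> gr i" if "x \<in> gr i" "y \<in> gr i"
    using that by (elim gr_queer_cases) (auto simp: gr_queer_def queer_abs_ops t)
  show "c *\<^sub>C x \<in> gr i" if "x \<in> gr i"
    using that by (elim gr_queer_cases) (auto simp: gr_queer_def queer_abs_ops t)
  show "x = 0" if "x \<in> gr 0" "x \<in> gr 1"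
    using that by (elim gr_queer_cases) (auto simp: queer_abs_eq t zero_queer_eq)
  show "br x y \<in> gr (i + j)" if "x \<in> gr i" "y \<in> gr j"
    using that
    by (elim gr_queer_cases) (auto simp: gr_queer_def queer_abs_ops trace_zero qbr_def intro!: exI trace_mul_diff)
  show "br x y = - (koszul_sign i j *\<^sub>C br y x)" if "x \<in> gr i" "y \<in> gr j"
    using that
    by (elim gr_queer_cases)
      (auto simp: koszul_sign_def queer_abs_ops trace_zero trace_add qbr_def trace_mul_diff
        complex_vector.scale_minus_left add.commute)
  show "br x (br y z) = br (br x y) z + koszul_sign i j *\<^sub>C br y (br x z)"
    if "x \<in> gr i" "y \<in> gr j"
    using that
  proof (elim gr_queer_cases)
    note rules = abs_queer_br[symmetric] abs_queer_plus[symmetric] abs_queer_scale[symmetric]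
      trace_qbr z(2) trace_zero snd_conv snd_scaleC_prod trace_scaleC mult_zero_right if_True if_False
      simp_thms bit.distinct
    { fix a b assume "i = 0" "j = 0" "x = abs_queer (a, 0)" "y = abs_queer (b, 0)"
      then show ?thesis
        unfolding z(1) using qbr_jacobi(1)[of a b a'' b'']
        by (simp only: rules koszul_sign_def)
          (simp add: complex_vector.scale_minus_left) }
    { fix a b assume "i = 0" "j = 1" "x = abs_queer (a, 0)" "y = abs_queer (0, b)" "trace b = 0"
      then show ?thesis
        unfolding z(1) using qbr_jacobi(2)[of a b a'' b'']
        by (simp only: rules koszul_sign_def)
          (simp add: complex_vector.scale_minus_left) }
    { fix a b assume "i = 1" "j = 0" "x = abs_queer (0, a)" "trace a = 0" "y = abs_queer (b, 0)"
      then show ?thesis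
        unfolding z(1) using qbr_jacobi(3)[of a b a'' b'']
        by (simp only: rules koszul_sign_def)
          (simp add: complex_vector.scale_minus_left) }
    { fix a b assume "i = 1" "j = 1" "x = abs_queer (0, a)" "trace a = 0" "y = abs_queer (0, b)" "trace b = 0"
      then show ?thesis
        unfolding z(1) using qbr_jacobi(4)[of a b a'' b'']
        by (simp only: rules koszul_sign_def)
          (simp add: complex_vector.scale_minus_left) }
  qed
qed

end


section \<open>Universal enveloping algebras\<close>

datatype 'a free_monoid = Free_Monoid (letters: "'a list")

instantiation free_monoid :: (type) monoid_add
begin
definition zero_free_monoid :: "'a free_monoid" where "0 = Free_Monoid []"
definition plus_free_monoid :: "'a free_monoid \<Rightarrow> 'a free_monoid \<Rightarrow> 'a free_monoid"
  where "v + w = Free_Monoid (letters v @ letters w)"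
instance by standard (simp_all add: zero_free_monoid_def plus_free_monoid_def)
end

definition two_sided_ideal :: "'r::{ring, complex_vector} set \<Rightarrow> bool"
  where "two_sided_ideal J \<longleftrightarrow> csubspace J \<and> (\<forall>a\<in>J. \<forall>u. u * a \<in> J \<and> a * u \<in> J)"

text \<open>The free associative unital algebra on the set \<open>\<gg>\<close>, with finitely supported functions on words
  and convolution as multiplication; the first two families of relations below turn it into the
  tensor algebra of the vector space \<open>\<gg>\<close>.\<close>

type_synonym 'g free_algebra = "'g free_monoid \<Rightarrow>\<^sub>0 complex"

definition letter :: "'g \<Rightarrow> 'g free_algebra"
  where "letter x = basis_elt (Free_Monoid [x])"

definition env_ideal :: "'g::lie_superalgebra free_algebra set"
  where "env_ideal = two_sided_ideal hull
    ({letter (x + y) - letter x - letter y | x y. True} \<union>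
     {letter (c *\<^sub>C x) - c *\<^sub>C letter x | c x. True} \<union>
     {letter x * letter y - koszul_sign i j *\<^sub>C (letter y * letter x) - letter (br x y)
        | x y i j. x \<in> gr i \<and> y \<in> gr j})"

lemma two_sided_ideal_env_ideal: "two_sided_ideal env_ideal"
  unfolding env_ideal_def
  by (rule hull_in)
    (auto simp: two_sided_ideal_def intro!: complex_vector.subspace_Inter)

lemma csubspace_env_ideal: "csubspace env_ideal"
  by (rule two_sided_ideal_env_ideal[unfolded two_sided_ideal_def, THEN conjunct1])

lemma env_ideal_mult:
  assumes "p - p' \<in> env_ideal" "q - q' \<in> env_ideal"
  shows "p * q - p' * q' \<in> env_ideal"
proof -
  have "(p - p') * q \<in> env_ideal" "p' * (q - q') \<in> env_ideal"
    using two_sided_ideal_env_ideal assms by (auto simp: two_sided_ideal_def)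
  then have "(p - p') * q + p' * (q - q') \<in> env_ideal"
    by (rule complex_vector.subspace_add[OF csubspace_env_ideal])
  then show ?thesis by (simp add: algebra_simps)
qed

quotient_type (overloaded) 'g env = "'g::lie_superalgebra free_algebra"
  / "\<lambda>p q. p - q \<in> env_ideal"
  by (rule equivp_mod_subspace[OF csubspace_env_ideal])

instantiation env :: (lie_superalgebra) "{ring, monoid_mult, complex_vector}"
begin
lift_definition zero_env :: "'a env" is 0 .
lift_definition one_env :: "'a env" is 1 .
lift_definition plus_env :: "'a env \<Rightarrow> 'a env \<Rightarrow> 'a env" is "(+)"
  by (rule mod_subspace_add[OF csubspace_env_ideal])
lift_definition minus_env :: "'a env \<Rightarrow> 'a env \<Rightarrow> 'a env" is "(-)"
  by (rule mod_subspace_diff[OF csubspace_env_ideal])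
lift_definition uminus_env :: "'a env \<Rightarrow> 'a env" is uminus
  by (rule mod_subspace_uminus[OF csubspace_env_ideal])
lift_definition times_env :: "'a env \<Rightarrow> 'a env \<Rightarrow> 'a env" is "(*)"
  by (rule env_ideal_mult)
lift_definition scaleC_env :: "complex \<Rightarrow> 'a env \<Rightarrow> 'a env" is scaleC
  by (rule mod_subspace_scale[OF csubspace_env_ideal])
instance
  by standard
    (transfer; simp add: complex_vector.subspace_0[OF csubspace_env_ideal] algebra_simps
      scaleC_add_right scaleC_add_left scaleC_scaleC scaleC_one)+
end

lift_definition env_incl :: "'g::lie_superalgebra \<Rightarrow> 'g env" is letter .

definition env_gr :: "bit \<Rightarrow> 'g::lie_superalgebra env set"
  where "env_gr k = cspan {prod_list (map env_incl xs) | xs ps.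
    list_all2 (\<lambda>x i. x \<in> gr i) xs ps \<and> sum_list ps = k}"


section \<open>Modules over Lie superalgebras\<close>

text \<open>A module over the subalgebra \<open>B\<close> is given by the grading \<open>\<Gamma>\<close> of the underlying space and the
  action \<open>\<alpha>\<close>, whose values outside \<open>B\<close> are irrelevant.\<close>

definition super_module ::
  "'g::lie_superalgebra set \<Rightarrow> (bit \<Rightarrow> 'v::complex_vector set) \<Rightarrow> ('g \<Rightarrow> 'v \<Rightarrow> 'v) \<Rightarrow> bool"
  where "super_module B \<Gamma> \<alpha> \<longleftrightarrow>
    internal_direct_sum UNIV \<Gamma> \<and>
    (\<forall>x\<in>B. clinear (\<alpha> x)) \<and>
    (\<forall>x\<in>B. \<forall>y\<in>B. \<forall>v. \<alpha> (x + y) v = \<alpha> x v + \<alpha> y v) \<and>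
    (\<forall>c. \<forall>x\<in>B. \<forall>v. \<alpha> (c *\<^sub>C x) v = c *\<^sub>C \<alpha> x v) \<and>
    (\<forall>i j. \<forall>x\<in>B \<inter> gr i. \<forall>v\<in>\<Gamma> j. \<alpha> x v \<in> \<Gamma> (i + j)) \<and>
    (\<forall>i j. \<forall>x\<in>B \<inter> gr i. \<forall>y\<in>B \<inter> gr j. \<forall>v.
       \<alpha> (br x y) v = \<alpha> x (\<alpha> y v) - koszul_sign i j *\<^sub>C \<alpha> y (\<alpha> x v))"

definition submodule ::
  "'g set \<Rightarrow> (bit \<Rightarrow> 'v::complex_vector set) \<Rightarrow> ('g \<Rightarrow> 'v \<Rightarrow> 'v) \<Rightarrow> 'v set \<Rightarrow> bool"
  where "submodule B \<Gamma> \<alpha> S \<longleftrightarrow> csubspace S \<and>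
    (\<forall>v\<in>S. \<exists>v\<^sub>0\<in>S \<inter> \<Gamma> 0. \<exists>v\<^sub>1\<in>S \<inter> \<Gamma> 1. v = v\<^sub>0 + v\<^sub>1) \<and>
    (\<forall>x\<in>B. \<forall>v\<in>S. \<alpha> x v \<in> S)"

definition irreducible_module ::
  "'g::lie_superalgebra set \<Rightarrow> (bit \<Rightarrow> 'v::complex_vector set) \<Rightarrow> ('g \<Rightarrow> 'v \<Rightarrow> 'v) \<Rightarrow> bool"
  where "irreducible_module B \<Gamma> \<alpha> \<longleftrightarrow> super_module B \<Gamma> \<alpha> \<and> (UNIV :: 'v set) \<noteq> {0} \<and>
    (\<forall>S. submodule B \<Gamma> \<alpha> S \<longrightarrow> S = {0} \<or> S = UNIV)"

definition maximal_submodule ::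
  "'g set \<Rightarrow> (bit \<Rightarrow> 'v::complex_vector set) \<Rightarrow> ('g \<Rightarrow> 'v \<Rightarrow> 'v) \<Rightarrow> 'v set \<Rightarrow> bool"
  where "maximal_submodule B \<Gamma> \<alpha> N \<longleftrightarrow> submodule B \<Gamma> \<alpha> N \<and> N \<noteq> UNIV \<and>
    (\<forall>S. submodule B \<Gamma> \<alpha> S \<and> N \<subseteq> S \<longrightarrow> S = N \<or> S = UNIV)"

definition unique_maximal_submodule ::
  "'g set \<Rightarrow> (bit \<Rightarrow> 'v::complex_vector set) \<Rightarrow> ('g \<Rightarrow> 'v \<Rightarrow> 'v) \<Rightarrow> 'v set \<Rightarrow> bool"
  where "unique_maximal_submodule B \<Gamma> \<alpha> N \<longleftrightarrow> maximal_submodule B \<Gamma> \<alpha> N \<and>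
    (\<forall>N'. maximal_submodule B \<Gamma> \<alpha> N' \<longrightarrow> N' = N)"

text \<open>\<open>(\<Gamma>', \<alpha>')\<close> is the quotient of \<open>(\<Gamma>, \<alpha>)\<close> by the submodule \<open>N\<close>, with projection \<open>\<pi>\<close>. The quotient
  depends on \<open>N\<close> and cannot be a type of its own; it is therefore realised on an arbitrary type, which
  determines it up to isomorphism.\<close>

definition is_quotient_module ::
  "(bit \<Rightarrow> 'v::complex_vector set) \<Rightarrow> ('g \<Rightarrow> 'v \<Rightarrow> 'v) \<Rightarrow> 'v set \<Rightarrow>
   (bit \<Rightarrow> 'w::complex_vector set) \<Rightarrow> ('g \<Rightarrow> 'w \<Rightarrow> 'w) \<Rightarrow> ('v \<Rightarrow> 'w) \<Rightarrow> bool"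
  where "is_quotient_module \<Gamma> \<alpha> N \<Gamma>' \<alpha>' \<pi> \<longleftrightarrow>
    clinear \<pi> \<and> surj \<pi> \<and> {v. \<pi> v = 0} = N \<and>
    (\<forall>x v. \<alpha>' x (\<pi> v) = \<pi> (\<alpha> x v)) \<and> (\<forall>k. \<Gamma>' k = \<pi> ` \<Gamma> k)"

text \<open>\<open>(\<Gamma>', \<alpha>')\<close> is \<open>U(\<gg>) \<otimes> H\<close> over \<open>U(B)\<close> for a module \<open>(\<Gamma>, \<alpha>)\<close> on \<open>H\<close> over a subalgebra \<open>B\<close>, realised
  as above as the quotient of the complex tensor product by the balancing relations, with projection \<open>p\<close>.
  It suffices to balance over \<open>B\<close> because \<open>B\<close> generates \<open>U(B)\<close>.\<close>

definition is_induced_module ::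
  "'g::lie_superalgebra set \<Rightarrow> (bit \<Rightarrow> 'h::complex_vector set) \<Rightarrow> ('g \<Rightarrow> 'h \<Rightarrow> 'h) \<Rightarrow>
   (bit \<Rightarrow> 'm::complex_vector set) \<Rightarrow> ('g \<Rightarrow> 'm \<Rightarrow> 'm) \<Rightarrow> (('g env, 'h) tensor \<Rightarrow> 'm) \<Rightarrow> bool"
  where "is_induced_module B \<Gamma> \<alpha> \<Gamma>' \<alpha>' p \<longleftrightarrow>
    clinear p \<and> surj p \<and>
    {t. p t = 0} = cspan {(u * env_incl y) \<otimes>\<^sub>t w - u \<otimes>\<^sub>t \<alpha> y w | u y w. y \<in> B} \<and>
    (\<forall>x. clinear (\<alpha>' x)) \<and>
    (\<forall>x u w. \<alpha>' x (p (u \<otimes>\<^sub>t w)) = p ((env_incl x * u) \<otimes>\<^sub>t w)) \<and>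
    (\<forall>k. \<Gamma>' k = p ` cspan {u \<otimes>\<^sub>t w | u w i j. u \<in> env_gr i \<and> w \<in> \<Gamma> j \<and> i + j = k})"

text \<open>The extension of an action of \<open>S\<close> to \<open>S \<oplus> T\<close> by letting \<open>T\<close> act by zero.\<close>

definition extend_by_zero ::
  "'g::complex_vector set \<Rightarrow> 'g set \<Rightarrow> ('g \<Rightarrow> 'v \<Rightarrow> 'v) \<Rightarrow> 'g \<Rightarrow> 'v \<Rightarrow> 'v"
  where "extend_by_zero S T \<alpha> z = \<alpha> (THE x. x \<in> S \<and> z - x \<in> T)"


section \<open>The modules \<open>H(\<psi>)\<close> and \<open>V(\<psi>)\<close>\<close>

definition diagonal_matrix :: "complex ^ 'n ^ 'n \<Rightarrow> bool"
  where "diagonal_matrix a \<longleftrightarrow> (\<forall>i j. i \<noteq> j \<longrightarrow> a $ i $ j = 0)"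

definition strictly_upper :: "complex ^ ('n::{finite, linorder}) ^ ('n::{finite, linorder}) \<Rightarrow> bool"
  where "strictly_upper a \<longleftrightarrow> (\<forall>i j. j \<le> i \<longrightarrow> a $ i $ j = 0)"

definition q_h0 :: "'n::finite queer set"
  where "q_h0 = {abs_queer (a, 0) | a. diagonal_matrix a \<and> trace a = 0}"

definition q_h1 :: "'n::finite queer set"
  where "q_h1 = {abs_queer (0, b) | b. diagonal_matrix b \<and> trace b = 0}"

definition q_h :: "'n::finite queer set"
  where "q_h = {x + y | x y. x \<in> q_h0 \<and> y \<in> q_h1}"

definition q_nplus :: "'n::{finite, linorder} queer set"
  where "q_nplus = {abs_queer (a, b) | a b. strictly_upper a \<and> strictly_upper b}"

definition q_b :: "'n::{finite, linorder} queer set"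
  where "q_b = {x + y | x y. x \<in> q_h \<and> y \<in> q_nplus}"

type_synonym ('n, 'a) queer_map = "('n queer, 'a) tensor"

definition L_functionals ::
  "(('n::finite, 'a::comm_complex_algebra_1) queer_map \<Rightarrow> complex) set"
  where "L_functionals = {\<psi> \<in> dual_space (tensor_span q_h0 UNIV).
    \<exists>I. alg_ideal I \<and> finite_codimensional I \<and> (\<forall>z\<in>tensor_span q_h0 I. \<psi> z = 0)}"

definition is_H_module ::
  "(('n::finite, 'a::comm_complex_algebra_1) queer_map \<Rightarrow> complex) \<Rightarrow>
   (bit \<Rightarrow> 'h::complex_vector set) \<Rightarrow> (('n, 'a) queer_map \<Rightarrow> 'h \<Rightarrow> 'h) \<Rightarrow> bool"
  where "is_H_module \<psi> \<Gamma> \<alpha> \<longleftrightarrow>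
    irreducible_module (tensor_span q_h UNIV) \<Gamma> \<alpha> \<and>
    finite_dimensional (UNIV :: 'h set) \<and>
    (\<forall>x\<in>tensor_span q_h0 UNIV. \<forall>v. \<alpha> x v = \<psi> x *\<^sub>C v)"

definition extended_H_action ::
  "(('n::{finite, linorder}, 'a::comm_complex_algebra_1) queer_map \<Rightarrow> 'h \<Rightarrow> 'h) \<Rightarrow>
   ('n, 'a) queer_map \<Rightarrow> 'h \<Rightarrow> 'h"
  where "extended_H_action = extend_by_zero (tensor_span q_h UNIV) (tensor_span q_nplus UNIV)"


section \<open>Weight spaces, annihilators and supports\<close>

definition weight_space ::
  "(('n::finite, 'a::comm_complex_algebra_1) queer_map \<Rightarrow> 'v::complex_vector \<Rightarrow> 'v) \<Rightarrow>
   ('n queer \<Rightarrow> complex) \<Rightarrow> 'v set"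
  where "weight_space \<alpha> \<mu> = {v. \<forall>h\<in>q_h0. \<alpha> (h \<otimes>\<^sub>t 1) v = \<mu> h *\<^sub>C v}"

definition weight_module ::
  "(('n::finite, 'a::comm_complex_algebra_1) queer_map \<Rightarrow> 'v::complex_vector \<Rightarrow> 'v) \<Rightarrow> bool"
  where "weight_module \<alpha> \<longleftrightarrow> internal_direct_sum (dual_space q_h0) (weight_space \<alpha>)"

definition quasifinite ::
  "(('n::finite, 'a::comm_complex_algebra_1) queer_map \<Rightarrow> 'v::complex_vector \<Rightarrow> 'v) \<Rightarrow> bool"
  where "quasifinite \<alpha> \<longleftrightarrow> weight_module \<alpha> \<and>
    (\<forall>\<mu>\<in>dual_space q_h0. finite_dimensional (weight_space \<alpha> \<mu>))"

definition ideal_annihilates ::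
  "'a::comm_complex_algebra_1 set \<Rightarrow>
   (('n::finite, 'a) queer_map \<Rightarrow> 'v::complex_vector \<Rightarrow> 'v) \<Rightarrow> bool"
  where "ideal_annihilates I \<alpha> \<longleftrightarrow> (\<forall>z\<in>tensor_span UNIV I. \<forall>v. \<alpha> z v = 0)"

text \<open>Ideals are subspaces, so a sum of ideals is the linear span of their union.\<close>

definition annihilator ::
  "(('n::finite, 'a::comm_complex_algebra_1) queer_map \<Rightarrow> 'v::complex_vector \<Rightarrow> 'v) \<Rightarrow> 'a set"
  where "annihilator \<alpha> = cspan (\<Union>{I. alg_ideal I \<and> ideal_annihilates I \<alpha>})"

definition module_support ::
  "(('n::finite, 'a::comm_complex_algebra_1) queer_map \<Rightarrow> 'v::complex_vector \<Rightarrow> 'v) \<Rightarrow> 'a set set"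
  where "module_support \<alpha> = ideal_support (annihilator \<alpha>)"

end

theory Submission
  imports Defs
begin

text \<open>By definition, \<open>\<psi>\<close> lies in \<open>\<L>(\<hh> \<otimes> A)\<close> exactly if it satisfies condition (3). So the task is to
  derive (1), (2) and (4) from an ideal \<open>I\<close> of finite codimension with \<open>\<psi>(\<hh>\<^sub>0 \<otimes> I) = 0\<close>.

  First, \<open>\<hh> \<otimes> I\<close> acts by zero on \<open>H(\<psi>)\<close>. For an odd \<open>x\<close> in \<open>\<hh> \<otimes> I\<close> all brackets with \<open>\<hh> \<otimes> A\<close> lie in
  \<open>\<hh>\<^sub>0 \<otimes> I\<close> and act by zero. So the kernel of \<open>x\<close> is a submodule, and it is not zero since \<open>x\<^sup>2 = 0\<close>
  (lemma \<open>H_module_cartan_ideal_zero\<close>).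

  Let \<open>T\<close> be the image of \<open>H(\<psi>)\<close> in \<open>V(\<psi>)\<close>. The vectors \<open>y w\<close> with \<open>y \<in> \<nn>\<^sup>- \<otimes> I\<close> and \<open>w \<in> T\<close> span a
  \<open>\<bb> \<otimes> A\<close>-stable space, because \<open>(\<hh> + \<nn>\<^sup>+) \<otimes> I\<close> kills \<open>T\<close>. The submodule that they generate is therefore
  spanned by what \<open>\<nn>\<^sup>- \<otimes> A\<close> makes of them (lemma \<open>word_span_invariant\<close>), and its weights are strictly
  below the weight of \<open>T\<close>. It is a proper submodule, hence zero. So \<open>\<qq> \<otimes> I\<close> kills \<open>T\<close>, and since it is an
  ideal of \<open>\<qq> \<otimes> A\<close>, it kills all of \<open>V(\<psi>)\<close>. This is (2).

  Now \<open>V(\<psi>)\<close> is spanned by words \<open>y\<^sub>1 \<dots> y\<^sub>k w\<close> with \<open>w\<close> in a basis of \<open>T\<close> and \<open>y\<^sub>i\<close> in a finite set, the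
  negative root vectors tensored with a basis of \<open>A\<close> modulo \<open>I\<close>. An element of \<open>\<hh>\<^sub>0\<close> that multiplies
  each negative root vector by a negative integer bounds the length of the words of a given weight. So the
  weight spaces are finite-dimensional, which is (1).

  Finally, there are at most \<open>dim (A / I)\<close> maximal ideals over \<open>I\<close>, because suitable elements
  that separate them are linearly independent modulo \<open>I\<close>. This is (4).\<close>


section \<open>Linear maps and joint eigenvectors\<close>

lemma clinear_zero: "clinear f \<Longrightarrow> f 0 = 0"
  using clinear_scale[of f 0 0] by simp

lemma clinear_sum: "clinear f \<Longrightarrow> f (\<Sum>x\<in>S. g x) = (\<Sum>x\<in>S. f (g x))"
  by (rule Vector_Spaces.linear.axioms(3)[THEN module_hom.sum])

lemma clinear_span_subset:
  assumes "clinear f" "csubspace S" "\<And>b. b \<in> B \<Longrightarrow> f b \<in> S" "x \<in> cspan B"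
  shows "f x \<in> S"
proof -
  have "csubspace {x. f x \<in> S}"
    using assms(1,2)
    by (auto intro!: complex_vector.subspaceI
        simp: clinear_zero clinear_add clinear_scale complex_vector.subspace_0
          complex_vector.subspace_add complex_vector.subspace_scale)
  then show ?thesis
    using complex_vector.span_minimal[of B "{x. f x \<in> S}"] assms(3,4) by auto
qed

lemma clinear_eq_on_span:
  assumes "clinear f" "clinear g" "\<And>b. b \<in> B \<Longrightarrow> f b = g b" "x \<in> cspan B"
  shows "f x = g x"
proof -
  have "clinear (\<lambda>x. f x - g x)"
    using assms(1,2) by (intro clinearI)
      (simp_all add: clinear_add clinear_scale complex_vector.scale_right_diff_distrib)
  then have "f x - g x \<in> {0}"
    by (rule clinear_span_subset) (use assms(3,4) in \<open>auto simp: complex_vector.subspace_single_0\<close>)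
  then show ?thesis by simp
qed

lemma clinear_image_subspace:
  assumes "clinear f" "csubspace S" shows "csubspace (f ` S)"
proof (rule complex_vector.subspaceI)
  show "0 \<in> f ` S"
    using clinear_zero[OF assms(1)] complex_vector.subspace_0[OF assms(2)] by force
  show "x + y \<in> f ` S" if "x \<in> f ` S" "y \<in> f ` S" for x y
    using that complex_vector.subspace_add[OF assms(2)]
    by (auto simp: clinear_add[OF assms(1), symmetric])
  show "c *\<^sub>C x \<in> f ` S" if "x \<in> f ` S" for c x
    using that complex_vector.subspace_scale[OF assms(2)]
    by (auto simp: clinear_scale[OF assms(1), symmetric])
qed

lemma clinear_image_span:
  assumes "clinear f" shows "f ` cspan B = cspan (f ` B)"
proof
  show "f ` cspan B \<subseteq> cspan (f ` B)"
    using clinear_span_subset[OF assms complex_vector.subspace_span[of "f ` B"]]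
    by (blast intro: complex_vector.span_base)
  show "cspan (f ` B) \<subseteq> f ` cspan B"
    by (intro complex_vector.span_minimal image_mono complex_vector.span_superset
        clinear_image_subspace assms complex_vector.subspace_span)
qed

lemma span_Union_subspaces_sum:
  assumes "v \<in> cspan (\<Union>j\<in>J. F j)" "\<And>j. j \<in> J \<Longrightarrow> csubspace (F j)"
  obtains S f where "finite S" "S \<subseteq> J" "\<And>j. j \<in> S \<Longrightarrow> f j \<in> F j" "v = (\<Sum>j\<in>S. f j)"
proof -
  let ?P = "\<lambda>v. \<exists>S f. finite S \<and> S \<subseteq> J \<and> (\<forall>j\<in>S. f j \<in> F j) \<and> v = (\<Sum>j\<in>S. f j)"
  have "?P v" using assms(1)
  proof (induct rule: complex_vector.span_induct_alt)
    case base
    show ?case by (rule exI[of _ "{}"]) simp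
  next
    case (step c x y)
    then obtain i where i: "i \<in> J" "x \<in> F i" by blast
    obtain S f where S: "finite S" "S \<subseteq> J" "\<forall>j\<in>S. f j \<in> F j" "y = (\<Sum>j\<in>S. f j)"
      using step by blast
    let ?g = "\<lambda>j. (if j = i then c *\<^sub>C x else 0) + (if j \<in> S then f j else 0)"
    have "c *\<^sub>C x + y = (\<Sum>j\<in>insert i S. ?g j)"
    proof -
      have "(\<Sum>j\<in>insert i S. if j = i then c *\<^sub>C x else 0) = c *\<^sub>C x"
        using S(1) by (subst sum.delta) simp_all
      moreover have "(\<Sum>j\<in>insert i S. if j \<in> S then f j else 0) = y"
        unfolding S(4) using S(1) by (intro sum.mono_neutral_cong_right) auto
      ultimately show ?thesis by (simp only: sum.distrib)
    qed
    moreover have "?g j \<in> F j" if "j \<in> insert i S" for j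
      using that i S assms(2)
      by (auto simp: complex_vector.subspace_0 complex_vector.subspace_add
          complex_vector.subspace_scale)
    ultimately show ?case
      using i S by (intro exI[of _ "insert i S"] exI[of _ ?g]) auto
  qed
  then show ?thesis using that by blast
qed

lemma csubspace_joint_eigenspace:
  assumes "\<And>h. h \<in> X \<Longrightarrow> clinear (T h)"
  shows "csubspace {v. \<forall>h\<in>X. T h v = c h *\<^sub>C v}"
  using assms by (auto intro!: complex_vector.subspaceI
      simp: clinear_zero clinear_add clinear_scale scaleC_add_right mult.commute)

text \<open>If two eigenvalue systems differ at \<open>h\<close>, then applying \<open>(T h - \<nu> h) / (\<mu> h - \<nu> h)\<close> to a linear
  relation removes the term of \<open>\<nu>\<close> and fixes the one of \<open>\<mu>\<close>, so a shortest relation is trivial.\<close>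

lemma joint_eigenspaces_independent:
  fixes T :: "'i \<Rightarrow> 'v::complex_vector \<Rightarrow> 'v" and wt :: "'j \<Rightarrow> 'i \<Rightarrow> complex"
  assumes lin: "\<And>h. h \<in> X \<Longrightarrow> clinear (T h)"
    and sep: "\<And>j. j \<in> J \<Longrightarrow> \<exists>h\<in>X. wt j h \<noteq> \<mu> h"
    and v: "\<forall>h\<in>X. T h v = \<mu> h *\<^sub>C v" "v \<in> cspan (\<Union>j\<in>J. {v. \<forall>h\<in>X. T h v = wt j h *\<^sub>C v})"
  shows "v = 0"
proof -
  obtain S f where S: "finite S" "S \<subseteq> J" and f: "\<forall>j\<in>S. \<forall>h\<in>X. T h (f j) = wt j h *\<^sub>C f j"
    and v_sum: "v = (\<Sum>j\<in>S. f j)"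
  proof (rule span_Union_subspaces_sum[OF v(2) csubspace_joint_eigenspace[OF lin]])
    fix S f
    assume "finite S" "S \<subseteq> J" "\<And>j. j \<in> S \<Longrightarrow> f j \<in> {v. \<forall>h\<in>X. T h v = wt j h *\<^sub>C v}"
      "v = (\<Sum>j\<in>S. f j)"
    then show thesis by (intro that[of S f]) auto
  qed
  from S f v_sum show ?thesis
  proof (induct S arbitrary: f rule: finite_induct)
    case (insert i S)
    obtain h where h: "h \<in> X" "wt i h \<noteq> \<mu> h" using sep insert.prems(1) by blast
    let ?d = "\<mu> h - wt i h"
    let ?g = "\<lambda>j. ((wt j h - wt i h) / ?d) *\<^sub>C f j"
    have Tv: "T h v = (\<Sum>j\<in>insert i S. wt j h *\<^sub>C f j)"
      unfolding insert.prems(3) clinear_sum[OF lin[OF h(1)]] using insert.prems(2) h(1)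
      by (intro sum.cong) auto
    have "?d *\<^sub>C v = T h v - wt i h *\<^sub>C v"
      using v(1) h(1) by (simp add: complex_vector.scale_left_diff_distrib)
    also have "\<dots> = (\<Sum>j\<in>insert i S. (wt j h - wt i h) *\<^sub>C f j)"
      unfolding Tv by (subst insert.prems(3))
        (simp add: complex_vector.scale_sum_right sum_subtractf[symmetric]
          complex_vector.scale_left_diff_distrib del: sum.insert)
    also have "\<dots> = (\<Sum>j\<in>S. (wt j h - wt i h) *\<^sub>C f j)"
      using insert.hyps by simp
    finally have "(1 / ?d) *\<^sub>C ?d *\<^sub>C v = (\<Sum>j\<in>S. ?g j)"
      by (simp add: complex_vector.scale_sum_right)
    then have "v = (\<Sum>j\<in>S. ?g j)" using h(2) by (simp add: scaleC_one)
    moreover have "\<forall>j\<in>S. \<forall>h\<in>X. T h (?g j) = wt j h *\<^sub>C ?g j"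
      using insert.prems(2) by (simp add: clinear_scale[OF lin] mult.commute)
    ultimately show ?case using insert.prems(1) by (intro insert.hyps(3)[of ?g]) auto
  qed simp
qed

text \<open>A spanning set of eigenvectors spans each eigenspace by those of its members that lie in it: the
  remaining part of an expansion of \<open>v\<close> is at once of eigenvalue \<open>\<mu>\<close> and a sum of other eigenvectors.\<close>

lemma eigenvector_in_span_of_same_eigenvalue:
  fixes T :: "'i \<Rightarrow> 'v::complex_vector \<Rightarrow> 'v" and wt :: "'j \<Rightarrow> 'i \<Rightarrow> complex"
  assumes lin: "\<And>h. h \<in> X \<Longrightarrow> clinear (T h)"
    and W: "\<And>j w. w \<in> W j \<Longrightarrow> \<forall>h\<in>X. T h w = wt j h *\<^sub>C w"
    and v: "\<forall>h\<in>X. T h v = \<mu> h *\<^sub>C v" "v \<in> cspan (\<Union>j. W j)"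
  shows "v \<in> cspan (\<Union>j\<in>{j. \<forall>h\<in>X. wt j h = \<mu> h}. W j)"
proof -
  let ?J = "{j. \<forall>h\<in>X. wt j h = \<mu> h}"
  let ?E = "{v. \<forall>h\<in>X. T h v = \<mu> h *\<^sub>C v}"
  have "(\<Union>j. W j) = (\<Union>j\<in>?J. W j) \<union> (\<Union>j\<in>-?J. W j)" by auto
  then obtain a b where ab: "v = a + b" "a \<in> cspan (\<Union>j\<in>?J. W j)" "b \<in> cspan (\<Union>j\<in>-?J. W j)"
    using v(2)[unfolded \<open>(\<Union>j. W j) = _\<close> complex_vector.span_Un] by blast
  have sub: "csubspace ?E" by (rule csubspace_joint_eigenspace[OF lin])
  have "(\<Union>j\<in>?J. W j) \<subseteq> ?E"
  proof
    fix w assume "w \<in> (\<Union>j\<in>?J. W j)"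
    then obtain j where "\<forall>h\<in>X. wt j h = \<mu> h" "w \<in> W j" by blast
    then show "w \<in> ?E" using W[of w j] by simp
  qed
  then have "a \<in> ?E" using subsetD[OF complex_vector.span_minimal[OF _ sub] ab(2)] by simp
  moreover have "v \<in> ?E" using v(1) by simp
  ultimately have "v - a \<in> ?E" by (rule complex_vector.subspace_diff[OF sub, rotated])
  then have "\<forall>h\<in>X. T h b = \<mu> h *\<^sub>C b" using ab(1) by simp
  moreover have "b \<in> cspan (\<Union>j\<in>-?J. {v. \<forall>h\<in>X. T h v = wt j h *\<^sub>C v})"
    by (rule subsetD[OF complex_vector.span_mono ab(3)]) (use W in blast)
  ultimately have "b = 0"
    by (intro joint_eigenspaces_independent[of X T "-?J" wt \<mu>, OF lin]) auto
  then show ?thesis using ab by simp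
qed


section \<open>Maximal ideals over an ideal of finite codimension\<close>

lemma ideal_mult_mem: "alg_ideal I \<Longrightarrow> x \<in> I \<Longrightarrow> a * x \<in> I"
  by (simp add: alg_ideal_def)

lemma maximal_ideal_prime:
  assumes M: "maximal_ideal M" and xy: "x * y \<in> M" and x: "x \<notin> M"
  shows "y \<in> M"
proof -
  have I: "alg_ideal M" using M by (simp add: maximal_ideal_def)
  let ?N = "{m + a * x | m a. m \<in> M}"
  have "alg_ideal ?N"
    unfolding alg_ideal_def
  proof (intro conjI ballI allI)
    show "0 \<in> ?N" using I unfolding alg_ideal_def
      by (intro CollectI exI[of _ 0]) simp
  next
    fix u v assume "u \<in> ?N" "v \<in> ?N"
    then obtain m a m' a' where "u = m + a * x" "v = m' + a' * x" "m \<in> M" "m' \<in> M" by blast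
    then show "u + v \<in> ?N" using I unfolding alg_ideal_def
      by (intro CollectI exI[of _ "m + m'"] exI[of _ "a + a'"]) (simp add: algebra_simps)
  next
    fix b u assume "u \<in> ?N"
    then obtain m a where "u = m + a * x" "m \<in> M" by blast
    then show "b * u \<in> ?N" using I unfolding alg_ideal_def
      by (intro CollectI exI[of _ "b * m"] exI[of _ "b * a"]) (simp add: algebra_simps)
  qed
  moreover have "M \<subseteq> ?N"
    by (intro subsetI CollectI, rule exI, rule exI[of _ 0]) simp
  moreover have "x \<in> ?N"
    using I unfolding alg_ideal_def
    by (intro CollectI exI[of _ 0] exI[of _ 1]) (simp add: mult.commute)
  ultimately have "?N = UNIV" using M x unfolding maximal_ideal_def by blast
  then obtain m a where ma: "1 = m + a * x" "m \<in> M" by blast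
  have "y = (m + a * x) * y" unfolding ma(1)[symmetric] by simp
  also have "\<dots> = y * m + a * (x * y)" by (simp add: algebra_simps)
  finally have y: "y = y * m + a * (x * y)" .
  have "y * m + a * (x * y) \<in> M" using I ma(2) xy by (simp add: alg_ideal_def)
  then show ?thesis by (simp only: y[symmetric])
qed

text \<open>The product of elements of \<open>M - M\<^sub>0\<close>, one for each \<open>M\<close>, avoids \<open>M\<^sub>0\<close> because \<open>M\<^sub>0\<close> is prime.\<close>

lemma maximal_ideals_separate:
  assumes "finite S" "\<forall>M\<in>S. maximal_ideal M" "maximal_ideal M\<^sub>0" "M\<^sub>0 \<notin> S"
  shows "\<exists>e. e \<notin> M\<^sub>0 \<and> (\<forall>M\<in>S. e \<in> M)"
  using assms
proof (induct S rule: finite_induct)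
  case empty
  then show ?case by (auto simp: maximal_ideal_def)
next
  case (insert M S)
  then obtain e where e: "e \<notin> M\<^sub>0" "\<forall>M\<in>S. e \<in> M" by auto
  have "\<not> M \<subseteq> M\<^sub>0" using insert.prems unfolding maximal_ideal_def by auto
  then obtain x where x: "x \<in> M" "x \<notin> M\<^sub>0" by blast
  have "x * e \<notin> M\<^sub>0" using maximal_ideal_prime insert.prems x(2) e(1) by blast
  moreover have "x * e \<in> M'" if "M' \<in> insert M S" for M'
  proof -
    have "alg_ideal M'" using that insert.prems(1) by (auto simp: maximal_ideal_def)
    then show ?thesis
      using that x(1) e(2) ideal_mult_mem[of M' e x] ideal_mult_mem[of M' x e]
      by (auto simp: mult.commute)
  qed
  ultimately show ?case by blast
qed

text \<open>Elements \<open>e M\<close> that lie outside \<open>M\<close> but in all other members of a family of maximal ideals over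
  \<open>I\<close> are linearly independent modulo \<open>I\<close>, so the family has at most \<open>dim (A / I)\<close> members.\<close>

lemma finite_support_if_finite_codimensional:
  fixes I :: "'a::comm_complex_algebra_1 set"
  assumes "finite_codimensional I"
  shows "finite (ideal_support I)"
proof (rule ccontr)
  obtain B where B: "finite B" "cspan (B \<union> I) = UNIV"
    using assms by (auto simp: finite_codimensional_def)
  assume "infinite (ideal_support I)"
  then obtain S where S: "S \<subseteq> ideal_support I" "finite S" "card S = Suc (card B)"
    using infinite_arbitrarily_large by blast
  have max: "maximal_ideal M" "csubspace M" "cspan I \<subseteq> M" if "M \<in> S" for M
    using that S(1) alg_ideal_csubspace[of M] complex_vector.span_minimal[of I M]
    by (auto simp: ideal_support_def maximal_ideal_def)
  have "\<exists>r. r \<in> cspan B \<and> r \<notin> M \<and> (\<forall>M'\<in>S - {M}. r \<in> M')" if M: "M \<in> S" for M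
  proof -
    obtain e where e: "e \<notin> M" "\<forall>M'\<in>S - {M}. e \<in> M'"
      using maximal_ideals_separate[of "S - {M}" M] S(2) max(1) M by auto
    have "e \<in> cspan (B \<union> I)" by (simp add: B)
    then obtain r z where rz: "e = r + z" "r \<in> cspan B" "z \<in> cspan I"
      unfolding complex_vector.span_Un by blast
    have "r \<in> M' \<longleftrightarrow> e \<in> M'" if "M' \<in> S" for M'
      using max(2,3)[OF that] rz complex_vector.subspace_add[of M' r z]
        complex_vector.subspace_diff[of M' e z] by auto
    then show ?thesis using e rz(2) M by auto
  qed
  then obtain r where r: "\<And>M. M \<in> S \<Longrightarrow> r M \<in> cspan B" "\<And>M. M \<in> S \<Longrightarrow> r M \<notin> M"
    "\<And>M M'. M \<in> S \<Longrightarrow> M' \<in> S \<Longrightarrow> M' \<noteq> M \<Longrightarrow> r M \<in> M'"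
    by (metis DiffI singletonD)
  have inj: "inj_on r S" using r(2,3) by (metis inj_onI)
  have "complex_vector.independent (r ` S)"
    unfolding complex_vector.dependent_def
  proof safe
    fix M assume M: "M \<in> S" and dep: "r M \<in> cspan (r ` S - {r M})"
    have "r ` S - {r M} \<subseteq> M" using r(3) M by auto
    then have "cspan (r ` S - {r M}) \<subseteq> M"
      using max(2)[OF M] by (rule complex_vector.span_minimal)
    then show False using dep r(2)[OF M] by blast
  qed
  then have "card (r ` S) \<le> card B"
    using complex_vector.independent_span_bound[OF B(1)] r(1) by blast
  then show False using S(3) card_image[OF inj] by simp
qed


section \<open>Words of operators in a representation\<close>

lemma span_homogeneous_graded:
  assumes sub: "\<And>i. csubspace (\<Gamma> i)" and hom: "\<And>b. b \<in> B \<Longrightarrow> b \<in> \<Gamma> 0 \<or> b \<in> \<Gamma> (1::bit)"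
    and v: "v \<in> cspan B"
  shows "\<exists>v\<^sub>0\<in>cspan B \<inter> \<Gamma> 0. \<exists>v\<^sub>1\<in>cspan B \<inter> \<Gamma> 1. v = v\<^sub>0 + v\<^sub>1"
proof -
  have "B = (B \<inter> \<Gamma> 0) \<union> (B \<inter> \<Gamma> 1)" using hom by blast
  then have "v \<in> cspan ((B \<inter> \<Gamma> 0) \<union> (B \<inter> \<Gamma> 1))" using v by simp
  then obtain a b where ab: "v = a + b" "a \<in> cspan (B \<inter> \<Gamma> 0)" "b \<in> cspan (B \<inter> \<Gamma> 1)"
    unfolding complex_vector.span_Un by blast
  have "cspan (B \<inter> \<Gamma> i) \<subseteq> cspan B \<inter> \<Gamma> i" for i
    using complex_vector.span_mono[of "B \<inter> \<Gamma> i" B]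
      complex_vector.span_minimal[OF _ sub[of i], of "B \<inter> \<Gamma> i"] by auto
  then show ?thesis using ab by blast
qed

locale representation =
  fixes \<alpha> :: "'g::lie_superalgebra \<Rightarrow> 'v::complex_vector \<Rightarrow> 'v"
  assumes linear_right: "clinear (\<alpha> x)"
    and linear_left: "clinear (\<lambda>x. \<alpha> x v)"
    and commutator: "x \<in> gr i \<Longrightarrow> y \<in> gr j \<Longrightarrow>
      \<alpha> x (\<alpha> y v) = koszul_sign i j *\<^sub>C \<alpha> y (\<alpha> x v) + \<alpha> (br x y) v"
begin

lemmas act_simps =
  clinear_add[OF linear_right] clinear_scale[OF linear_right] clinear_zero[OF linear_right]
  clinear_add[OF linear_left] clinear_scale[OF linear_left] clinear_zero[OF linear_left]

text \<open>The number attached to a vector and to an operator is a height: an operator of height \<open>r\<close> adds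
  \<open>r\<close>. It will determine the eigenvalue of a word under a height element, and it bounds the length of a
  word when all operators have positive height.\<close>

inductive_set words :: "('g \<times> nat) set \<Rightarrow> ('v \<times> nat) set \<Rightarrow> ('v \<times> nat) set"
  for Y B where
    base: "(b, k) \<in> B \<Longrightarrow> (b, k) \<in> words Y B"
  | step: "(y, r) \<in> Y \<Longrightarrow> (v, k) \<in> words Y B \<Longrightarrow> (\<alpha> y v, k + r) \<in> words Y B"

definition word_span :: "('g \<times> nat) set \<Rightarrow> ('v \<times> nat) set \<Rightarrow> 'v set"
  where "word_span Y B = cspan (fst ` words Y B)"

lemma csubspace_word_span: "csubspace (word_span Y B)"
  unfolding word_span_def by (rule complex_vector.subspace_span)

lemma word_in_span: "(v, k) \<in> words Y B \<Longrightarrow> v \<in> word_span Y B"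
  unfolding word_span_def by (force intro: complex_vector.span_base)

lemma word_span_minimal:
  assumes "csubspace S" "\<And>b k. (b, k) \<in> B \<Longrightarrow> b \<in> S"
    "\<And>y r v. (y, r) \<in> Y \<Longrightarrow> v \<in> S \<Longrightarrow> \<alpha> y v \<in> S"
  shows "word_span Y B \<subseteq> S"
proof -
  have "v \<in> S" if "(v, k) \<in> words Y B" for v k
    using that by induct (use assms in auto)
  then show ?thesis
    unfolding word_span_def using assms(1) by (intro complex_vector.span_minimal) auto
qed

lemma word_span_step:
  assumes "(y, r) \<in> Y" "v \<in> word_span Y B" shows "\<alpha> y v \<in> word_span Y B"
  using linear_right csubspace_word_span _ assms(2)[unfolded word_span_def]
  by (rule clinear_span_subset) (use words.step[OF assms(1)] word_in_span in fastforce)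

text \<open>By \<open>x y = \<plusminus>y x + [x, y]\<close>, an operator \<open>x\<close> of \<open>X\<close> moves past the letters of a word; the bracket is
  again a combination of letters and of elements of \<open>X\<close>, which act on a shorter word. This replaces the
  Poincare-Birkhoff-Witt theorem for a triangular decomposition.\<close>

lemma word_span_invariant:
  assumes hom: "\<And>x. x \<in> X \<union> fst ` Y \<Longrightarrow> x \<in> gr 0 \<or> x \<in> gr 1"
    and span: "cspan (X \<union> fst ` Y) = UNIV"
    and base: "\<And>x b k. x \<in> X \<Longrightarrow> (b, k) \<in> B \<Longrightarrow> \<alpha> x b \<in> word_span Y B"
    and v: "v \<in> word_span Y B"
  shows "\<alpha> x v \<in> word_span Y B"
proof -
  let ?S = "word_span Y B"
  have all: "\<alpha> z v \<in> ?S" if "\<And>x. x \<in> X \<Longrightarrow> \<alpha> x v \<in> ?S" "v \<in> ?S" for z v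
    using linear_left csubspace_word_span
    by (rule clinear_span_subset[where B = "X \<union> fst ` Y"])
      (use that word_span_step span in auto)
  have "\<alpha> x v \<in> ?S" if "(v, k) \<in> words Y B" "x \<in> X" for x v k
    using that
  proof (induct arbitrary: x)
    case (step y r v k)
    have "y \<in> gr 0 \<or> y \<in> gr 1" using hom step.hyps(1) by force
    then obtain i j where ij: "x \<in> gr i" "y \<in> gr j" using hom[of x] step.prems by blast
    have "\<alpha> y (\<alpha> x v) \<in> ?S" using step by (blast intro: word_span_step)
    moreover have "\<alpha> (br x y) v \<in> ?S" using step by (blast intro: all word_in_span)
    ultimately show ?case
      unfolding commutator[OF ij]
      by (intro complex_vector.subspace_add[OF csubspace_word_span]
          complex_vector.subspace_scale[OF csubspace_word_span])
  qed (rule base)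
  then have "\<alpha> x v \<in> ?S" if "x \<in> X" for x
    by (intro clinear_span_subset[OF linear_right csubspace_word_span _ v[unfolded word_span_def]])
      (use that in auto)
  then show ?thesis using v by (rule all)
qed

lemma finite_words_of_height:
  assumes "finite Y" "\<And>y r. (y, r) \<in> Y \<Longrightarrow> r \<ge> 1" "finite B"
  shows "finite {v. (v, k) \<in> words Y B}"
proof (induct k rule: less_induct)
  case (less k)
  have "{v. (v, k) \<in> words Y B} \<subseteq>
    fst ` B \<union> (\<Union>(y, r)\<in>{(y, r)\<in>Y. r \<le> k}. \<alpha> y ` {v. (v, k - r) \<in> words Y B})"
  proof
    fix v assume "v \<in> {v. (v, k) \<in> words Y B}"
    then have "(v, k) \<in> words Y B" by simp
    then show "v \<in> fst ` B \<union> (\<Union>(y, r)\<in>{(y, r)\<in>Y. r \<le> k}. \<alpha> y ` {v. (v, k - r) \<in> words Y B})"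
    proof cases
      case (step y r u l)
      then show ?thesis by (intro UnI2 UN_I[of "(y, r)"]) auto
    qed force
  qed
  moreover have "finite {v. (v, k - r) \<in> words Y B}" if "(y, r) \<in> Y" "r \<le> k" for y r
    using less[of "k - r"] assms(2)[OF that(1)] that(2) by simp
  moreover have "finite {(y, r)\<in>Y. r \<le> k}"
    by (rule finite_subset[OF _ assms(1)]) auto
  ultimately show ?case
    using assms(3) by (elim finite_subset) auto
qed

lemma weight_shift:
  assumes "d \<in> gr 0" "y \<in> gr 0 \<or> y \<in> gr 1" "br d y = a *\<^sub>C y" "\<alpha> d v = c *\<^sub>C v"
  shows "\<alpha> d (\<alpha> y v) = (c + a) *\<^sub>C \<alpha> y v"
proof -
  obtain j where "y \<in> gr j" using assms(2) by blast
  from commutator[OF assms(1) this, of v] show ?thesis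
    using assms(3,4) by (simp add: koszul_sign_def act_simps scaleC_one scaleC_add_left)
qed

lemma words_weight:
  assumes "d \<in> gr 0" "\<And>y r. (y, r) \<in> Y \<Longrightarrow> y \<in> gr 0 \<or> y \<in> gr 1"
    "\<And>y r. (y, r) \<in> Y \<Longrightarrow> br d y = (- of_nat r) *\<^sub>C y"
    "\<And>b k. (b, k) \<in> B \<Longrightarrow> \<alpha> d b = (c - of_nat k) *\<^sub>C b"
    and "(v, k) \<in> words Y B"
  shows "\<alpha> d v = (c - of_nat k) *\<^sub>C v"
  using assms(5)
proof induct
  case (step y r v k)
  show ?case
    using weight_shift[OF assms(1) assms(2,3)[OF step(1)] step(3)] by (simp add: algebra_simps)
qed (rule assms(4))

end


section \<open>Root vectors of the queer Lie superalgebra\<close>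

definition matrix_unit :: "'n \<Rightarrow> 'n \<Rightarrow> complex ^ 'n ^ 'n::finite"
  where "matrix_unit i j = (\<chi> k l. if k = i \<and> l = j then 1 else 0)"

definition root_vector :: "bit \<Rightarrow> 'n \<Rightarrow> 'n \<Rightarrow> 'n::finite queer"
  where "root_vector s i j = abs_queer (if s = 0 then (matrix_unit i j, 0) else (0, matrix_unit i j))"

text \<open>A representative is determined up to a multiple of the identity, which changes neither the
  difference of two diagonal entries nor, modulo the identity, the diagonal part.\<close>

definition root :: "'n \<Rightarrow> 'n \<Rightarrow> 'n::finite queer \<Rightarrow> complex"
  where "root i j h = fst (rep_queer h) $ i $ i - fst (rep_queer h) $ j $ j"

definition diagonal_part :: "complex ^ 'n ^ 'n \<Rightarrow> complex ^ 'n ^ 'n::finite"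
  where "diagonal_part a = (\<chi> i j. if i = j then a $ i $ j else 0)"

definition queer_diagonal :: "'n::finite queer \<Rightarrow> 'n queer"
  where "queer_diagonal x =
    abs_queer (diagonal_part (fst (rep_queer x)), diagonal_part (snd (rep_queer x)))"

lemma trace_matrix_unit: "i \<noteq> j \<Longrightarrow> trace (matrix_unit i j) = 0"
  by (auto simp: trace_def matrix_unit_def intro!: sum.neutral)

lemma trace_diagonal_part: "trace (diagonal_part a) = trace a"
  by (simp add: trace_def diagonal_part_def)

lemma diagonal_part_linear:
  "diagonal_part (a + b) = diagonal_part a + diagonal_part b"
  "diagonal_part (c *\<^sub>C a) = c *\<^sub>C diagonal_part a"
  by (simp_all add: diagonal_part_def vec_eq_iff scaleC_vec_def scaleC_complex_def)

lemma diagonal_part_eqs: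
  "diagonal_matrix a \<Longrightarrow> diagonal_part a = a" "strictly_upper b \<Longrightarrow> diagonal_part b = 0"
  "diagonal_part 0 = 0" "diagonal_part (mat 1) = mat 1"
  by (auto simp: diagonal_part_def diagonal_matrix_def strictly_upper_def vec_eq_iff mat_def)

lemma rep_abs_queer:
  assumes "trace b = 0"
  obtains c where "rep_queer (abs_queer (a, b)) = (a + c *\<^sub>C mat 1, b)"
proof -
  have "queer_rel (a, b) (a, b)" using assms by (simp add: queer_relI')
  then have "queer_rel (rep_queer (abs_queer (a, b))) (a, b)"
    by (rule rep_abs_rsp_left[OF Quotient3_queer])
  then show ?thesis
    by (elim queer_relE) (auto simp: scaleC_prod_def intro: that)
qed

lemma queer_diagonal_abs:
  assumes "trace b = 0"
  shows "queer_diagonal (abs_queer (a, b)) = abs_queer (diagonal_part a, diagonal_part b)"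
proof -
  obtain c where c: "rep_queer (abs_queer (a, b)) = (a + c *\<^sub>C mat 1, b)"
    using assms by (rule rep_abs_queer)
  show ?thesis
    unfolding queer_diagonal_def c using assms
    by (auto simp: diagonal_part_linear diagonal_part_eqs queer_abs_eq trace_diagonal_part)
qed

lemma clinear_queer_diagonal: "clinear queer_diagonal"
proof (rule clinearI)
  fix x y :: "'a queer" and c
  obtain a b where x: "x = abs_queer (a, b)" "trace b = 0" by (rule queer_cases)
  obtain a' b' where y: "y = abs_queer (a', b')" "trace b' = 0" by (rule queer_cases)
  show "queer_diagonal (x + y) = queer_diagonal x + queer_diagonal y"
    using x y by (simp add: queer_abs_ops queer_diagonal_abs trace_add trace_diagonal_part
        diagonal_part_linear)
  show "queer_diagonal (c *\<^sub>C x) = c *\<^sub>C queer_diagonal x"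
    using x by (simp add: queer_abs_ops queer_diagonal_abs trace_scaleC trace_diagonal_part
        diagonal_part_linear)
qed

lemma diagonal_matrix_shift:
  "diagonal_matrix a \<Longrightarrow> diagonal_matrix (a + c *\<^sub>C mat 1)"
  by (simp add: diagonal_matrix_def scaleC_vec_def mat_def scaleC_complex_def)

text \<open>Modulo the identity matrix, every diagonal matrix is traceless.\<close>

lemma q_h0_eq: "q_h0 = {abs_queer (a, 0) | a :: complex ^ 'n ^ 'n::finite. diagonal_matrix a}"
proof -
  have "\<exists>a'. abs_queer (a, 0) = abs_queer (a', 0) \<and> diagonal_matrix a' \<and> trace a' = 0"
    if "diagonal_matrix a" for a :: "complex ^ 'n ^ 'n"
  proof -
    let ?c = "- (trace a / of_nat CARD('n))"
    have "trace (a + ?c *\<^sub>C mat 1) = 0"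
      unfolding trace_add trace_scaleC trace_I by simp
    moreover have "abs_queer (a, 0) = abs_queer (a + ?c *\<^sub>C mat 1, 0)"
      unfolding queer_abs_eq[OF trace_zero trace_zero]
      by (intro conjI exI[of _ "- ?c"]) (simp_all add: complex_vector.scale_minus_left)
    ultimately show ?thesis using diagonal_matrix_shift[OF that] by blast
  qed
  then show ?thesis unfolding q_h0_def by blast
qed

lemma csubspace_q_h0: "csubspace (q_h0 :: 'n::finite queer set)"
proof (rule complex_vector.subspaceI)
  show "0 \<in> (q_h0 :: 'n queer set)"
    unfolding q_h0_eq zero_queer_eq by (auto simp: diagonal_matrix_def)
next
  fix x y :: "'n queer" assume "x \<in> q_h0" "y \<in> q_h0"
  then obtain a b where "x = abs_queer (a, 0)" "y = abs_queer (b, 0)"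
    "diagonal_matrix a" "diagonal_matrix b"
    unfolding q_h0_eq by blast
  then show "x + y \<in> q_h0"
    unfolding q_h0_eq by (auto simp: queer_abs_ops trace_zero diagonal_matrix_def intro!: exI[of _ "a + b"])
next
  fix c and x :: "'n queer" assume "x \<in> q_h0"
  then obtain a where a: "x = abs_queer (a, 0)" "diagonal_matrix a"
    unfolding q_h0_eq by blast
  have "c *\<^sub>C x = abs_queer (c *\<^sub>C a, 0)"
    by (simp add: a(1) queer_abs_ops trace_zero)
  moreover have "diagonal_matrix (c *\<^sub>C a)"
    using a(2) by (simp add: diagonal_matrix_def scaleC_vec_def scaleC_complex_def)
  ultimately show "c *\<^sub>C x \<in> q_h0" unfolding q_h0_eq by blast
qed

lemma cartan_homogeneous: "x \<in> q_h0 \<Longrightarrow> x \<in> gr 0" "x \<in> q_h1 \<Longrightarrow> x \<in> gr 1"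
  by (auto simp: q_h0_def q_h1_def gr_queer_def)

lemma cartan_subset_q_h: "q_h0 \<subseteq> (q_h :: 'n::finite queer set)" "q_h1 \<subseteq> (q_h :: 'n::finite queer set)"
proof -
  have "diagonal_matrix (0 :: complex ^ 'n ^ 'n)" by (simp add: diagonal_matrix_def)
  then have "0 \<in> (q_h0 :: 'n queer set)" "0 \<in> (q_h1 :: 'n queer set)"
    unfolding q_h0_def q_h1_def zero_queer_eq using trace_zero by blast+
  then have "x \<in> q_h0 \<Longrightarrow> x + 0 \<in> q_h" "x \<in> q_h1 \<Longrightarrow> 0 + x \<in> q_h" for x :: "'n queer"
    unfolding q_h_def by blast+
  then show "q_h0 \<subseteq> (q_h :: 'n queer set)" "q_h1 \<subseteq> (q_h :: 'n queer set)" by auto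
qed

lemma q_h1_bracket:
  assumes "x \<in> q_h1" "y \<in> q_h1"
  shows "br x y \<in> (q_h0 :: 'n::finite queer set)"
proof -
  obtain a b :: "complex ^ 'n ^ 'n" where ab: "x = abs_queer (0, a)" "diagonal_matrix a" "trace a = 0"
    "y = abs_queer (0, b)" "diagonal_matrix b" "trace b = 0"
    using assms unfolding q_h1_def by blast
  have "(c ** d) $ i $ j = 0"
    if "diagonal_matrix c" "diagonal_matrix d" "i \<noteq> j" for c d :: "complex ^ 'n ^ 'n" and i j
  proof -
    have "c $ i $ k * d $ k $ j = 0" for k
      using that by (cases "k = i") (simp_all add: diagonal_matrix_def)
    then show ?thesis
      unfolding matrix_matrix_mult_def by (simp only: vec_lambda_beta sum.neutral_const)
  qed
  then have "diagonal_matrix (a ** b + b ** a)" using ab by (simp add: diagonal_matrix_def)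
  then show ?thesis
    unfolding q_h0_eq ab by (auto simp: queer_abs_ops qbr_def ab)
qed

lemma root_vector_homogeneous: "i \<noteq> j \<Longrightarrow> root_vector s i j \<in> gr s"
  by (cases s) (auto simp: root_vector_def gr_queer_def trace_matrix_unit)

lemma root_vector_nplus:
  fixes i j :: "'n::{finite, linorder}"
  assumes "i < j" shows "root_vector s i j \<in> q_nplus"
proof -
  have "strictly_upper (matrix_unit i j)" "strictly_upper 0"
    using assms by (auto simp: strictly_upper_def matrix_unit_def)
  then show ?thesis unfolding root_vector_def q_nplus_def by (cases s) (simp_all, blast+)
qed

lemma root_abs_queer:
  assumes "trace b = 0" shows "root i j (abs_queer (a, b)) = a $ i $ i - a $ j $ j"
proof -
  obtain c where "rep_queer (abs_queer (a, b)) = (a + c *\<^sub>C mat 1, b)"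
    using assms by (rule rep_abs_queer)
  then show ?thesis by (simp add: root_def scaleC_vec_def mat_def)
qed

lemma root_linear: "root i j (x + y) = root i j x + root i j y" "root i j (c *\<^sub>C x) = c * root i j x"
proof -
  obtain a b where x: "x = abs_queer (a, b)" "trace b = 0" by (rule queer_cases)
  obtain a' b' where y: "y = abs_queer (a', b')" "trace b' = 0" by (rule queer_cases)
  show "root i j (x + y) = root i j x + root i j y"
    using x y by (simp add: queer_abs_ops root_abs_queer trace_add)
  have "root i j (c *\<^sub>C x) = (c *\<^sub>C a) $ i $ i - (c *\<^sub>C a) $ j $ j"
    using x by (simp add: queer_abs_ops root_abs_queer trace_scaleC)
  then show "root i j (c *\<^sub>C x) = c * root i j x"
    using x by (simp add: root_abs_queer scaleC_vec_def scaleC_complex_def right_diff_distrib)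
qed

lemma q_h0_root_vector:
  assumes h: "h \<in> q_h0" and ij: "i \<noteq> j"
  shows "br h (root_vector s i j) = root i j h *\<^sub>C root_vector s i j"
proof -
  obtain a where a: "h = abs_queer (a, 0)" "diagonal_matrix a"
    using h unfolding q_h0_eq by blast
  have root: "root i j h = a $ i $ i - a $ j $ j"
    unfolding a(1) by (rule root_abs_queer[OF trace_zero])
  have "(a ** matrix_unit i j) $ k $ l = a $ i $ i * matrix_unit i j $ k $ l"
    "(matrix_unit i j ** a) $ k $ l = a $ j $ j * matrix_unit i j $ k $ l" for k l
  proof -
    have "(\<Sum>m\<in>UNIV. a $ k $ m * matrix_unit i j $ m $ l)
        = (\<Sum>m\<in>UNIV. if m = i then a $ k $ i * matrix_unit i j $ i $ l else 0)"
      "(\<Sum>m\<in>UNIV. matrix_unit i j $ k $ m * a $ m $ l)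
        = (\<Sum>m\<in>UNIV. if m = j then matrix_unit i j $ k $ j * a $ j $ l else 0)"
      by (intro sum.cong refl; simp add: matrix_unit_def)+
    then have "(a ** matrix_unit i j) $ k $ l = a $ k $ i * matrix_unit i j $ i $ l"
      "(matrix_unit i j ** a) $ k $ l = matrix_unit i j $ k $ j * a $ j $ l"
      by (simp_all add: matrix_matrix_mult_def)
    then show "(a ** matrix_unit i j) $ k $ l = a $ i $ i * matrix_unit i j $ k $ l"
      "(matrix_unit i j ** a) $ k $ l = a $ j $ j * matrix_unit i j $ k $ l"
      using a(2) by (auto simp: matrix_unit_def diagonal_matrix_def)
  qed
  then have "a ** matrix_unit i j - matrix_unit i j ** a = (a $ i $ i - a $ j $ j) *\<^sub>C matrix_unit i j"
    by (simp add: vec_eq_iff scaleC_vec_def scaleC_complex_def algebra_simps)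
  then show ?thesis
    unfolding root unfolding a(1) using ij
    by (cases s) (simp_all add: root_vector_def queer_abs_ops trace_zero trace_matrix_unit qbr_def)
qed

lemma matrix_eq_sum_units: "a = (\<Sum>i\<in>UNIV. \<Sum>j\<in>UNIV. a $ i $ j *\<^sub>C matrix_unit i j)"
proof -
  have "(\<Sum>i\<in>UNIV. \<Sum>j\<in>UNIV. a $ i $ j * (if k = i \<and> l = j then 1 else 0)) = a $ k $ l" for k l
  proof -
    have "(\<Sum>j\<in>UNIV. a $ i $ j * (if k = i \<and> l = j then 1 else 0)) = (if i = k then a $ i $ l else 0)"
      for i by (simp add: if_distrib[of "(*) _"] cong: if_cong)
    then show ?thesis by simp
  qed
  then show ?thesis
    by (simp add: vec_eq_iff scaleC_vec_def scaleC_complex_def matrix_unit_def)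
qed

lemma queer_spanned:
  "x \<in> cspan (q_h0 \<union> q_h1 \<union> {root_vector s i j | s i j. i \<noteq> (j::'n::finite)})"
proof -
  let ?S = "cspan (q_h0 \<union> q_h1 \<union> {root_vector s i j | s i j. i \<noteq> (j::'n::finite)})"
  let ?off = "\<lambda>a :: complex ^ 'n ^ 'n. a - diagonal_part a"
  \<comment> \<open>An off-diagonal part is traceless, so \<open>L s\<close> is linear on all matrices, although a matrix unit on
    the diagonal alone does not define an odd element.\<close>
  define L where "L s a = abs_queer (if s = (0::bit) then (?off a, 0) else (0, ?off a))" for s a
  have tr: "trace (?off a) = 0" for a by (simp add: trace_sub trace_diagonal_part)
  have lin: "clinear (L s)" for s
    unfolding L_def
  proof (rule clinearI)
    have e: "?off (x + y) = ?off x + ?off y" "?off (c *\<^sub>C x) = c *\<^sub>C ?off x" for x y c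
      by (simp_all add: diagonal_part_linear complex_vector.scale_right_diff_distrib)
    fix x y :: "complex ^ 'n ^ 'n" and c
    show "abs_queer (if s = 0 then (?off (x + y), 0) else (0, ?off (x + y))) =
      abs_queer (if s = 0 then (?off x, 0) else (0, ?off x)) +
      abs_queer (if s = 0 then (?off y, 0) else (0, ?off y))"
      unfolding e using tr by (cases s) (simp_all add: queer_abs_ops trace_zero)
    show "abs_queer (if s = 0 then (?off (c *\<^sub>C x), 0) else (0, ?off (c *\<^sub>C x))) =
      c *\<^sub>C abs_queer (if s = 0 then (?off x, 0) else (0, ?off x))"
      unfolding e using tr by (cases s) (simp_all add: queer_abs_ops trace_zero)
  qed
  have unit: "L s (matrix_unit i j) \<in> ?S" for s i j
  proof (cases "i = j")
    case True
    then have "?off (matrix_unit i j) = 0"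
      by (simp add: vec_eq_iff diagonal_part_def matrix_unit_def)
    then have "L s (matrix_unit i j) = 0" by (simp add: L_def zero_queer_eq)
    then show ?thesis by (simp add: complex_vector.span_zero)
  next
    case False
    then have "?off (matrix_unit i j) = matrix_unit i j"
      by (simp add: vec_eq_iff diagonal_part_def matrix_unit_def)
    then have "L s (matrix_unit i j) = root_vector s i j" by (simp add: L_def root_vector_def)
    then show ?thesis using False by (auto intro!: complex_vector.span_base)
  qed
  have off: "L s a \<in> ?S" for s a
    by (subst matrix_eq_sum_units[of a], unfold clinear_sum[OF lin] clinear_scale[OF lin])
      (intro complex_vector.span_sum complex_vector.span_scale unit)
  obtain a b where x: "x = abs_queer (a, b)" "trace b = 0" by (rule queer_cases)
  have "diagonal_matrix (diagonal_part m)" for m :: "complex ^ 'n ^ 'n"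
    by (simp add: diagonal_matrix_def diagonal_part_def)
  then have "abs_queer (diagonal_part a, 0) \<in> ?S" "abs_queer (0, diagonal_part b) \<in> ?S"
    using x(2) by (auto simp: q_h0_eq q_h1_def trace_diagonal_part intro!: complex_vector.span_base)
  then have "abs_queer (diagonal_part a, 0) + L 0 a + (abs_queer (0, diagonal_part b) + L 1 b) \<in> ?S"
    using off[of 0 a] off[of 1 b] by (intro complex_vector.span_add)
  also have "abs_queer (diagonal_part a, 0) + L 0 a + (abs_queer (0, diagonal_part b) + L 1 b) = x"
    unfolding x(1) using tr x(2)
    by (simp add: L_def queer_abs_ops trace_zero trace_diagonal_part)
  finally show ?thesis .
qed

definition position :: "'n::{finite, linorder} \<Rightarrow> nat"
  where "position i = card {j. j < i}"

lemma position_less: "i < j \<Longrightarrow> position i < position j"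
  unfolding position_def by (intro psubset_card_mono) (auto intro: less_trans)

text \<open>Up to a scalar matrix, this is the half sum of the positive coroots; it multiplies the root vectors of
  \<open>\<nn>\<^sup>-\<close> by negative integers.\<close>

definition height_element :: "'n::{finite, linorder} queer"
  where "height_element = abs_queer (\<chi> i j. if i = j then - of_nat (position i) else 0, 0)"

lemma height_element_q_h0: "height_element \<in> q_h0"
  unfolding height_element_def q_h0_eq by (auto simp: diagonal_matrix_def)

lemma root_height_element:
  fixes i j :: "'n::{finite, linorder}"
  assumes "j < i"
  shows "root i j height_element = - of_nat (position i - position j)"
  using position_less[OF assms]
  by (simp add: height_element_def root_abs_queer[OF trace_zero] of_nat_diff)


section \<open>Triangular spanning sets of the map algebra\<close>

definition borel_generators :: "'a::comm_complex_algebra_1 set \<Rightarrow> ('n::{finite, linorder}, 'a) queer_map set"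
  where "borel_generators J =
    {x \<otimes>\<^sub>t f | x f. x \<in> q_h0 \<union> q_h1 \<union> {root_vector s i j | s i j. i < j} \<and> f \<in> J}"

definition lowering_operators ::
  "'a::comm_complex_algebra_1 set \<Rightarrow> (('n::{finite, linorder}, 'a) queer_map \<times> nat) set"
  where "lowering_operators J =
    {(root_vector s i j \<otimes>\<^sub>t f, position i - position j) | s i j f. j < i \<and> f \<in> J}"

lemma tens_linear:
  "clinear (\<lambda>x. x \<otimes>\<^sub>t f)" "clinear (\<lambda>f. x \<otimes>\<^sub>t f)"
  by (intro clinearI; simp add: tens_add_left tens_scale_left tens_add_right tens_scale_right)+

lemma tensor_span_triangular:
  fixes J :: "'a::comm_complex_algebra_1 set"
  shows "(tensor_span UNIV J :: ('n::{finite, linorder}, 'a) queer_map set) \<subseteq>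
    cspan (borel_generators J \<union> fst ` lowering_operators J)"
proof -
  let ?S = "cspan (borel_generators J \<union> fst ` lowering_operators J)"
  have "x \<otimes>\<^sub>t f \<in> ?S" if f: "f \<in> J" for x :: "'n queer" and f
    using tens_linear(1) complex_vector.subspace_span _ queer_spanned
  proof (rule clinear_span_subset)
    fix x :: "'n queer"
    assume "x \<in> q_h0 \<union> q_h1 \<union> {root_vector s i j | s i j. i \<noteq> j}"
    then consider "x \<in> q_h0 \<union> q_h1 \<union> {root_vector s i j | s i j. i < j}"
      | s i j where "x = root_vector s i j" "j < i"
      by (auto simp: neq_iff)
    then have "x \<otimes>\<^sub>t f \<in> borel_generators J \<union> fst ` lowering_operators J"
    proof cases
      case 1
      then show ?thesis unfolding borel_generators_def using f by blast
    next
      case (2 s i j)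
      then have "(x \<otimes>\<^sub>t f, position i - position j) \<in> lowering_operators J"
        unfolding lowering_operators_def using f by blast
      then show ?thesis by force
    qed
    then show "x \<otimes>\<^sub>t f \<in> ?S" by (rule complex_vector.span_base)
  qed
  then show ?thesis
    unfolding tensor_span_def
    by (intro complex_vector.span_minimal[OF _ complex_vector.subspace_span]) auto
qed

lemma triangular_span_UNIV:
  "cspan (borel_generators UNIV \<union> fst ` lowering_operators UNIV) = UNIV"
  using tensor_span_triangular[of UNIV] by (simp add: tensor_span_UNIV top.extremum_unique)

lemma lowering_operator_homogeneous:
  "(y, r) \<in> lowering_operators J \<Longrightarrow> y \<in> gr 0 \<or> y \<in> gr 1"
proof -
  assume "(y, r) \<in> lowering_operators J"
  then obtain s i j f where "y = root_vector s i j \<otimes>\<^sub>t f" "j < i"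
    unfolding lowering_operators_def by blast
  then have "y \<in> gr s" by (auto intro: tens_in_gr root_vector_homogeneous)
  then show ?thesis by (cases s) auto
qed

lemma triangular_homogeneous:
  fixes x :: "('n::{finite, linorder}, 'a::comm_complex_algebra_1) queer_map"
  assumes "x \<in> borel_generators J \<union> fst ` lowering_operators J"
  shows "x \<in> gr 0 \<or> x \<in> gr 1"
proof (cases "x \<in> borel_generators J")
  case True
  then obtain a f where x: "x = a \<otimes>\<^sub>t f" "a \<in> q_h0 \<union> q_h1 \<union> {root_vector s i j | s i j. i < j}"
    unfolding borel_generators_def by blast
  have "a \<in> gr 0 \<or> a \<in> gr 1"
  proof -
    have "root_vector s i j \<in> gr 0 \<or> root_vector s i j \<in> gr 1" if "i < j" for s and i j :: 'n
      using root_vector_homogeneous[of i j s] that by (cases s) auto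
    then show ?thesis using x(2) cartan_homogeneous by blast
  qed
  then show ?thesis using x(1) by (auto intro: tens_in_gr)
next
  case False
  then show ?thesis using assms lowering_operator_homogeneous by fastforce
qed

lemma triangular_in_tensor_span:
  "x \<in> borel_generators J \<union> fst ` lowering_operators J \<Longrightarrow> x \<in> tensor_span UNIV J"
  unfolding borel_generators_def lowering_operators_def tensor_span_def
  by (rule complex_vector.span_base) (auto; blast)

lemma bracket_tensor_span_ideal:
  assumes I: "alg_ideal I" and z: "z \<in> tensor_span UNIV I"
  shows "br x z \<in> tensor_span UNIV I"
  using z unfolding tensor_span_def
proof (rule clinear_span_subset[rotated 3])
  show "clinear (br x)" by (intro clinearI) (simp_all add: br_add_right br_scale_right)
  show "br x b \<in> cspan {x \<otimes>\<^sub>t y |x y. x \<in> UNIV \<and> y \<in> I}"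
    if "b \<in> {x \<otimes>\<^sub>t y |x y. x \<in> UNIV \<and> y \<in> I}" for b
  proof -
    obtain y f where b: "b = y \<otimes>\<^sub>t f" "f \<in> I" using \<open>b \<in> _\<close> by blast
    show ?thesis unfolding b(1)
    proof (induct x rule: tensor_induct)
      case (tens a g)
      show ?case
        unfolding br_tens using ideal_mult_mem[OF I b(2)]
        by (intro complex_vector.span_base) blast
    qed (simp add: br_add_left complex_vector.span_add)
  qed
qed (rule complex_vector.subspace_span)

lemma finite_lowering_operators: "finite J \<Longrightarrow> finite (lowering_operators J)"
proof -
  assume J: "finite J"
  have "UNIV = {0, 1 :: bit}" using bit.exhaust by blast
  then have "finite (UNIV :: bit set)" by (metis finite.emptyI finite.insertI)
  with J have "finite ((\<lambda>(s, i, j, f). (root_vector s i j \<otimes>\<^sub>t f, position i - position j)) `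
    (UNIV \<times> UNIV \<times> UNIV \<times> J))"
    by (intro finite_imageI finite_cartesian_product) simp_all
  then show ?thesis by (rule rev_finite_subset) (force simp: lowering_operators_def)
qed

lemma lowering_operator_height:
  "(y, r) \<in> lowering_operators J \<Longrightarrow> r \<ge> 1"
  using position_less by (fastforce simp: lowering_operators_def)

lemma br_cartan_root_vector:
  assumes "h \<in> q_h0" "i \<noteq> j"
  shows "br (h \<otimes>\<^sub>t 1) (root_vector s i j \<otimes>\<^sub>t f) = root i j h *\<^sub>C (root_vector s i j \<otimes>\<^sub>t f)"
  using assms by (simp add: br_tens q_h0_root_vector tens_scale_left)

lemma br_height_lowering_operator:
  "(y, r) \<in> lowering_operators J \<Longrightarrow> br (height_element \<otimes>\<^sub>t 1) y = (- of_nat r) *\<^sub>C y"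
  unfolding lowering_operators_def
  by (auto simp: br_cartan_root_vector[OF height_element_q_h0] root_height_element)


section \<open>Irreducible highest weight modules\<close>

text \<open>These are the properties of \<open>V(\<psi>)\<close> that decide the theorem, stated without reference to its
  construction as a quotient of an induced module: \<open>T\<close> is the image of \<open>H(\<psi>)\<close>, \<open>\<kappa>\<close> is the restriction
  of \<open>\<psi>\<close> to \<open>\<hh>\<^sub>0\<close>, and \<open>I\<close> is an ideal that witnesses condition (3).\<close>

locale irreducible_highest_weight = representation \<alpha>
  for \<alpha> :: "('n::{finite, linorder}, 'a::comm_complex_algebra_1) queer_map
      \<Rightarrow> 'v::complex_vector \<Rightarrow> 'v" +
  fixes \<Gamma> :: "bit \<Rightarrow> 'v set" and T :: "'v set" and \<kappa> :: "'n queer \<Rightarrow> complex" and I :: "'a set"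
  assumes grading: "csubspace (\<Gamma> i)"
    and graded_action: "z \<in> gr i \<Longrightarrow> v \<in> \<Gamma> j \<Longrightarrow> \<alpha> z v \<in> \<Gamma> (i + j)"
    and irreducible: "submodule UNIV \<Gamma> \<alpha> S \<Longrightarrow> S = {0} \<or> S = UNIV"
    and nonzero: "(UNIV :: 'v set) \<noteq> {0}"
    and generated: "csubspace S \<Longrightarrow> T \<subseteq> S \<Longrightarrow> (\<And>z v. v \<in> S \<Longrightarrow> \<alpha> z v \<in> S) \<Longrightarrow> S = UNIV"
    and top_subspace: "csubspace T"
    and top_graded: "w \<in> T \<Longrightarrow> \<exists>w\<^sub>0\<in>T \<inter> \<Gamma> 0. \<exists>w\<^sub>1\<in>T \<inter> \<Gamma> 1. w = w\<^sub>0 + w\<^sub>1"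
    and top_finite: "finite_dimensional T"
    and top_cartan: "x \<in> q_h0 \<union> q_h1 \<Longrightarrow> w \<in> T \<Longrightarrow> \<alpha> (x \<otimes>\<^sub>t f) w \<in> T"
    and top_nplus: "x \<in> q_nplus \<Longrightarrow> w \<in> T \<Longrightarrow> \<alpha> (x \<otimes>\<^sub>t f) w = 0"
    and top_weight: "h \<in> q_h0 \<Longrightarrow> w \<in> T \<Longrightarrow> \<alpha> (h \<otimes>\<^sub>t 1) w = \<kappa> h *\<^sub>C w"
    and weight_dual: "\<kappa> \<in> dual_space q_h0"
    and ideal: "alg_ideal I" "finite_codimensional I"
    and top_ideal: "x \<in> q_h0 \<union> q_h1 \<Longrightarrow> f \<in> I \<Longrightarrow> w \<in> T \<Longrightarrow> \<alpha> (x \<otimes>\<^sub>t f) w = 0"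
begin

lemma top_borel: "x \<in> borel_generators UNIV \<Longrightarrow> w \<in> T \<Longrightarrow> \<alpha> x w \<in> T"
  and top_borel_ideal: "x \<in> borel_generators I \<Longrightarrow> w \<in> T \<Longrightarrow> \<alpha> x w = 0"
  using top_cartan top_ideal top_nplus[OF root_vector_nplus] complex_vector.subspace_0[OF top_subspace]
  by (auto simp: borel_generators_def)

lemma lowered_words_of_top_span: "word_span (lowering_operators UNIV) (T \<times> {0}) = UNIV"
proof (rule generated)
  let ?S = "word_span (lowering_operators UNIV) (T \<times> {0})"
  show "csubspace ?S" by (rule csubspace_word_span)
  show T: "T \<subseteq> ?S" by (auto intro: word_in_span words.base)
  show "\<alpha> x v \<in> ?S" if "v \<in> ?S" for x v
    using triangular_homogeneous triangular_span_UNIV _ that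
    by (rule word_span_invariant) (use T top_borel in auto)
qed

lemma words_height_weight:
  assumes "\<And>b k. (b, k) \<in> B \<Longrightarrow> \<alpha> (height_element \<otimes>\<^sub>t 1) b = (c - of_nat k) *\<^sub>C b"
    and "(v, k) \<in> words (lowering_operators J) B"
  shows "\<alpha> (height_element \<otimes>\<^sub>t 1) v = (c - of_nat k) *\<^sub>C v"
  using _ lowering_operator_homogeneous br_height_lowering_operator assms
  by (rule words_weight) (intro tens_in_gr cartan_homogeneous height_element_q_h0)

text \<open>The vectors \<open>y w\<close> with \<open>y \<in> \<nn>\<^sup>- \<otimes> I\<close> and \<open>w \<in> T\<close> generate a submodule spanned by vectors of
  positive height, hence a proper one, hence zero by irreducibility.\<close>

lemma ideal_kills_top:
  assumes "z \<in> tensor_span UNIV I" "w \<in> T"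
  shows "\<alpha> z w = 0"
proof -
  let ?Y = "lowering_operators UNIV :: (('n, 'a) queer_map \<times> nat) set"
  define B where "B = {(\<alpha> y w, r) | y r w. (y, r) \<in> lowering_operators I \<and> w \<in> T \<inter> (\<Gamma> 0 \<union> \<Gamma> 1)}"
  let ?K = "word_span ?Y B"
  have low: "\<alpha> y w \<in> ?K" if y: "(y, r) \<in> lowering_operators I" and "w \<in> T" for y r w
  proof -
    obtain w\<^sub>0 w\<^sub>1 where w: "w = w\<^sub>0 + w\<^sub>1" "w\<^sub>0 \<in> T \<inter> \<Gamma> 0" "w\<^sub>1 \<in> T \<inter> \<Gamma> 1"
      using top_graded \<open>w \<in> T\<close> by blast
    then have "(\<alpha> y w\<^sub>0, r) \<in> B" "(\<alpha> y w\<^sub>1, r) \<in> B" unfolding B_def using y by blast+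
    then have "\<alpha> y w\<^sub>0 \<in> ?K" "\<alpha> y w\<^sub>1 \<in> ?K" by (auto intro: word_in_span words.base)
    then show ?thesis
      by (simp add: w(1) act_simps complex_vector.subspace_add[OF csubspace_word_span])
  qed
  have all: "\<alpha> z w \<in> ?K" if "z \<in> tensor_span UNIV I" "w \<in> T" for z w
    using linear_left csubspace_word_span _ subsetD[OF tensor_span_triangular that(1)]
  proof (rule clinear_span_subset)
    fix b :: "('n, 'a) queer_map"
    assume "b \<in> borel_generators I \<union> fst ` lowering_operators I"
    then show "\<alpha> b w \<in> ?K"
      using low top_borel_ideal[OF _ that(2)] that(2)
      by (auto simp: complex_vector.subspace_0[OF csubspace_word_span])
  qed
  have "submodule UNIV \<Gamma> \<alpha> ?K"
    unfolding submodule_def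
  proof (intro conjI ballI)
    show "csubspace ?K" by (rule csubspace_word_span)
  next
    fix v assume v: "v \<in> ?K"
    have "v \<in> \<Gamma> 0 \<or> v \<in> \<Gamma> 1" if "(v, k) \<in> words ?Y B" for v k
      using that
    proof induct
      case (base b k)
      then obtain y r w where b: "b = \<alpha> y w" "(y, r) \<in> lowering_operators I" "w \<in> \<Gamma> 0 \<union> \<Gamma> 1"
        unfolding B_def by blast
      then obtain i j where "y \<in> gr i" "w \<in> \<Gamma> j" using lowering_operator_homogeneous by blast
      then have "\<alpha> y w \<in> \<Gamma> (i + j)" by (rule graded_action)
      then show ?case unfolding b(1) by (cases "i + j") auto
    next
      case (step y r v k)
      then obtain i j where "y \<in> gr i" "v \<in> \<Gamma> j" using lowering_operator_homogeneous by blast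
      then have "\<alpha> y v \<in> \<Gamma> (i + j)" by (rule graded_action)
      then show ?case by (cases "i + j") auto
    qed
    then have "b \<in> \<Gamma> 0 \<or> b \<in> \<Gamma> 1" if "b \<in> fst ` words ?Y B" for b
      using that by fastforce
    then show "\<exists>v\<^sub>0\<in>?K \<inter> \<Gamma> 0. \<exists>v\<^sub>1\<in>?K \<inter> \<Gamma> 1. v = v\<^sub>0 + v\<^sub>1"
      using v unfolding word_span_def by (intro span_homogeneous_graded grading)
  next
    fix x v assume v: "v \<in> ?K"
    show "\<alpha> x v \<in> ?K"
      using triangular_homogeneous triangular_span_UNIV _ v
    proof (rule word_span_invariant)
      fix x :: "('n, 'a) queer_map" and b k
      assume x: "x \<in> borel_generators UNIV" and "(b, k) \<in> B"
      then obtain y w where b: "b = \<alpha> y w" "(y, k) \<in> lowering_operators I" "w \<in> T"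
        unfolding B_def by blast
      obtain i j where ij: "x \<in> gr i" "y \<in> gr j"
        using triangular_homogeneous[of x UNIV] x lowering_operator_homogeneous[OF b(2)] by blast
      have "y \<in> tensor_span UNIV I" using b(2) triangular_in_tensor_span[of y I] by force
      then have "\<alpha> (br x y) w \<in> ?K" using b(3) by (intro all bracket_tensor_span_ideal ideal(1))
      moreover have "\<alpha> y (\<alpha> x w) \<in> ?K" using b(2,3) x top_borel low by blast
      ultimately show "\<alpha> x b \<in> ?K"
        unfolding b(1) commutator[OF ij]
        by (intro complex_vector.subspace_add[OF csubspace_word_span]
            complex_vector.subspace_scale[OF csubspace_word_span])
    qed
  qed
  then have "?K = {0} \<or> ?K = UNIV" by (rule irreducible)
  moreover have "?K \<noteq> UNIV"
  proof
    assume K: "?K = UNIV"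
    let ?E = "\<lambda>k::nat. {v. \<forall>h\<in>{height_element}. \<alpha> (h \<otimes>\<^sub>t 1) v = (\<kappa> h - of_nat k) *\<^sub>C v}"
    have B: "\<alpha> (height_element \<otimes>\<^sub>t 1) b = (\<kappa> height_element - of_nat k) *\<^sub>C b \<and> k \<ge> 1"
      if "(b, k) \<in> B" for b k
    proof -
      obtain y w where b: "b = \<alpha> y w" "(y, k) \<in> lowering_operators I" "w \<in> T"
        using \<open>(b, k) \<in> B\<close> unfolding B_def by blast
      have "\<alpha> (height_element \<otimes>\<^sub>t 1) b = (\<kappa> height_element + - of_nat k) *\<^sub>C b"
        unfolding b(1)
        by (rule weight_shift[OF tens_in_gr[OF cartan_homogeneous(1)[OF height_element_q_h0]]
              lowering_operator_homogeneous[OF b(2)] br_height_lowering_operator[OF b(2)]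
              top_weight[OF height_element_q_h0 b(3)]])
      then show ?thesis using lowering_operator_height[OF b(2)] by simp
    qed
    have pos: "k \<ge> 1" if "(v, k) \<in> words ?Y B" for v k
      using that by induct (use B in auto)
    have "(v, k) \<in> words ?Y B \<Longrightarrow> v \<in> (\<Union>k\<in>{1..}. ?E k)" for v k
      using words_height_weight[of B "\<kappa> height_element" v k UNIV] B pos[of v k] by auto
    then have "?K \<subseteq> cspan (\<Union>k\<in>{1..}. ?E k)"
      unfolding word_span_def by (intro complex_vector.span_mono) auto
    then have "v \<in> cspan (\<Union>k\<in>{1..}. ?E k)" for v using K by blast
    then have "w = 0" if "w \<in> T" for w
      by (intro joint_eigenspaces_independent[of "{height_element}" "\<lambda>h. \<alpha> (h \<otimes>\<^sub>t 1)" "{1..}"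
            "\<lambda>k h. \<kappa> h - of_nat k" \<kappa> w])
        (use that top_weight height_element_q_h0 linear_right in auto)
    then have "{0} = (UNIV :: 'v set)"
      by (intro generated) (auto simp: complex_vector.subspace_single_0 act_simps)
    then show False using nonzero by simp
  qed
  ultimately show ?thesis using all[OF assms] by simp
qed

text \<open>As \<open>\<qq> \<otimes> I\<close> is an ideal of \<open>\<qq> \<otimes> A\<close>, the vectors that it kills form a submodule, and this submodule
  contains the generating space \<open>T\<close>.\<close>

lemma ideal_annihilates_module: "ideal_annihilates I \<alpha>"
proof -
  let ?W = "{v. \<forall>z\<in>tensor_span UNIV I. \<alpha> z v = 0}"
  have "?W = UNIV"
  proof (rule generated)
    show "csubspace ?W"
      by (auto intro!: complex_vector.subspaceI simp: act_simps)
    show "T \<subseteq> ?W" using ideal_kills_top by blast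
    show "\<alpha> x v \<in> ?W" if v: "v \<in> ?W" for x v
    proof -
      have zero: "\<alpha> z (\<alpha> x v) = 0"
        if x: "x \<in> borel_generators UNIV \<union> fst ` lowering_operators UNIV"
          and z: "z \<in> borel_generators I \<union> fst ` lowering_operators I" for x z
      proof -
        obtain i j where ij: "z \<in> gr i" "x \<in> gr j"
          using triangular_homogeneous[OF x] triangular_homogeneous[OF z] by blast
        have "br x z \<in> tensor_span UNIV I" "z \<in> tensor_span UNIV I"
          using bracket_tensor_span_ideal[OF ideal(1)] triangular_in_tensor_span[OF z] by blast+
        then have "\<alpha> (br x z) v = 0" "\<alpha> z v = 0" using v by blast+
        then show ?thesis using commutator[OF ij(2,1), of v]
          by (cases "koszul_sign j i = 1") (auto simp: act_simps koszul_sign_def scaleC_one split: if_splits)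
      qed
      have "\<alpha> x v \<in> {u. \<alpha> z u = 0}"
        if z: "z \<in> borel_generators I \<union> fst ` lowering_operators I" for z
      proof (rule clinear_span_subset[OF linear_left csubspace_kernel[OF linear_right]])
        show "x \<in> cspan (borel_generators UNIV \<union> fst ` lowering_operators UNIV)"
          by (simp add: triangular_span_UNIV)
      qed (use zero z in blast)
      then have "\<alpha> z (\<alpha> x v) \<in> {0}" if "z \<in> tensor_span UNIV I" for z
        by (intro clinear_span_subset[OF linear_left complex_vector.subspace_single_0 _
              subsetD[OF tensor_span_triangular that]]) blast
      then show ?thesis by simp
    qed
  qed
  then show ?thesis unfolding ideal_annihilates_def by blast
qed

text \<open>Because \<open>\<qq> \<otimes> I\<close> acts by zero, the operators \<open>x \<otimes> f\<close> with \<open>f\<close> in a spanning set of \<open>A\<close> modulo \<open>I\<close>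
  suffice to produce all of the module from \<open>T\<close>.\<close>

lemma finitely_many_operators_suffice:
  assumes J: "cspan (J \<union> I) = UNIV" and B: "T \<subseteq> cspan B"
  shows "word_span (lowering_operators J) (B \<times> {0}) = UNIV"
proof -
  let ?S = "word_span (lowering_operators J) (B \<times> {0})"
  have "word_span (lowering_operators UNIV) (T \<times> {0}) \<subseteq> ?S"
  proof (rule word_span_minimal)
    show "csubspace ?S" by (rule csubspace_word_span)
    have "B \<subseteq> ?S" by (auto intro: word_in_span words.base)
    then have "T \<subseteq> ?S"
      using B complex_vector.span_minimal[OF _ csubspace_word_span] by blast
    then show "b \<in> ?S" if "(b, k) \<in> T \<times> {0}" for b and k :: nat using that by auto
    show "\<alpha> y v \<in> ?S" if y: "(y, r) \<in> lowering_operators UNIV" and v: "v \<in> ?S" for y r v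
    proof -
      obtain s i j f where y: "y = root_vector s i j \<otimes>\<^sub>t f" "j < i"
        using y unfolding lowering_operators_def by blast
      have lin: "clinear (\<lambda>f. \<alpha> (root_vector s i j \<otimes>\<^sub>t f) v)"
        by (intro clinearI) (simp_all add: tens_add_right tens_scale_right act_simps)
      show ?thesis unfolding y(1)
      proof (rule clinear_span_subset[OF lin csubspace_word_span])
        show "f \<in> cspan (J \<union> I)" by (simp add: J)
        fix g assume "g \<in> J \<union> I"
        then consider "g \<in> J" | "g \<in> I" by blast
        then show "\<alpha> (root_vector s i j \<otimes>\<^sub>t g) v \<in> ?S"
        proof cases
          case 1
          then have "(root_vector s i j \<otimes>\<^sub>t g, position i - position j) \<in> lowering_operators J"
            unfolding lowering_operators_def using y(2) by blast
          then show ?thesis using v by (rule word_span_step)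
        next
          case 2
          then have "root_vector s i j \<otimes>\<^sub>t g \<in> tensor_span UNIV I"
            unfolding tensor_span_def by (intro complex_vector.span_base) blast
          then have "\<alpha> (root_vector s i j \<otimes>\<^sub>t g) v = 0"
            using ideal_annihilates_module unfolding ideal_annihilates_def by blast
          then show ?thesis
            using complex_vector.subspace_0[OF csubspace_word_span] by simp
        qed
      qed
    qed
  qed
  then show ?thesis unfolding lowered_words_of_top_span by blast
qed

text \<open>A weight determines the eigenvalue of the height element, hence the height of the words that
  contribute, and there are finitely many words of each height.\<close>

lemma finite_dimensional_weight_space: "finite_dimensional (weight_space \<alpha> \<mu>)"
proof -
  obtain J where J: "finite J" "cspan (J \<union> I) = UNIV"
    using ideal(2) unfolding finite_codimensional_def by blast
  obtain B' where B': "finite B'" "T \<subseteq> cspan B'"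
    using top_finite unfolding finite_dimensional_def by blast
  \<comment> \<open>The set \<open>B'\<close> need not lie in \<open>T\<close>, but the words below have to start from weight vectors.\<close>
  obtain B where B: "B \<subseteq> T" "complex_vector.independent B" "T \<subseteq> cspan B"
    using complex_vector.maximal_independent_subset by blast
  then have "finite B"
    using complex_vector.independent_span_bound[OF B'(1) B(2)] B'(2) by blast
  let ?W = "\<lambda>k. {v. (v, k) \<in> words (lowering_operators J) (B \<times> {0})}"
  let ?k = "{k::nat. \<forall>h\<in>{height_element}. \<kappa> h - of_nat k = \<mu> h}"
  have "finite (?W k)" for k
    using J(1) \<open>finite B\<close> lowering_operator_height
    by (intro finite_words_of_height finite_lowering_operators) auto
  moreover have "?k \<subseteq> {k}" if "k \<in> ?k" for k
  proof
    fix l assume "l \<in> ?k"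
    then have "complex_of_nat l = of_nat k" using that by (simp add: algebra_simps)
    then show "l \<in> {k}" by simp
  qed
  then have "finite ?k" by (cases "?k = {}") (auto intro: finite_subset)
  ultimately have "finite (\<Union>k\<in>?k. ?W k)" by blast
  moreover have "v \<in> cspan (\<Union>k\<in>?k. ?W k)" if v: "v \<in> weight_space \<alpha> \<mu>" for v
  proof (rule eigenvector_in_span_of_same_eigenvalue[where T = "\<lambda>h. \<alpha> (h \<otimes>\<^sub>t 1)"])
    show "\<forall>h\<in>{height_element}. \<alpha> (h \<otimes>\<^sub>t 1) v = \<mu> h *\<^sub>C v"
      using v by (simp add: weight_space_def height_element_q_h0)
    have "fst ` words (lowering_operators J) (B \<times> {0}) = (\<Union>k. ?W k)" by force
    then show "v \<in> cspan (\<Union>k. ?W k)"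
      using finitely_many_operators_suffice[OF J(2) B(3)] by (simp add: word_span_def)
    show "\<forall>h\<in>{height_element}. \<alpha> (h \<otimes>\<^sub>t 1) w = (\<kappa> h - of_nat k) *\<^sub>C w" if "w \<in> ?W k" for w k
    proof -
      have "\<alpha> (height_element \<otimes>\<^sub>t 1) b = (\<kappa> height_element - of_nat k) *\<^sub>C b"
        if "(b, k) \<in> B \<times> {0}" for b and k :: nat
        using that B(1) top_weight[OF height_element_q_h0] by auto
      then show ?thesis using words_height_weight that by blast
    qed
  qed (rule linear_right)
  ultimately show ?thesis unfolding finite_dimensional_def by blast
qed

text \<open>A lowering operator carries the space of weight \<open>\<mu>\<close> to that of \<open>\<mu>\<close> plus a negative root, so the sum
  of the weight spaces contains every word that starts in \<open>T\<close>.\<close>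

lemma weight_module: "weight_module \<alpha>"
  unfolding weight_module_def internal_direct_sum_def
proof (intro conjI ballI)
  have sub: "csubspace (weight_space \<alpha> \<mu>)" for \<mu>
    unfolding weight_space_def by (rule csubspace_joint_eigenspace[OF linear_right])
  then show "csubspace (weight_space \<alpha> \<mu>)" for \<mu> .
  let ?S = "cspan (\<Union>\<mu>\<in>dual_space q_h0. weight_space \<alpha> \<mu>)"
  have "word_span (lowering_operators UNIV) (T \<times> {0}) \<subseteq> ?S"
  proof (rule word_span_minimal)
    have "T \<subseteq> weight_space \<alpha> \<kappa>" using top_weight by (auto simp: weight_space_def)
    then show "b \<in> ?S" if "(b, k) \<in> T \<times> {0}" for b and k :: nat
      using that weight_dual by (auto intro!: complex_vector.span_base)
    show "\<alpha> y v \<in> ?S" if y: "(y, r) \<in> lowering_operators UNIV" and v: "v \<in> ?S" for y r v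
      using linear_right complex_vector.subspace_span _ v
    proof (rule clinear_span_subset)
      fix u assume "u \<in> (\<Union>\<mu>\<in>dual_space q_h0. weight_space \<alpha> \<mu>)"
      then obtain \<mu> where mu: "\<mu> \<in> dual_space q_h0" "u \<in> weight_space \<alpha> \<mu>" by blast
      obtain s i j f where ij: "y = root_vector s i j \<otimes>\<^sub>t f" "j < i"
        using y unfolding lowering_operators_def by blast
      define \<nu> where "\<nu> = (\<lambda>h. if h \<in> q_h0 then \<mu> h + root i j h else 0)"
      have "\<nu> \<in> dual_space q_h0"
        using mu(1) unfolding dual_space_def \<nu>_def
        by (auto simp: root_linear distrib_left complex_vector.subspace_add[OF csubspace_q_h0]
            complex_vector.subspace_scale[OF csubspace_q_h0])
      moreover have "\<alpha> y u \<in> weight_space \<alpha> \<nu>"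
        unfolding weight_space_def
      proof (intro CollectI ballI)
        fix h :: "'n queer" assume h: "h \<in> q_h0"
        have "\<alpha> (h \<otimes>\<^sub>t 1) (\<alpha> y u) = (\<mu> h + root i j h) *\<^sub>C \<alpha> y u"
        proof (rule weight_shift)
          show "h \<otimes>\<^sub>t 1 \<in> gr 0" by (intro tens_in_gr cartan_homogeneous h)
          show "y \<in> gr 0 \<or> y \<in> gr 1" using y by (rule lowering_operator_homogeneous)
          show "br (h \<otimes>\<^sub>t 1) y = root i j h *\<^sub>C y"
            unfolding ij(1) using h ij(2) by (intro br_cartan_root_vector) auto
          show "\<alpha> (h \<otimes>\<^sub>t 1) u = \<mu> h *\<^sub>C u" using mu(2) h by (simp add: weight_space_def)
        qed
        then show "\<alpha> (h \<otimes>\<^sub>t 1) (\<alpha> y u) = \<nu> h *\<^sub>C \<alpha> y u" using h by (simp add: \<nu>_def)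
      qed
      ultimately show "\<alpha> y u \<in> ?S" by (blast intro: complex_vector.span_base)
    qed
  qed (rule complex_vector.subspace_span)
  then show "?S = UNIV" unfolding lowered_words_of_top_span by blast
  show "weight_space \<alpha> \<mu> \<inter> cspan (\<Union>\<nu>\<in>dual_space q_h0 - {\<mu>}. weight_space \<alpha> \<nu>) = {0}"
    if mu: "\<mu> \<in> dual_space q_h0" for \<mu>
  proof -
    have "v = 0" if "v \<in> weight_space \<alpha> \<mu>"
      "v \<in> cspan (\<Union>\<nu>\<in>dual_space q_h0 - {\<mu>}. weight_space \<alpha> \<nu>)" for v
    proof (rule joint_eigenspaces_independent[where T = "\<lambda>h. \<alpha> (h \<otimes>\<^sub>t 1)" and X = q_h0 and \<mu> = \<mu>
          and J = "dual_space q_h0 - {\<mu>}" and wt = "\<lambda>\<nu>. \<nu>"])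
      show "\<exists>h\<in>q_h0. \<nu> h \<noteq> \<mu> h" if "\<nu> \<in> dual_space q_h0 - {\<mu>}" for \<nu>
      proof (rule ccontr)
        assume "\<not> ?thesis"
        then have "\<nu> h = \<mu> h" for h
          using that mu \<open>\<not> (\<exists>h\<in>q_h0. \<nu> h \<noteq> \<mu> h)\<close>
          by (cases "h \<in> q_h0") (simp_all add: dual_space_def)
        then have "\<nu> = \<mu>" by (rule ext)
        then show False using that by simp
      qed
    qed (use that linear_right in \<open>auto simp: weight_space_def\<close>)
    moreover have "0 \<in> weight_space \<alpha> \<mu>" using sub by (rule complex_vector.subspace_0)
    ultimately show ?thesis using complex_vector.span_zero by blast
  qed
qed

lemma quasifinite: "quasifinite \<alpha>"
  unfolding quasifinite_def using weight_module finite_dimensional_weight_space by blast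

lemma finite_module_support: "finite (module_support \<alpha>)"
proof (rule finite_subset)
  have "I \<subseteq> annihilator \<alpha>"
    unfolding annihilator_def using ideal(1) ideal_annihilates_module
    by (intro order_trans[OF _ complex_vector.span_superset]) blast
  then show "module_support \<alpha> \<subseteq> ideal_support I"
    unfolding module_support_def ideal_support_def by blast
  show "finite (ideal_support I)" using ideal(2) by (rule finite_support_if_finite_codimensional)
qed

end


section \<open>The modules \<open>H(\<psi>)\<close>\<close>

text \<open>The spaces \<open>\<hh> \<otimes> A\<close> and \<open>\<nn>\<^sup>+ \<otimes> A\<close> meet only in zero, because taking diagonal parts separates
  them. So the decomposition chosen in the extension of the action from \<open>\<hh> \<otimes> A\<close> to \<open>\<bb> \<otimes> A\<close> is
  unique, which the next lemma exploits.\<close>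

lemma cartan_nplus_projection:
  obtains E :: "('n::{finite, linorder}, 'a::comm_complex_algebra_1) queer_map \<Rightarrow> ('n, 'a) queer_map"
  where "clinear E" "\<And>z. z \<in> tensor_span q_h UNIV \<Longrightarrow> E z = z"
    "\<And>z. z \<in> tensor_span q_nplus UNIV \<Longrightarrow> E z = 0"
proof -
  let ?E = "tensor_lift (\<lambda>(x :: 'n queer) (f :: 'a). queer_diagonal x \<otimes>\<^sub>t f)"
  have bil: "cbilinear (\<lambda>(x :: 'n queer) (f :: 'a). queer_diagonal x \<otimes>\<^sub>t f)"
    unfolding cbilinear_def
    by (intro conjI allI clinearI)
      (simp_all add: clinear_add[OF clinear_queer_diagonal] clinear_scale[OF clinear_queer_diagonal]
        tens_add_left tens_add_right tens_scale_left tens_scale_right)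
  note lin = clinear_tensor_lift[OF bil]
  have h: "queer_diagonal x = x" if "x \<in> q_h0 \<union> q_h1" for x :: "'n queer"
    using that by (auto simp: q_h0_def q_h1_def queer_diagonal_abs trace_zero diagonal_part_eqs)
  then have h: "queer_diagonal x = x" if "x \<in> q_h" for x :: "'n queer"
    using that by (auto simp: q_h_def clinear_add[OF clinear_queer_diagonal])
  have n: "queer_diagonal x = 0" if n: "x \<in> q_nplus" for x :: "'n queer"
  proof -
    obtain a b where x: "x = abs_queer (a, b)" "strictly_upper a" "strictly_upper b"
      using n unfolding q_nplus_def by blast
    then have "trace b = 0" by (simp add: trace_def strictly_upper_def)
    then show ?thesis using x by (simp add: queer_diagonal_abs diagonal_part_eqs zero_queer_eq)
  qed
  have "?E z = z" if "z \<in> tensor_span q_h UNIV" for z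
  proof (rule clinear_eq_on_span[OF lin _ _ that[unfolded tensor_span_def]])
    show "clinear (\<lambda>z :: ('n, 'a) queer_map. z)" by (intro clinearI) simp_all
  qed (auto simp: tensor_lift_tens[OF bil] h)
  moreover have "?E z \<in> {0}" if "z \<in> tensor_span q_nplus UNIV" for z
    using lin complex_vector.subspace_single_0 _ that[unfolded tensor_span_def]
    by (rule clinear_span_subset)
      (auto simp: tensor_lift_tens[OF bil] n clinear_zero[OF tens_linear(1)])
  ultimately show ?thesis using lin that by blast
qed

lemma extended_H_action_eq:
  "z \<in> tensor_span q_h UNIV \<Longrightarrow> extended_H_action \<alpha> z = \<alpha> z"
  "z \<in> tensor_span q_nplus UNIV \<Longrightarrow> extended_H_action \<alpha> z = \<alpha> 0"
proof -
  obtain E :: "('a, 'b) queer_map \<Rightarrow> ('a, 'b) queer_map" where E: "clinear E"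
    "\<And>z. z \<in> tensor_span q_h UNIV \<Longrightarrow> E z = z" "\<And>z. z \<in> tensor_span q_nplus UNIV \<Longrightarrow> E z = 0"
    using cartan_nplus_projection by blast
  have 0: "0 \<in> tensor_span q_h UNIV" "0 \<in> tensor_span q_nplus UNIV"
    unfolding tensor_span_def by (simp_all add: complex_vector.span_zero)
  have eq: "x = E z" if "x \<in> tensor_span q_h UNIV" "z - x \<in> tensor_span q_nplus UNIV" for x z
    using E(2)[OF that(1)] E(3)[OF that(2)] by (simp add: clinear_diff[OF E(1)])
  show "extended_H_action \<alpha> z = \<alpha> z" if z: "z \<in> tensor_span q_h UNIV"
  proof -
    have "(THE x. x \<in> tensor_span q_h UNIV \<and> z - x \<in> tensor_span q_nplus UNIV) = z"
      by (rule the_equality) (use z 0 eq[of _ z] E(2)[OF z] in auto)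
    then show ?thesis by (simp add: extended_H_action_def extend_by_zero_def fun_eq_iff)
  qed
  show "extended_H_action \<alpha> z = \<alpha> 0" if z: "z \<in> tensor_span q_nplus UNIV"
  proof -
    have "(THE x. x \<in> tensor_span q_h UNIV \<and> z - x \<in> tensor_span q_nplus UNIV) = 0"
      by (rule the_equality) (use z 0 eq[of _ z] E(3)[OF z] in auto)
    then show ?thesis by (simp add: extended_H_action_def extend_by_zero_def fun_eq_iff)
  qed
qed

lemma super_module_graded:
  assumes "super_module B \<Gamma> \<alpha>"
  shows "csubspace (\<Gamma> i)" "\<exists>v\<^sub>0\<in>\<Gamma> 0. \<exists>v\<^sub>1\<in>\<Gamma> 1. v = v\<^sub>0 + v\<^sub>1"
    "v \<in> \<Gamma> 0 \<Longrightarrow> v \<in> \<Gamma> 1 \<Longrightarrow> v = 0"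
proof -
  have ds: "internal_direct_sum UNIV \<Gamma>" using assms by (simp add: super_module_def)
  then show sub: "csubspace (\<Gamma> i)" for i by (simp add: internal_direct_sum_def)
  have "v \<in> cspan (\<Union>i. \<Gamma> i)" using ds by (simp add: internal_direct_sum_def)
  moreover have "b \<in> \<Gamma> 0 \<or> b \<in> \<Gamma> 1" if "b \<in> (\<Union>i. \<Gamma> i)" for b
    using that by (metis (full_types) UN_E bit.exhaust)
  ultimately show "\<exists>v\<^sub>0\<in>\<Gamma> 0. \<exists>v\<^sub>1\<in>\<Gamma> 1. v = v\<^sub>0 + v\<^sub>1"
    using span_homogeneous_graded[of \<Gamma>, OF sub] by blast
  assume v: "v \<in> \<Gamma> 0" "v \<in> \<Gamma> 1"
  have "v \<in> cspan (\<Union>i\<in>UNIV - {0}. \<Gamma> i)"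
    by (rule complex_vector.span_base, rule UN_I[of 1]) (use v in auto)
  then show "v = 0" using ds v(1) unfolding internal_direct_sum_def by blast
qed

text \<open>For odd \<open>x\<close> in \<open>\<hh> \<otimes> I\<close>, the brackets of \<open>x\<close> with \<open>\<hh> \<otimes> A\<close> lie in \<open>\<hh>\<^sub>0 \<otimes> I\<close> and act by zero. Hence the
  kernel of \<open>x\<close> is a submodule, and \<open>x\<^sup>2 = 0\<close> on \<open>H(\<psi>)\<close>, so the kernel is not zero; irreducibility makes
  it everything.\<close>

lemma H_module_cartan_ideal_zero:
  fixes \<Gamma> :: "bit \<Rightarrow> 'h::complex_vector set"
    and \<psi> :: "('n::{finite, linorder}, 'a::comm_complex_algebra_1) queer_map \<Rightarrow> complex"
  assumes H: "is_H_module \<psi> \<Gamma> \<alpha>" and I: "alg_ideal I"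
    and psi: "\<forall>z\<in>tensor_span q_h0 I. \<psi> z = 0"
    and x: "x \<in> q_h0 \<union> q_h1" and f: "f \<in> I"
  shows "\<alpha> (x \<otimes>\<^sub>t f) w = 0"
proof -
  let ?B = "tensor_span (q_h :: 'n queer set) (UNIV :: 'a set)"
  have irr: "irreducible_module ?B \<Gamma> \<alpha>"
    and scalar: "\<And>z v. z \<in> tensor_span q_h0 UNIV \<Longrightarrow> \<alpha> z v = \<psi> z *\<^sub>C v"
    using H unfolding is_H_module_def by blast+
  then have sm: "super_module ?B \<Gamma> \<alpha>" by (simp add: irreducible_module_def)
  then have lin: "\<And>z. z \<in> ?B \<Longrightarrow> clinear (\<alpha> z)"
    and add: "\<And>y z v. y \<in> ?B \<Longrightarrow> z \<in> ?B \<Longrightarrow> \<alpha> (y + z) v = \<alpha> y v + \<alpha> z v"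
    and scl: "\<And>c z v. z \<in> ?B \<Longrightarrow> \<alpha> (c *\<^sub>C z) v = c *\<^sub>C \<alpha> z v"
    and grd: "\<And>i j z v. z \<in> ?B \<Longrightarrow> z \<in> gr i \<Longrightarrow> v \<in> \<Gamma> j \<Longrightarrow> \<alpha> z v \<in> \<Gamma> (i + j)"
    and brk: "\<And>i j y z v. y \<in> ?B \<Longrightarrow> y \<in> gr i \<Longrightarrow> z \<in> ?B \<Longrightarrow> z \<in> gr j \<Longrightarrow>
      \<alpha> (br y z) v = \<alpha> y (\<alpha> z v) - koszul_sign i j *\<^sub>C \<alpha> z (\<alpha> y v)"
    unfolding super_module_def by blast+
  have mem: "y \<otimes>\<^sub>t g \<in> tensor_span S J" if "y \<in> S" "g \<in> J" for y :: "'n queer" and g :: 'a and S J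
    unfolding tensor_span_def using that by (intro complex_vector.span_base) blast
  show ?thesis
  proof (cases "x \<in> q_h0")
    case True
    then have "\<psi> (x \<otimes>\<^sub>t f) = 0" using psi mem[OF True f] by blast
    then show ?thesis using scalar[OF mem[OF True UNIV_I]] by simp
  next
    case False
    then have x1: "x \<in> q_h1" using x by blast
    let ?x = "x \<otimes>\<^sub>t f"
    let ?K = "{v. \<alpha> ?x v = 0}"
    have xB: "?x \<in> ?B" using x1 cartan_subset_q_h(2) by (intro mem) auto
    have xg: "?x \<in> gr 1" using x1 by (intro tens_in_gr cartan_homogeneous)
    have anti: "\<alpha> ?x (\<alpha> (y \<otimes>\<^sub>t g) v) = - \<alpha> (y \<otimes>\<^sub>t g) (\<alpha> ?x v)" if y: "y \<in> q_h1" for y g v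
    proof -
      have yB: "y \<otimes>\<^sub>t g \<in> ?B" using y cartan_subset_q_h(2) by (intro mem) auto
      have yg: "y \<otimes>\<^sub>t g \<in> gr 1" using y by (intro tens_in_gr cartan_homogeneous)
      have "f * g \<in> I" using ideal_mult_mem[OF I f, of g] by (simp add: mult.commute)
      then have "br ?x (y \<otimes>\<^sub>t g) \<in> tensor_span q_h0 I" "br ?x (y \<otimes>\<^sub>t g) \<in> tensor_span q_h0 UNIV"
        unfolding br_tens using q_h1_bracket[OF x1 y] by (intro mem; simp)+
      then have "\<alpha> (br ?x (y \<otimes>\<^sub>t g)) v = 0" using scalar psi by simp
      then show ?thesis
        using brk[OF xB xg yB yg, of v] by (simp add: koszul_sign_def scaleC_one eq_neg_iff_add_eq_0)
    qed
    have sub: "csubspace ?K" by (rule csubspace_kernel[OF lin[OF xB]])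
    have "submodule ?B \<Gamma> \<alpha> ?K"
      unfolding submodule_def
    proof (intro conjI ballI)
      show "csubspace ?K" by (rule sub)
    next
      fix v assume v: "v \<in> ?K"
      obtain v\<^sub>0 v\<^sub>1 where d: "v = v\<^sub>0 + v\<^sub>1" "v\<^sub>0 \<in> \<Gamma> 0" "v\<^sub>1 \<in> \<Gamma> 1"
        using super_module_graded(2)[OF sm] by blast
      have e: "\<alpha> ?x v\<^sub>0 + \<alpha> ?x v\<^sub>1 = 0" using v d(1) by (simp add: clinear_add[OF lin[OF xB]])
      have "\<alpha> ?x v\<^sub>0 \<in> \<Gamma> 1" "\<alpha> ?x v\<^sub>1 \<in> \<Gamma> 0"
        using grd[OF xB xg d(2)] grd[OF xB xg d(3)] by simp_all
      moreover from this have "\<alpha> ?x v\<^sub>0 \<in> \<Gamma> 0"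
        using e complex_vector.subspace_neg[OF super_module_graded(1)[OF sm], of "\<alpha> ?x v\<^sub>1" 0]
        by (simp add: eq_neg_iff_add_eq_0[symmetric])
      ultimately have "\<alpha> ?x v\<^sub>0 = 0" using super_module_graded(3)[OF sm] by blast
      then show "\<exists>v\<^sub>0\<in>?K \<inter> \<Gamma> 0. \<exists>v\<^sub>1\<in>?K \<inter> \<Gamma> 1. v = v\<^sub>0 + v\<^sub>1"
        using e d by auto
    next
      fix z v assume z: "z \<in> ?B" and v: "v \<in> ?K"
      have gen: "\<alpha> (y \<otimes>\<^sub>t g) v \<in> ?K" if "y \<in> q_h0 \<union> q_h1" for y g
      proof (cases "y \<in> q_h0")
        case True
        then show ?thesis
          using v scalar[OF mem[OF True UNIV_I]] by (simp add: clinear_scale[OF lin[OF xB]])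
      next
        case False
        have "y \<otimes>\<^sub>t g \<in> ?B" using that cartan_subset_q_h by (intro mem) auto
        then show ?thesis using anti[of y g v] False that v clinear_zero[OF lin] by auto
      qed
      have "z \<in> ?B \<and> \<alpha> z v \<in> ?K"
        using z unfolding tensor_span_def
      proof (induct rule: complex_vector.span_induct_alt)
        case base
        have "0 \<in> ?B" unfolding tensor_span_def by (rule complex_vector.span_zero)
        moreover from this have "\<alpha> 0 v = 0" using scl[of 0 0 v] by simp
        ultimately show ?case
          unfolding tensor_span_def using complex_vector.subspace_0[OF sub] by simp
      next
        case (step c b z)
        then obtain y g where b: "b = y \<otimes>\<^sub>t g" "y \<in> q_h" by blast
        then obtain y\<^sub>0 y\<^sub>1 where y: "y = y\<^sub>0 + y\<^sub>1" "y\<^sub>0 \<in> q_h0" "y\<^sub>1 \<in> q_h1"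
          unfolding q_h_def by blast
        have "b \<in> ?B" "y\<^sub>0 \<otimes>\<^sub>t g \<in> ?B" "y\<^sub>1 \<otimes>\<^sub>t g \<in> ?B"
          using b y(2,3) cartan_subset_q_h by (auto intro: mem)
        moreover have "z \<in> ?B" using step(2) by (simp add: tensor_span_def)
        moreover from \<open>b \<in> ?B\<close> have "c *\<^sub>C b \<in> ?B"
          unfolding tensor_span_def by (rule complex_vector.span_scale)
        ultimately have B: "b \<in> ?B" "y\<^sub>0 \<otimes>\<^sub>t g \<in> ?B" "y\<^sub>1 \<otimes>\<^sub>t g \<in> ?B" "c *\<^sub>C b \<in> ?B" "z \<in> ?B"
          by blast+
        have "\<alpha> b v = \<alpha> (y\<^sub>0 \<otimes>\<^sub>t g) v + \<alpha> (y\<^sub>1 \<otimes>\<^sub>t g) v"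
          unfolding b(1) y(1) tens_add_left using B(2,3) by (rule add)
        then have "\<alpha> b v \<in> ?K"
          using gen[of y\<^sub>0 g] gen[of y\<^sub>1 g] y(2,3) complex_vector.subspace_add[OF sub] by simp
        then have "\<alpha> (c *\<^sub>C b + z) v \<in> ?K"
          unfolding add[OF B(4,5)] scl[OF B(1)] using step
          by (intro complex_vector.subspace_add[OF sub] complex_vector.subspace_scale[OF sub]) auto
        moreover have "c *\<^sub>C b + z \<in> ?B"
          using B(4,5) unfolding tensor_span_def by (rule complex_vector.span_add)
        ultimately show ?case unfolding tensor_span_def by blast
      qed
      then show "\<alpha> z v \<in> ?K" ..
    qed
    then have "?K = {0} \<or> ?K = UNIV" using irr unfolding irreducible_module_def by blast
    moreover have "?K \<noteq> {0}"
    proof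
      assume K: "?K = {0}"
      have "\<alpha> ?x (\<alpha> ?x v) = 0" for v
      proof -
        have "\<alpha> ?x (\<alpha> ?x v) = - \<alpha> ?x (\<alpha> ?x v)" using anti[OF x1] .
        then have "2 *\<^sub>C \<alpha> ?x (\<alpha> ?x v) = 0"
          using scaleC_add_left[of 1 1 "\<alpha> ?x (\<alpha> ?x v)"] by (simp add: scaleC_one eq_neg_iff_add_eq_0)
        then show ?thesis by simp
      qed
      then have "\<alpha> ?x v \<in> ?K" for v by simp
      then have "\<alpha> ?x v = 0" for v by (simp only: K singleton_iff)
      then have "v \<in> ?K" for v by (rule CollectI)
      then have "(UNIV :: 'h set) = {0}" unfolding K by blast
      then show False using irr unfolding irreducible_module_def by blast
    qed
    ultimately have "?K = UNIV" by simp
    then have "w \<in> ?K" by (simp only: UNIV_I)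
    then show ?thesis by simp
  qed
qed


section \<open>Enveloping algebras and induced modules\<close>

lemma env_incl_linear:
  "env_incl (x + y) = env_incl x + env_incl y" "env_incl (c *\<^sub>C x) = c *\<^sub>C env_incl x"
proof -
  have "letter (x + y) - letter x - letter y \<in> env_ideal" "letter (c *\<^sub>C x) - c *\<^sub>C letter x \<in> env_ideal"
    unfolding env_ideal_def by (rule hull_inc; blast)+
  then show "env_incl (x + y) = env_incl x + env_incl y" "env_incl (c *\<^sub>C x) = c *\<^sub>C env_incl x"
    by (simp_all add: env_incl.abs_eq plus_env.abs_eq scaleC_env.abs_eq env.abs_eq_iff diff_diff_eq)
qed

lemma env_incl_commutator:
  assumes "x \<in> gr i" "y \<in> gr j"
  shows "env_incl x * env_incl y = koszul_sign i j *\<^sub>C (env_incl y * env_incl x) + env_incl (br x y)"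
proof -
  have "letter x * letter y - koszul_sign i j *\<^sub>C (letter y * letter x) - letter (br x y) \<in> env_ideal"
    unfolding env_ideal_def using assms by (intro hull_inc) blast
  then show ?thesis
    by (simp add: env_incl.abs_eq plus_env.abs_eq times_env.abs_eq scaleC_env.abs_eq env.abs_eq_iff
        diff_diff_eq)
qed

lemma env_spanned_by_words: "u \<in> cspan {prod_list (map env_incl xs) | xs. True}"
proof -
  let ?S = "cspan {prod_list (map env_incl xs) | xs. True}"
  have cons: "basis_elt (Free_Monoid (x # xs)) = letter x * basis_elt (Free_Monoid xs)" for x :: 'a and xs
    by (simp add: letter_def Poly_Mapping.mult_single plus_free_monoid_def)
  have one: "basis_elt (Free_Monoid []) = (1 :: 'a free_algebra)"
    by (simp add: zero_free_monoid_def[symmetric])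
  have word: "abs_env (basis_elt (Free_Monoid xs)) = prod_list (map env_incl xs)" for xs :: "'a list"
    by (induct xs) (simp_all add: one cons one_env.abs_eq times_env.abs_eq[symmetric] env_incl.abs_eq)
  have "abs_env p \<in> ?S" for p :: "'a free_algebra"
  proof (induct p rule: update_induct)
    case const
    show ?case by (simp add: zero_env.abs_eq[symmetric] complex_vector.span_zero)
  next
    case (update p k v)
    have "Poly_Mapping.update k v p = p + v *\<^sub>C basis_elt k"
      using update(1)
      by (intro poly_mapping_eqI)
        (auto simp: lookup_update lookup_add lookup_scaleC lookup_single scaleC_complex_def
          when_def in_keys_iff)
    then have "abs_env (Poly_Mapping.update k v p)
        = abs_env p + v *\<^sub>C prod_list (map env_incl (letters k))"
      by (simp add: scaleC_env.abs_eq plus_env.abs_eq word[symmetric])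
    moreover have "v *\<^sub>C prod_list (map env_incl (letters k)) \<in> ?S"
      by (intro complex_vector.span_scale complex_vector.span_base) blast
    ultimately show ?case using update(3) by (simp add: complex_vector.span_add)
  qed
  then show ?thesis by (induct u) blast
qed

lemma env_mult_scale:
  fixes a b :: "'g::lie_superalgebra env"
  shows "a * (c *\<^sub>C b) = c *\<^sub>C (a * b)" "(c *\<^sub>C a) * b = c *\<^sub>C (a * b)"
proof -
  \<comment> \<open>A scalar is a multiple of the empty word, the unit of the free algebra, and so it is central.\<close>
  have single: "p * Poly_Mapping.single 0 c = c *\<^sub>C p \<and> Poly_Mapping.single 0 c * p = c *\<^sub>C p"
    for p :: "'g free_algebra"
  proof (induct p rule: update_induct)
    case (update p k v)
    have "Poly_Mapping.update k v p = p + Poly_Mapping.single k v"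
      using update(1)
      by (intro poly_mapping_eqI)
        (auto simp: lookup_update lookup_add lookup_single when_def in_keys_iff)
    moreover have "c *\<^sub>C Poly_Mapping.single k v = Poly_Mapping.single k (c * v)"
      by (intro poly_mapping_eqI)
        (auto simp: lookup_scaleC lookup_single scaleC_complex_def when_def)
    ultimately show ?case
      using update(3) by (simp add: scaleC_add_right distrib_right distrib_left mult_single mult.commute)
  qed simp
  have "p * (c *\<^sub>C q) = c *\<^sub>C (p * q)" for p q :: "'g free_algebra"
    using single[of q] single[of "p * q"] by (metis mult.assoc)
  then show "a * (c *\<^sub>C b) = c *\<^sub>C (a * b)"
    by (induct a, induct b) (simp add: times_env.abs_eq scaleC_env.abs_eq)
  have "(c *\<^sub>C p) * q = c *\<^sub>C (p * q)" for p q :: "'g free_algebra"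
    using single[of p] single[of "p * q"] by (metis mult.assoc)
  then show "(c *\<^sub>C a) * b = c *\<^sub>C (a * b)"
    by (induct a, induct b) (simp add: times_env.abs_eq scaleC_env.abs_eq)
qed

lemma one_in_env_gr: "1 \<in> env_gr 0"
  unfolding env_gr_def
  by (intro complex_vector.span_base CollectI exI[of _ "[]"]) simp

lemma env_incl_mult_gr:
  fixes x :: "'g::lie_superalgebra"
  assumes "x \<in> gr i" "u \<in> env_gr j"
  shows "env_incl x * u \<in> env_gr (i + j)"
  using assms(2) unfolding env_gr_def[of j]
proof (rule clinear_span_subset[rotated 3])
  show "clinear ((*) (env_incl x))"
    by (intro clinearI) (simp_all add: distrib_left env_mult_scale)
  show "csubspace (env_gr (i + j))" unfolding env_gr_def by (rule complex_vector.subspace_span)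
  fix b :: "'g env"
  assume "b \<in> {prod_list (map env_incl xs) | xs ps. list_all2 (\<lambda>x i. x \<in> gr i) xs ps \<and> sum_list ps = j}"
  then obtain xs ps where b: "b = prod_list (map env_incl xs)" "list_all2 (\<lambda>x i. x \<in> gr i) xs ps"
    "sum_list ps = j" by blast
  then have "env_incl x * b = prod_list (map env_incl (x # xs))"
    "list_all2 (\<lambda>x i. x \<in> gr i) (x # xs) (i # ps)" "sum_list (i # ps) = i + j"
    using assms(1) by simp_all
  then show "env_incl x * b \<in> env_gr (i + j)"
    unfolding env_gr_def by (intro complex_vector.span_base) blast
qed

lemma quotient_by_maximal_irreducible:
  assumes graded: "\<And>i. csubspace (\<Gamma> i)"
    and N: "maximal_submodule UNIV \<Gamma> \<alpha> N"
    and Q: "is_quotient_module \<Gamma> \<alpha> N \<Gamma>' \<alpha>' \<pi>"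
    and S: "submodule UNIV \<Gamma>' \<alpha>' S"
  shows "S = {0} \<or> S = UNIV"
proof -
  have lin: "clinear \<pi>" and surj: "surj \<pi>" and ker: "\<And>v. \<pi> v = 0 \<longleftrightarrow> v \<in> N"
    and act: "\<And>x v. \<alpha>' x (\<pi> v) = \<pi> (\<alpha> x v)" and gr: "\<And>k. \<Gamma>' k = \<pi> ` \<Gamma> k"
    using Q unfolding is_quotient_module_def by blast+
  have N': "submodule UNIV \<Gamma> \<alpha> N" using N by (simp add: maximal_submodule_def)
  have sub: "csubspace S" using S by (simp add: submodule_def)
  let ?P = "{v. \<pi> v \<in> S}"
  have "submodule UNIV \<Gamma> \<alpha> ?P"
    unfolding submodule_def
  proof (intro conjI ballI)
    show "csubspace ?P"
      by (auto intro!: complex_vector.subspaceI simp: clinear_zero[OF lin] clinear_add[OF lin]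
          clinear_scale[OF lin] complex_vector.subspace_0[OF sub] complex_vector.subspace_add[OF sub]
          complex_vector.subspace_scale[OF sub])
  next
    fix v assume "v \<in> ?P"
    then obtain s\<^sub>0 s\<^sub>1 where s: "s\<^sub>0 \<in> S \<inter> \<Gamma>' 0" "s\<^sub>1 \<in> S \<inter> \<Gamma>' 1" "\<pi> v = s\<^sub>0 + s\<^sub>1"
      using S unfolding submodule_def by blast
    then obtain m\<^sub>0 m\<^sub>1 where m: "m\<^sub>0 \<in> \<Gamma> 0" "s\<^sub>0 = \<pi> m\<^sub>0" "m\<^sub>1 \<in> \<Gamma> 1" "s\<^sub>1 = \<pi> m\<^sub>1"
      unfolding gr by blast
    have "v - (m\<^sub>0 + m\<^sub>1) \<in> N"
      unfolding ker[symmetric] using s(3) m by (simp add: clinear_diff[OF lin] clinear_add[OF lin])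
    then obtain n\<^sub>0 n\<^sub>1 where n: "n\<^sub>0 \<in> N \<inter> \<Gamma> 0" "n\<^sub>1 \<in> N \<inter> \<Gamma> 1" "v - (m\<^sub>0 + m\<^sub>1) = n\<^sub>0 + n\<^sub>1"
      using N' unfolding submodule_def by blast
    have "\<pi> (m\<^sub>0 + n\<^sub>0) = s\<^sub>0" "\<pi> (m\<^sub>1 + n\<^sub>1) = s\<^sub>1"
      using m n ker by (simp_all add: clinear_add[OF lin])
    moreover have "v = (m\<^sub>0 + n\<^sub>0) + (m\<^sub>1 + n\<^sub>1)" using n(3) by (simp add: algebra_simps)
    ultimately show "\<exists>v\<^sub>0\<in>?P \<inter> \<Gamma> 0. \<exists>v\<^sub>1\<in>?P \<inter> \<Gamma> 1. v = v\<^sub>0 + v\<^sub>1"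
      using s m n complex_vector.subspace_add[OF graded]
      by (intro bexI[of _ "m\<^sub>0 + n\<^sub>0"] bexI[of _ "m\<^sub>1 + n\<^sub>1"]) auto
  next
    fix x v assume "v \<in> ?P"
    then show "\<alpha> x v \<in> ?P" using S by (simp add: submodule_def act[symmetric])
  qed
  moreover have "N \<subseteq> ?P"
    using complex_vector.subspace_0[OF sub] by (simp add: subset_iff ker[symmetric])
  ultimately have "?P = N \<or> ?P = UNIV" using N unfolding maximal_submodule_def by blast
  moreover have "S = \<pi> ` ?P" using surj_image_vimage_eq[OF surj, of S] by (simp add: vimage_def)
  moreover have "\<pi> ` N = {0}"
    using ker complex_vector.subspace_0[of N] N' clinear_zero[OF lin] by (force simp: submodule_def)
  ultimately show ?thesis using surj by auto
qed


section \<open>The module \<open>V(\<psi>)\<close>\<close>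

lemma borel_components: "q_h \<subseteq> (q_b :: 'n::{finite, linorder} queer set)" "q_nplus \<subseteq> (q_b :: 'n::{finite, linorder} queer set)"
proof -
  have "strictly_upper 0" by (simp add: strictly_upper_def)
  then have "(0 :: 'n queer) \<in> q_nplus" unfolding q_nplus_def zero_queer_eq by blast
  moreover have "(0 :: 'n queer) \<in> q_h"
    using complex_vector.subspace_0[OF csubspace_q_h0] cartan_subset_q_h(1) by blast
  ultimately have "x \<in> q_h \<Longrightarrow> x + 0 \<in> q_b" "x \<in> q_nplus \<Longrightarrow> 0 + x \<in> q_b" for x :: "'n queer"
    unfolding q_b_def by blast+
  then show "q_h \<subseteq> (q_b :: 'n queer set)" "q_nplus \<subseteq> (q_b :: 'n queer set)" by auto
qed

lemma L_functional_weight: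
  assumes "\<psi> \<in> L_functionals"
  shows "(\<lambda>h. if h \<in> q_h0 then \<psi> (h \<otimes>\<^sub>t 1) else 0) \<in> dual_space q_h0"
proof -
  have add: "\<And>x y. x \<in> tensor_span q_h0 UNIV \<Longrightarrow> y \<in> tensor_span q_h0 UNIV \<Longrightarrow> \<psi> (x + y) = \<psi> x + \<psi> y"
    and scale: "\<And>c x. x \<in> tensor_span q_h0 UNIV \<Longrightarrow> \<psi> (c *\<^sub>C x) = c * \<psi> x"
    using assms unfolding L_functionals_def dual_space_def by blast+
  have mem: "h \<otimes>\<^sub>t 1 \<in> tensor_span q_h0 UNIV" if "h \<in> q_h0" for h
    unfolding tensor_span_def using that by (intro complex_vector.span_base) blast
  show ?thesis
    unfolding dual_space_def
    by (auto simp: tens_add_left tens_scale_left add scale mem complex_vector.subspace_add[OF csubspace_q_h0]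
        complex_vector.subspace_scale[OF csubspace_q_h0])
qed

text \<open>The balancing relations turn the action of \<open>\<bb> \<otimes> A\<close> on \<open>1 \<otimes> w\<close> into its action on \<open>w\<close>, so \<open>1 \<otimes> H(\<psi>)\<close>
  behaves like \<open>H(\<psi>)\<close>; it generates because words in \<open>\<qq> \<otimes> A\<close> span the enveloping algebra.\<close>

lemma V_irreducible_highest_weight:
  fixes \<psi> :: "('n::{finite, linorder}, 'a::comm_complex_algebra_1) queer_map \<Rightarrow> complex"
    and \<Gamma>H :: "bit \<Rightarrow> 'h::complex_vector set" and \<alpha>H :: "('n, 'a) queer_map \<Rightarrow> 'h \<Rightarrow> 'h"
    and \<Gamma>M :: "bit \<Rightarrow> 'm::complex_vector set" and \<alpha>M :: "('n, 'a) queer_map \<Rightarrow> 'm \<Rightarrow> 'm"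
    and \<Gamma>V :: "bit \<Rightarrow> 'v::complex_vector set" and \<alpha>V :: "('n, 'a) queer_map \<Rightarrow> 'v \<Rightarrow> 'v"
    and p :: "(('n, 'a) queer_map env, 'h) tensor \<Rightarrow> 'm" and N :: "'m set" and \<pi> :: "'m \<Rightarrow> 'v"
  assumes psi: "\<psi> \<in> L_functionals"
    and H: "is_H_module \<psi> \<Gamma>H \<alpha>H"
    and Vbar: "is_induced_module (tensor_span q_b UNIV) \<Gamma>H (extended_H_action \<alpha>H) \<Gamma>M \<alpha>M p"
    and N: "maximal_submodule UNIV \<Gamma>M \<alpha>M N"
    and V: "is_quotient_module \<Gamma>M \<alpha>M N \<Gamma>V \<alpha>V \<pi>"
    and I: "alg_ideal I" "finite_codimensional I" "\<forall>z\<in>tensor_span q_h0 I. \<psi> z = 0"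
  shows "irreducible_highest_weight \<alpha>V \<Gamma>V (range (\<lambda>w. \<pi> (p (1 \<otimes>\<^sub>t w))))
    (\<lambda>h. if h \<in> q_h0 then \<psi> (h \<otimes>\<^sub>t 1) else 0) I"
proof -
  define q where "q t = \<pi> (p t)" for t
  define top where "top w = q (1 \<otimes>\<^sub>t w)" for w
  have p: "clinear p" "surj p"
    and bal: "{t. p t = 0} = cspan {(u * env_incl y) \<otimes>\<^sub>t w - u \<otimes>\<^sub>t extended_H_action \<alpha>H y w | u y w.
      y \<in> tensor_span q_b UNIV}"
    and actM: "\<And>x. clinear (\<alpha>M x)" "\<And>x u w. \<alpha>M x (p (u \<otimes>\<^sub>t w)) = p ((env_incl x * u) \<otimes>\<^sub>t w)"
    and grM: "\<And>k. \<Gamma>M k = p ` cspan {u \<otimes>\<^sub>t w | u w i j. u \<in> env_gr i \<and> w \<in> \<Gamma>H j \<and> i + j = k}"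
    using Vbar unfolding is_induced_module_def by blast+
  have pi: "clinear \<pi>" "surj \<pi>" "\<And>m. \<pi> m = 0 \<longleftrightarrow> m \<in> N"
    and actV: "\<And>x m. \<alpha>V x (\<pi> m) = \<pi> (\<alpha>M x m)" and grV: "\<And>k. \<Gamma>V k = \<pi> ` \<Gamma>M k"
    using V unfolding is_quotient_module_def by blast+
  have sm: "super_module (tensor_span q_h UNIV) \<Gamma>H \<alpha>H"
    and scalar: "\<And>z w. z \<in> tensor_span q_h0 UNIV \<Longrightarrow> \<alpha>H z w = \<psi> z *\<^sub>C w"
    and finH: "finite_dimensional (UNIV :: 'h set)"
    using H unfolding is_H_module_def irreducible_module_def by blast+
  have mem: "x \<otimes>\<^sub>t f \<in> tensor_span S UNIV" if "x \<in> S" for x :: "'n queer" and f :: 'a and S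
    unfolding tensor_span_def using that by (intro complex_vector.span_base) blast

  have lin: "clinear q"
    unfolding q_def by (intro clinearI) (simp_all add: clinear_add[OF p(1)] clinear_scale[OF p(1)]
        clinear_add[OF pi(1)] clinear_scale[OF pi(1)])
  have surj: "\<exists>t. v = q t" for v
    unfolding q_def using p(2) pi(2) by (metis surjD)
  have act: "\<alpha>V x (q (u \<otimes>\<^sub>t w)) = q ((env_incl x * u) \<otimes>\<^sub>t w)" for x u w
    by (simp add: q_def actV actM(2))
  have linV: "clinear (\<alpha>V x)" for x
  proof (rule clinearI)
    fix v v' c
    obtain m m' where "v = \<pi> m" "v' = \<pi> m'" using pi(2) by (metis surjD)
    then show "\<alpha>V x (v + v') = \<alpha>V x v + \<alpha>V x v'" "\<alpha>V x (c *\<^sub>C v) = c *\<^sub>C \<alpha>V x v"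
      by (simp_all add: clinear_add[OF pi(1), symmetric] clinear_scale[OF pi(1), symmetric] actV
          clinear_add[OF actM(1)] clinear_scale[OF actM(1)])
  qed
  have rep: "representation \<alpha>V"
  proof (rule representation.intro)
    show "clinear (\<alpha>V x)" for x by (rule linV)
    have "\<alpha>V (x + y) (q t) = \<alpha>V x (q t) + \<alpha>V y (q t)" "\<alpha>V (c *\<^sub>C x) (q t) = c *\<^sub>C \<alpha>V x (q t)"
      for x y c t
      by (induct t rule: tensor_induct;
          simp add: act env_incl_linear distrib_right tens_add_left clinear_add[OF lin]
            clinear_add[OF linV] env_mult_scale tens_scale_left clinear_scale[OF lin] scaleC_add_right)+
    then show "clinear (\<lambda>x. \<alpha>V x v)" for v
      by (intro clinearI) (use surj[of v] in auto)
    show "\<alpha>V x (\<alpha>V y v) = koszul_sign i j *\<^sub>C \<alpha>V y (\<alpha>V x v) + \<alpha>V (br x y) v"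
      if "x \<in> gr i" "y \<in> gr j" for x y i j v
    proof -
      obtain t where v: "v = q t" using surj by blast
      show ?thesis unfolding v
      proof (induct t rule: tensor_induct)
        case (tens u w)
        show ?case
          by (simp add: act mult.assoc[symmetric] env_incl_commutator[OF that] distrib_right
              tens_add_left env_mult_scale tens_scale_left clinear_add[OF lin] clinear_scale[OF lin])
      qed (simp add: clinear_add[OF lin] clinear_add[OF linV] scaleC_add_right)
    qed
  qed

  have top_act: "\<alpha>V y (top w) = top (extended_H_action \<alpha>H y w)" if "y \<in> tensor_span q_b UNIV" for y w
  proof -
    have "(1 * env_incl y) \<otimes>\<^sub>t w - 1 \<otimes>\<^sub>t extended_H_action \<alpha>H y w \<in> {t. p t = 0}"
      unfolding bal using that by (intro complex_vector.span_base) blast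
    then have "p (env_incl y \<otimes>\<^sub>t w) = p (1 \<otimes>\<^sub>t extended_H_action \<alpha>H y w)"
      by (simp add: clinear_diff[OF p(1)])
    then show ?thesis unfolding top_def act by (simp add: q_def)
  qed
  have top_h: "\<alpha>V (x \<otimes>\<^sub>t f) (top w) = top (\<alpha>H (x \<otimes>\<^sub>t f) w)" if "x \<in> q_h0 \<union> q_h1" for x f w
  proof -
    have x: "x \<in> q_h" using that cartan_subset_q_h by blast
    then show ?thesis
      using top_act[OF mem[OF subsetD[OF borel_components(1) x]], of f w]
      by (simp add: extended_H_action_eq(1)[OF mem[OF x]])
  qed
  have lin_top: "clinear top"
    unfolding top_def
    by (intro clinearI) (simp_all add: tens_add_right tens_scale_right clinear_add[OF lin] clinear_scale[OF lin])

  have grV': "\<Gamma>V k = cspan {q (u \<otimes>\<^sub>t w) | u w i j. u \<in> env_gr i \<and> w \<in> \<Gamma>H j \<and> i + j = k}" for k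
  proof -
    have "\<Gamma>V k = q ` cspan {u \<otimes>\<^sub>t w | u w i j. u \<in> env_gr i \<and> w \<in> \<Gamma>H j \<and> i + j = k}"
      unfolding grV grM image_image q_def ..
    also have "\<dots> = cspan (q ` {u \<otimes>\<^sub>t w | u w i j. u \<in> env_gr i \<and> w \<in> \<Gamma>H j \<and> i + j = k})"
      by (rule clinear_image_span[OF lin])
    also have "q ` {u \<otimes>\<^sub>t w | u w i j. u \<in> env_gr i \<and> w \<in> \<Gamma>H j \<and> i + j = k}
        = {q (u \<otimes>\<^sub>t w) | u w i j. u \<in> env_gr i \<and> w \<in> \<Gamma>H j \<and> i + j = k}" by blast
    finally show ?thesis .
  qed
  have subV: "csubspace (\<Gamma>V k)" for k unfolding grV' by (rule complex_vector.subspace_span)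
  have subM: "csubspace (\<Gamma>M k)" for k
    unfolding grM clinear_image_span[OF p(1)] by (rule complex_vector.subspace_span)

  show ?thesis
    unfolding q_def[symmetric] top_def[symmetric]
  proof (rule irreducible_highest_weight.intro[OF rep irreducible_highest_weight_axioms.intro])
    show "csubspace (\<Gamma>V i)" for i by (rule subV)
    show "\<alpha>V z v \<in> \<Gamma>V (i + j)" if z: "z \<in> gr i" and v: "v \<in> \<Gamma>V j" for z v i j
      using v unfolding grV'[of j]
    proof (rule clinear_span_subset[OF linV subV, rotated])
      fix b assume "b \<in> {q (u \<otimes>\<^sub>t w) | u w i k. u \<in> env_gr i \<and> w \<in> \<Gamma>H k \<and> i + k = j}"
      then obtain u w k l where b: "b = q (u \<otimes>\<^sub>t w)" "u \<in> env_gr k" "w \<in> \<Gamma>H l" "k + l = j" by blast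
      have "env_incl z * u \<in> env_gr (i + k)" using z b(2) by (rule env_incl_mult_gr)
      moreover have "(i + k) + l = i + j" by (simp only: add.assoc b(4))
      ultimately show "\<alpha>V z b \<in> \<Gamma>V (i + j)"
        unfolding b(1) act grV' using b(3) by (intro complex_vector.span_base) blast
    qed
    show "S = {0} \<or> S = UNIV" if "submodule UNIV \<Gamma>V \<alpha>V S" for S
      using subM N V that by (rule quotient_by_maximal_irreducible)
    show "(UNIV :: 'v set) \<noteq> {0}"
    proof
      assume "(UNIV :: 'v set) = {0}"
      then have "m \<in> N" for m using pi(3)[of m] by blast
      then show False using N unfolding maximal_submodule_def by blast
    qed
    show "S = UNIV" if S: "csubspace S" "range top \<subseteq> S" "\<And>z v. v \<in> S \<Longrightarrow> \<alpha>V z v \<in> S" for S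
    proof -
      have word: "q (prod_list (map env_incl xs) \<otimes>\<^sub>t w) \<in> S" for xs w
      proof (induct xs)
        case Nil
        then show ?case using S(2) by (auto simp: top_def)
      next
        case (Cons x xs)
        then show ?case using S(3)[of _ x] by (simp add: act[symmetric])
      qed
      have "q t \<in> S" for t
      proof (induct t rule: tensor_induct)
        case (tens u w)
        have "clinear (\<lambda>u. q (u \<otimes>\<^sub>t w))"
          by (intro clinearI) (simp_all add: tens_add_left tens_scale_left clinear_add[OF lin] clinear_scale[OF lin])
        then show ?case
          using S(1) _ env_spanned_by_words by (rule clinear_span_subset) (use word in blast)
      qed (simp add: clinear_add[OF lin] complex_vector.subspace_add[OF S(1)])
      then show ?thesis using surj by (metis UNIV_eq_I)
    qed
    show "csubspace (range top)"
      by (rule clinear_image_subspace[OF lin_top complex_vector.subspace_UNIV])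
    show "\<exists>w\<^sub>0\<in>range top \<inter> \<Gamma>V 0. \<exists>w\<^sub>1\<in>range top \<inter> \<Gamma>V 1. v = w\<^sub>0 + w\<^sub>1" if v: "v \<in> range top" for v
    proof -
      obtain w where w: "v = top w" using v by blast
      obtain w\<^sub>0 w\<^sub>1 where d: "w = w\<^sub>0 + w\<^sub>1" "w\<^sub>0 \<in> \<Gamma>H 0" "w\<^sub>1 \<in> \<Gamma>H 1"
        using super_module_graded(2)[OF sm] by blast
      have "top w \<in> \<Gamma>V k" if "w \<in> \<Gamma>H k" for w k
        unfolding grV' top_def using that one_in_env_gr
        by (intro complex_vector.span_base) (force intro: exI[of _ 0])
      then show ?thesis
        using d by (intro bexI[of _ "top w\<^sub>0"] bexI[of _ "top w\<^sub>1"]) (auto simp: w clinear_add[OF lin_top])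
    qed
    show "finite_dimensional (range top)"
    proof -
      obtain B where B: "finite B" "(UNIV :: 'h set) \<subseteq> cspan B"
        using finH unfolding finite_dimensional_def by blast
      have "range top \<subseteq> cspan (top ` B)"
        unfolding clinear_image_span[OF lin_top, symmetric] using B(2) by blast
      then show ?thesis unfolding finite_dimensional_def using B(1) by blast
    qed
    show "\<alpha>V (x \<otimes>\<^sub>t f) v \<in> range top" if "x \<in> q_h0 \<union> q_h1" "v \<in> range top" for x f v
      using top_h[OF that(1)] that(2) by blast
    show "\<alpha>V (x \<otimes>\<^sub>t f) v = 0" if x: "x \<in> q_nplus" and v: "v \<in> range top" for x f v
    proof -
      obtain w where w: "v = top w" using v by blast
      have "extended_H_action \<alpha>H (x \<otimes>\<^sub>t f) w = \<alpha>H 0 w"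
        by (simp add: extended_H_action_eq(2)[OF mem[OF x]])
      also have "\<alpha>H 0 w = 0"
      proof -
        have "0 \<in> tensor_span (q_h :: 'n queer set) (UNIV :: 'a set)"
          unfolding tensor_span_def by (rule complex_vector.span_zero)
        then have "\<alpha>H (0 *\<^sub>C 0) w = 0 *\<^sub>C \<alpha>H 0 w" using sm unfolding super_module_def by blast
        then show ?thesis by simp
      qed
      finally show ?thesis
        unfolding w using top_act[OF mem[OF subsetD[OF borel_components(2) x]], of f w]
        by (simp add: clinear_zero[OF lin_top])
    qed
    show "\<alpha>V (h \<otimes>\<^sub>t 1) v = (if h \<in> q_h0 then \<psi> (h \<otimes>\<^sub>t 1) else 0) *\<^sub>C v"
      if "h \<in> q_h0" "v \<in> range top" for h v
      using that by (auto simp: top_h scalar mem clinear_scale[OF lin_top])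
    show "(\<lambda>h. if h \<in> q_h0 then \<psi> (h \<otimes>\<^sub>t 1) else 0) \<in> dual_space q_h0"
      using psi by (rule L_functional_weight)
    show "alg_ideal I" "finite_codimensional I" by (rule I)+
    show "\<alpha>V (x \<otimes>\<^sub>t f) v = 0" if "x \<in> q_h0 \<union> q_h1" "f \<in> I" "v \<in> range top" for x f v
      using that(3)
      by (auto simp: top_h[OF that(1)] H_module_cartan_ideal_zero[OF H I(1,3) that(1,2)]
          clinear_zero[OF lin_top])
  qed
qed

theorem theorem5p6:
  fixes n :: nat
    and \<psi> :: "('n::{finite, linorder}, 'a::comm_complex_algebra_1) queer_map \<Rightarrow> complex"
    and \<Gamma>H :: "bit \<Rightarrow> 'h::complex_vector set" and \<alpha>H :: "('n, 'a) queer_map \<Rightarrow> 'h \<Rightarrow> 'h"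
    and \<Gamma>M :: "bit \<Rightarrow> 'm::complex_vector set" and \<alpha>M :: "('n, 'a) queer_map \<Rightarrow> 'm \<Rightarrow> 'm"
    and \<Gamma>V :: "bit \<Rightarrow> 'v::complex_vector set" and \<alpha>V :: "('n, 'a) queer_map \<Rightarrow> 'v \<Rightarrow> 'v"
    and p :: "(('n, 'a) queer_map env, 'h) tensor \<Rightarrow> 'm" and N :: "'m set" and \<pi> :: "'m \<Rightarrow> 'v"
  assumes n: "CARD('n) = n + 1" "n \<ge> 2"
    and psi: "\<psi> \<in> L_functionals"
    and H: "is_H_module \<psi> \<Gamma>H \<alpha>H"
    and Vbar: "is_induced_module (tensor_span q_b UNIV) \<Gamma>H (extended_H_action \<alpha>H) \<Gamma>M \<alpha>M p"
    and N: "unique_maximal_submodule UNIV \<Gamma>M \<alpha>M N"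
    and V: "is_quotient_module \<Gamma>M \<alpha>M N \<Gamma>V \<alpha>V \<pi>"
  shows "(quasifinite \<alpha>V \<longleftrightarrow>
            (\<exists>I::'a set. alg_ideal I \<and> finite_codimensional I \<and> ideal_annihilates I \<alpha>V)) \<and>
         (quasifinite \<alpha>V \<longleftrightarrow>
            (\<exists>I::'a set. alg_ideal I \<and> finite_codimensional I \<and>
              (\<forall>z\<in>tensor_span q_h0 I. \<psi> z = 0))) \<and>
         (finitely_generated_algebra TYPE('a) \<longrightarrow>
            (quasifinite \<alpha>V \<longleftrightarrow> finite (module_support \<alpha>V)))"
proof -
  obtain I where I: "alg_ideal I" "finite_codimensional I" "\<forall>z\<in>tensor_span q_h0 I. \<psi> z = 0"
    using psi unfolding L_functionals_def by blast
  have "maximal_submodule UNIV \<Gamma>M \<alpha>M N" using N by (simp add: unique_maximal_submodule_def)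
  from psi H Vbar this V I
  interpret irreducible_highest_weight \<alpha>V \<Gamma>V "range (\<lambda>w. \<pi> (p (1 \<otimes>\<^sub>t w)))"
    "\<lambda>h. if h \<in> q_h0 then \<psi> (h \<otimes>\<^sub>t 1) else 0" I
    by (rule V_irreducible_highest_weight)
  show ?thesis
  proof (intro conjI impI iffI)
    show "\<exists>I::'a set. alg_ideal I \<and> finite_codimensional I \<and> ideal_annihilates I \<alpha>V"
      using I(1,2) ideal_annihilates_module by blast
    show "\<exists>I::'a set. alg_ideal I \<and> finite_codimensional I \<and> (\<forall>z\<in>tensor_span q_h0 I. \<psi> z = 0)"
      using I by blast
  qed (rule quasifinite finite_module_support)+
qed

end
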